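(* Let $r\ge 2$ and let $s,p,n$ be positive integers with $n=4p=2r+s$ and $p+s+2=n+1$. Put $$P(x)=K\sum_{k=0}^{r-1}(-1)^k\binom{r-1}{k}\frac{x^{2r-2k-1}}{2r-2k-1}+C,\qquad C=-\frac12,\quad K=\frac{(-1)^{r+1}(2r-1)!!}{2\,(2(r-1))!!},$$ $$Q_1(x)=-(2x+1)^4+1,\qquad Q_2(x)=4x(x-1)(x-i)(x-1-i).$$ Then the Shabat polynomials of the two trees with passport $[r^2,1^s;4^p;n]$ are (up to equivalence) the compositions $Q_1(P(x))$ and $Q_2(-P(ix))$, one for each tree.
   Context: Here $i=\sqrt{-1}$ and $m!!$ is the double factorial. A Shabat polynomial is a complex polynomial with at most two finite critical values $c_1,c_2$. Its tree is the bicolored plane tree $P^{-1}([c_1,c_2])$, with black vertices the points of $P^{-1}(c_1)$, white vertices the points of $P^{-1}(c_2)$, edges the connected components of the preimage of the open segment $(c_1,c_2)$, and vertex degree equal to the multiplicity of the corresponding root of $P-c_1$ or $P-c_2$. Two Shabat polynomials $P,Q$ (with ordered critical values $c_{1,1},c_{1,2}$ and $c_{2,1},c_{2,2}$) are equivalent if $Q(x)=AP(ax+b)+B$ with $A,a\ne 0$ and $c_{2,j}=Ac_{1,j}+B$ for $j=1,2$; bicolored plane trees (up to color- and orientation-preserving isomorphism) correspond bijectively to Shabat polynomials up to equivalence. The passport $[\alpha;\beta;n]$ of a tree with $n$ edges records the partition $\alpha\vdash n$ of black vertex degrees and $\beta\vdash n$ of white vertex degrees ($k^m$ means $k$ repeated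 $m$ times). Under the stated conditions there are exactly two trees with passport $[r^2,1^s;4^p;n]$. In the claim, $c_1=0$ and $c_2=1$ for both compositions. *)

theory Defs
  imports
    "HOL-Analysis.Analysis"
    "HOL-Computational_Algebra.Polynomial"
    "HOL-Library.Multiset"
    "HOL-Combinatorics.Orbits"
begin

text \<open>
  A finite bicolored graph (parallel edges allowed) with a rotation system: \<open>black_next\<close> and
  \<open>white_next\<close> send an edge to the next one in counterclockwise order around its black,
  respectively white, end. For a tree such a rotation system is the same thing as an embedding
  into the oriented plane, up to orientation-preserving homeomorphism.
\<close>

record ('v, 'e) bicolored_map =
  black_verts :: "'v set"
  white_verts :: "'v set"
  edges :: "'e set"
  black_end :: "'e \<Rightarrow> 'v"
  white_end :: "'e \<Rightarrow> 'v"
  black_next :: "'e \<Rightarrow> 'e"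
  white_next :: "'e \<Rightarrow> 'e"

definition black_star :: "('v, 'e) bicolored_map \<Rightarrow> 'v \<Rightarrow> 'e set" where
  "black_star T v = {e \<in> edges T. black_end T e = v}"

definition white_star :: "('v, 'e) bicolored_map \<Rightarrow> 'v \<Rightarrow> 'e set" where
  "white_star T v = {e \<in> edges T. white_end T e = v}"

text \<open>
  \<open>cyclic_on\<close> fails on the empty set, so every vertex has at least one edge. This only excludes
  the tree without edges, which is not the tree of a Shabat polynomial.
\<close>

definition bicolored_map :: "('v, 'e) bicolored_map \<Rightarrow> bool" where
  "bicolored_map T \<longleftrightarrow>
     finite (edges T) \<and> edges T \<noteq> {} \<and>
     black_verts T \<inter> white_verts T = {} \<and>
     black_end T ` edges T \<subseteq> black_verts T \<and>
     white_end T ` edges T \<subseteq> white_verts T \<and>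
     (\<forall>v \<in> black_verts T. cyclic_on (black_next T) (black_star T v)) \<and>
     (\<forall>v \<in> white_verts T. cyclic_on (white_next T) (white_star T v))"

definition adjacency :: "('v, 'e) bicolored_map \<Rightarrow> ('v \<times> 'v) set" where
  "adjacency T = {(black_end T e, white_end T e) | e. e \<in> edges T}"

definition connected_map :: "('v, 'e) bicolored_map \<Rightarrow> bool" where
  "connected_map T \<longleftrightarrow>
     (\<forall>u \<in> black_verts T \<union> white_verts T. \<forall>v \<in> black_verts T \<union> white_verts T.
        (u, v) \<in> (adjacency T \<union> (adjacency T)\<inverse>)\<^sup>*)"

text \<open>
  A cycle of length \<open>2 * k\<close> runs through the edges
  \<open>x 0, y 0, x 1, y 1, \<dots>, x (k - 1), y (k - 1)\<close>, where \<open>x i\<close> goes from a black to a white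
  vertex and \<open>y i\<close> from there to the next black vertex. For \<open>k = 1\<close> it is a pair of
  parallel edges.
\<close>

definition has_cycle :: "('v, 'e) bicolored_map \<Rightarrow> bool" where
  "has_cycle T \<longleftrightarrow>
     (\<exists>k x y. 0 < k \<and>
        (\<forall>i<k. x i \<in> edges T \<and> y i \<in> edges T \<and> x i \<noteq> y i \<and>
           white_end T (x i) = white_end T (y i) \<and>
           black_end T (y i) = black_end T (x (Suc i mod k))) \<and>
        inj_on (\<lambda>i. black_end T (x i)) {..<k} \<and>
        inj_on (\<lambda>i. white_end T (x i)) {..<k})"

definition bicolored_plane_tree :: "('v, 'e) bicolored_map \<Rightarrow> bool" where
  "bicolored_plane_tree T \<longleftrightarrow> bicolored_map T \<and> connected_map T \<and> \<not> has_cycle T"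

definition isomorphic_maps ::
  "('v, 'e) bicolored_map \<Rightarrow> ('w, 'f) bicolored_map \<Rightarrow> bool" where
  "isomorphic_maps T U \<longleftrightarrow>
     (\<exists>\<phi> \<psi>. bij_betw \<phi> (black_verts T) (black_verts U) \<and>
            bij_betw \<phi> (white_verts T) (white_verts U) \<and>
            bij_betw \<psi> (edges T) (edges U) \<and>
            (\<forall>e \<in> edges T.
               black_end U (\<psi> e) = \<phi> (black_end T e) \<and>
               white_end U (\<psi> e) = \<phi> (white_end T e) \<and>
               black_next U (\<psi> e) = \<psi> (black_next T e) \<and>
               white_next U (\<psi> e) = \<psi> (white_next T e)))"

text \<open>The multisets of black and of white vertex degrees, and the number of edges.\<close>

definition passport :: "('v, 'e) bicolored_map \<Rightarrow> nat multiset \<times> nat multiset \<times> nat" where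
  "passport T =
     (image_mset (\<lambda>v. card (black_star T v)) (mset_set (black_verts T)),
      image_mset (\<lambda>v. card (white_star T v)) (mset_set (white_verts T)),
      card (edges T))"

definition shabat :: "complex poly \<Rightarrow> complex \<Rightarrow> complex \<Rightarrow> bool" where
  "shabat F c1 c2 \<longleftrightarrow>
     degree F > 0 \<and> c1 \<noteq> c2 \<and> (\<forall>z. poly (pderiv F) z = 0 \<longrightarrow> poly F z \<in> {c1, c2})"

definition preimage_edges :: "complex poly \<Rightarrow> complex \<Rightarrow> complex \<Rightarrow> complex set set" where
  "preimage_edges F c1 c2 = components (poly F -` open_segment c1 c2)"

text \<open>The unit vector tangent at its end \<open>v\<close> to the arc \<open>e\<close>, pointing into \<open>e\<close>.\<close>

definition direction :: "complex \<Rightarrow> complex set \<Rightarrow> complex" where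
  "direction v e = Lim (at v within e) (\<lambda>z. sgn (z - v))"

text \<open>
  The angle in the half-open interval from 0 (excluded) to \<open>2 * pi\<close> (included) by which \<open>u\<close>
  has to be turned counterclockwise to reach \<open>w\<close>. A full turn is used for \<open>u = w\<close>, so that an edge
  is its own successor only at a vertex of degree 1.
\<close>

definition ccw_angle :: "complex \<Rightarrow> complex \<Rightarrow> real" where
  "ccw_angle u w = (if u = w then 2 * pi else Arg2pi (w / u))"

definition next_edge :: "complex set set \<Rightarrow> complex \<Rightarrow> complex set \<Rightarrow> complex set" where
  "next_edge E v e =
     arg_min (\<lambda>e'. ccw_angle (direction v e) (direction v e')) (\<lambda>e'. e' \<in> E \<and> v \<in> closure e')"

definition edge_end :: "complex poly \<Rightarrow> complex \<Rightarrow> complex set \<Rightarrow> complex" where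
  "edge_end F c e = (THE v. v \<in> closure e \<and> poly F v = c)"

definition shabat_tree ::
  "complex poly \<Rightarrow> complex \<Rightarrow> complex \<Rightarrow> (complex, complex set) bicolored_map" where
  "shabat_tree F c1 c2 =
     \<lparr>black_verts = {z. poly F z = c1},
      white_verts = {z. poly F z = c2},
      edges = preimage_edges F c1 c2,
      black_end = edge_end F c1,
      white_end = edge_end F c2,
      black_next = (\<lambda>e. next_edge (preimage_edges F c1 c2) (edge_end F c1 e) e),
      white_next = (\<lambda>e. next_edge (preimage_edges F c1 c2) (edge_end F c2 e) e)\<rparr>"

definition shabat_polynomial_of ::
  "('v, 'e) bicolored_map \<Rightarrow> complex poly \<Rightarrow> complex \<Rightarrow> complex \<Rightarrow> bool" where
  "shabat_polynomial_of T F c1 c2 \<longleftrightarrow> shabat F c1 c2 \<and> isomorphic_maps (shabat_tree F c1 c2) T"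

definition shabat_equivalent ::
  "complex poly \<Rightarrow> complex \<Rightarrow> complex \<Rightarrow> complex poly \<Rightarrow> complex \<Rightarrow> complex \<Rightarrow> bool" where
  "shabat_equivalent F c1 c2 G d1 d2 \<longleftrightarrow>
     (\<exists>A B a b. A \<noteq> 0 \<and> a \<noteq> 0 \<and> G = smult A (F \<circ>\<^sub>p [:b, a:]) + [:B:] \<and>
        d1 = A * c1 + B \<and> d2 = A * c2 + B)"

fun double_fact :: "nat \<Rightarrow> nat" where
  "double_fact 0 = 1"
| "double_fact (Suc 0) = 1"
| "double_fact (Suc (Suc m)) = Suc (Suc m) * double_fact m"

end

theory Submission
  imports
    Defs
    "HOL-Complex_Analysis.Complex_Analysis"
    "HOL-Computational_Algebra.Computational_Algebra"
begin

text \<open>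
  Combinatorially, two black vertices of degree \<open>r\<close> and \<open>2 * r - 1\<close> white vertices of degree 4 force
  exactly one white vertex adjacent to both hubs, and the plane tree is determined by whether the
  hubs are opposite or adjacent around it.

  Analytically, a Shabat polynomial for \<open>0\<close>, \<open>1\<close> with this passport has the form \<open>1 - h ^ 4\<close> with
  \<open>h' = \<kappa> (x - \<alpha>)^(r - 1) (x - \<beta>)^(r - 1)\<close>. After moving \<open>\<alpha>\<close>, \<open>\<beta>\<close> to \<open>1\<close>, \<open>- 1\<close> the polynomial \<open>h\<close> is an
  affine function of \<open>P\<close>, and \<open>h \<alpha>\<close>, \<open>h \<beta>\<close> are distinct fourth roots of unity. Their quotient is \<open>- 1\<close>
  for \<open>F1\<close> and \<open>\<plusminus> \<i>\<close> for \<open>F2\<close>. Since \<open>h\<close> is multiplied by \<open>\<i>\<close> from the black end of one edge at a white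
  vertex to that of the next, the quotient is also the angle between the hubs, so that it separates
  the two trees.

  That the preimage of the segment is a plane tree with vertex degrees equal to the multiplicities
  follows from covering theory over the complement of the critical values, a power coordinate at
  each vertex, and the maximum principle, which excludes cycles.
\<close>

section \<open>Maps as pairs of rotations\<close>

text \<open>Maps and polynomials with this passport are classified separately: each side has at most
  two classes, and \<open>F1\<close>, \<open>F2\<close> realise two non-isomorphic trees. Hence the
  preimages of the segment themselves serve as \<open>T1\<close>, \<open>T2\<close>, and a
  polynomial with tree \<open>T1\<close> can only be equivalent to \<open>F1\<close>: it has the
  same passport, and \<open>F2\<close> has the other tree. The obstacle is that the rotations are
  defined through limits of directions of arcs and a least angle, so the local picture at every
  vertex has to be established before the preimage can be treated as a combinatorial object. The
  constants normalise the primitive: \<open>K\<close> makes P(1) - P(-1) = 1 and \<open>C\<close>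
  places P(1) at 0, so that h = (1 - \<rho>) P + 1 takes the values 1 and \<rho> at the two hubs.
  Then \<rho> = -1 turns 1 - h^4 into Q1(P), and \<rho> = \<i> turns it into Q2(-P).\<close>

lemma cyclic_on_funpow_card:
  assumes "cyclic_on f S" "x \<in> S"
  shows "(f ^^ card S) x = x" "S = {(f ^^ j) x | j. j < card S}"
proof -
  have S: "S = orbit f x" and x: "x \<in> orbit f x"
    using assms by (auto simp: cyclic_on_alldef)
  let ?d = "funpow_dist1 f x x"
  have inj: "inj_on (\<lambda>n. (f ^^ n) x) {0..<?d}"
    by (intro inj_on_funpow_dist1 x)
  have eq: "S = (\<lambda>n. (f ^^ n) x) ` {0..<?d}"
    unfolding S by (rule orbit_conv_funpow_dist1[OF x])
  \<comment> \<open>The iterates up to the first return are distinct, so the return time is the size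
    of the cycle.\<close>
  have d: "card S = ?d"
    using card_image[OF inj] by (simp only: eq card_atLeastLessThan diff_zero)
  show "(f ^^ card S) x = x"
    unfolding d by (rule funpow_dist1_prop[OF x])
  show "S = {(f ^^ j) x | j. j < card S}"
  proof -
    have "S = (\<lambda>n. (f ^^ n) x) ` {0..<card S}" unfolding d by (rule eq)
    also have "\<dots> = {(f ^^ j) x | j. j < card S}" by auto
    finally show ?thesis .
  qed
qed

text \<open>Statements about white vertices are obtained from those about black ones through this
  symmetry; for polynomials it is the passage from F to 1 - F, see
  \<open>shabat_tree_reflect\<close>.\<close>

definition swap_colors :: "('v, 'e) bicolored_map \<Rightarrow> ('v, 'e) bicolored_map" where
  "swap_colors T = \<lparr>black_verts = white_verts T, white_verts = black_verts T, edges = edges T,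
     black_end = white_end T, white_end = black_end T,
     black_next = white_next T, white_next = black_next T\<rparr>"

lemma swap_colors_simps [simp]:
  "black_verts (swap_colors T) = white_verts T" "white_verts (swap_colors T) = black_verts T"
  "edges (swap_colors T) = edges T" "black_end (swap_colors T) = white_end T"
  "white_end (swap_colors T) = black_end T" "black_next (swap_colors T) = white_next T"
  "white_next (swap_colors T) = black_next T"
  "black_star (swap_colors T) = white_star T" "white_star (swap_colors T) = black_star T"
  by (simp_all add: swap_colors_def black_star_def white_star_def fun_eq_iff)

lemma bicolored_map_swap_colors: "bicolored_map T \<Longrightarrow> bicolored_map (swap_colors T)"
  by (auto simp: bicolored_map_def)

lemma black_nextD:
  assumes "bicolored_map T" "e \<in> edges T"
  shows "black_end T e \<in> black_verts T" "black_next T e \<in> edges T"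
    "black_end T (black_next T e) = black_end T e"
    "cyclic_on (black_next T) (black_star T (black_end T e))"
proof -
  show v: "black_end T e \<in> black_verts T"
    using assms by (auto simp: bicolored_map_def)
  show c: "cyclic_on (black_next T) (black_star T (black_end T e))"
    using assms v by (auto simp: bicolored_map_def)
  have "black_next T e \<in> black_star T (black_end T e)"
    using cyclic_on_inI[OF c] assms by (auto simp: black_star_def)
  then show "black_next T e \<in> edges T" "black_end T (black_next T e) = black_end T e"
    by (auto simp: black_star_def)
qed

lemma white_nextD:
  assumes "bicolored_map T" "e \<in> edges T"
  shows "white_end T e \<in> white_verts T" "white_next T e \<in> edges T"
    "white_end T (white_next T e) = white_end T e"
    "cyclic_on (white_next T) (white_star T (white_end T e))"
  using black_nextD[OF bicolored_map_swap_colors[OF assms(1)], of e] assms(2) by auto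

lemma funpow_black_next:
  assumes "bicolored_map T" "e \<in> edges T"
  shows "(black_next T ^^ k) e \<in> edges T \<and> black_end T ((black_next T ^^ k) e) = black_end T e"
  by (induction k) (use assms black_nextD[OF assms(1)] in auto)

lemma funpow_white_next:
  assumes "bicolored_map T" "e \<in> edges T"
  shows "(white_next T ^^ k) e \<in> edges T \<and> white_end T ((white_next T ^^ k) e) = white_end T e"
  using funpow_black_next[OF bicolored_map_swap_colors[OF assms(1)], of e] assms(2) by auto

lemma black_end_eq_iff:
  assumes "bicolored_map T" "e \<in> edges T" "f \<in> edges T"
  shows "black_end T e = black_end T f \<longleftrightarrow> f \<in> orbit (black_next T) e"
proof -
  have "e \<in> black_star T (black_end T e)" using assms by (simp add: black_star_def)
  with black_nextD(4)[OF assms(1,2)] have "orbit (black_next T) e = black_star T (black_end T e)"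
    by (rule orbit_cyclic_eq3)
  then show ?thesis using assms(3) by (simp add: black_star_def eq_commute)
qed

lemma black_verts_eq:
  assumes "bicolored_map T"
  shows "black_verts T = black_end T ` edges T"
proof -
  have "\<exists>e\<in>edges T. black_end T e = v" if "v \<in> black_verts T" for v
  proof -
    have "cyclic_on (black_next T) (black_star T v)" using assms that by (auto simp: bicolored_map_def)
    then have "black_star T v \<noteq> {}" by (simp add: cyclic_on_alldef)
    then show ?thesis by (auto simp: black_star_def)
  qed
  moreover have "black_end T ` edges T \<subseteq> black_verts T"
    using assms by (simp add: bicolored_map_def)
  ultimately show ?thesis by blast
qed

lemma white_verts_eq: "bicolored_map T \<Longrightarrow> white_verts T = white_end T ` edges T"
  using black_verts_eq[OF bicolored_map_swap_colors, of T] by simp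

text \<open>A bijection of the edges commuting with both rotations determines the bijection of the
  vertices, because the stars are the orbits of the rotations.\<close>

definition edge_iso :: "('v, 'e) bicolored_map \<Rightarrow> ('w, 'f) bicolored_map \<Rightarrow> ('e \<Rightarrow> 'f) \<Rightarrow> bool" where
  "edge_iso T U \<psi> \<longleftrightarrow> bij_betw \<psi> (edges T) (edges U) \<and>
     (\<forall>e \<in> edges T. black_next U (\<psi> e) = \<psi> (black_next T e) \<and>
                     white_next U (\<psi> e) = \<psi> (white_next T e))"

lemma edge_iso_swap: "edge_iso T U \<psi> \<Longrightarrow> edge_iso (swap_colors T) (swap_colors U) \<psi>"
  by (auto simp: edge_iso_def)

lemma edge_iso_black_end:
  assumes "bicolored_map T" "bicolored_map U" "edge_iso T U \<psi>" "e \<in> edges T" "f \<in> edges T"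
  shows "black_end U (\<psi> e) = black_end U (\<psi> f) \<longleftrightarrow> black_end T e = black_end T f"
proof -
  let ?s = "black_next T" and ?s' = "black_next U"
  have bij: "bij_betw \<psi> (edges T) (edges U)"
    using assms(3) by (simp add: edge_iso_def)
  have com: "?s' (\<psi> x) = \<psi> (?s x)" if "x \<in> edges T" for x
    using assms(3) that by (auto simp: edge_iso_def)
  have sub: "orbit ?s e \<subseteq> edges T"
  proof
    fix x assume "x \<in> orbit ?s e"
    then show "x \<in> edges T"
      by induction (auto simp: assms black_nextD)
  qed
  have "e \<in> orbit ?s e" using black_end_eq_iff[OF assms(1,4,4)] by simp
  then have "\<psi> ` orbit ?s e = orbit ?s' (\<psi> e)"
    by (rule orbit_inverse) (use com sub in auto)
  moreover have "\<psi> f \<in> \<psi> ` orbit ?s e \<longleftrightarrow> f \<in> orbit ?s e"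
  proof
    assume "\<psi> f \<in> \<psi> ` orbit ?s e"
    then obtain x where "x \<in> orbit ?s e" "\<psi> f = \<psi> x" by blast
    then show "f \<in> orbit ?s e" using inj_onD[of \<psi> "edges T" f x] bij sub assms(5) by (auto simp: bij_betw_def)
  qed auto
  ultimately show ?thesis
    using black_end_eq_iff[OF assms(1,4,5)] black_end_eq_iff[OF assms(2), of "\<psi> e" "\<psi> f"]
      bij_betwE[OF bij] assms(4,5) by simp
qed

lemma isomorphic_maps_iff:
  assumes T: "bicolored_map T" and U: "bicolored_map U"
  shows "isomorphic_maps T U \<longleftrightarrow> (\<exists>\<psi>. edge_iso T U \<psi>)"
proof
  assume "isomorphic_maps T U"
  then show "\<exists>\<psi>. edge_iso T U \<psi>"
    unfolding isomorphic_maps_def edge_iso_def by (elim exE conjE) (intro exI conjI, assumption, simp)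
next
  assume "\<exists>\<psi>. edge_iso T U \<psi>"
  then obtain \<psi> where iso: "edge_iso T U \<psi>" by blast
  have bij: "bij_betw \<psi> (edges T) (edges U)" using iso by (simp add: edge_iso_def)
  have b: "black_end U (\<psi> e) = black_end U (\<psi> f) \<longleftrightarrow> black_end T e = black_end T f"
    if "e \<in> edges T" "f \<in> edges T" for e f using edge_iso_black_end[OF T U iso that] .
  have w: "white_end U (\<psi> e) = white_end U (\<psi> f) \<longleftrightarrow> white_end T e = white_end T f"
    if "e \<in> edges T" "f \<in> edges T" for e f
    using edge_iso_black_end[OF bicolored_map_swap_colors[OF T] bicolored_map_swap_colors[OF U]
        edge_iso_swap[OF iso], of e f] that by simp
  \<comment> \<open>A vertex goes to the end of the image of any edge at it. The facts
    \<open>b\<close> and \<open>w\<close> make the choice of the edge irrelevant, and disjointness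
    of the colours makes the case distinction harmless.\<close>
  define \<phi> where "\<phi> v = (if v \<in> black_verts T
       then black_end U (\<psi> (SOME e. e \<in> edges T \<and> black_end T e = v))
       else white_end U (\<psi> (SOME e. e \<in> edges T \<and> white_end T e = v)))" for v
  have \<phi>b: "\<phi> (black_end T e) = black_end U (\<psi> e)" if "e \<in> edges T" for e
  proof -
    have "(SOME f. f \<in> edges T \<and> black_end T f = black_end T e) \<in> edges T \<and>
          black_end T (SOME f. f \<in> edges T \<and> black_end T f = black_end T e) = black_end T e"
      by (rule someI[of _ e]) (use that in auto)
    then show ?thesis
      using that T b by (auto simp: \<phi>_def black_nextD)
  qed
  have \<phi>w: "\<phi> (white_end T e) = white_end U (\<psi> e)" if "e \<in> edges T" for e
  proof -
    have "(SOME f. f \<in> edges T \<and> white_end T f = white_end T e) \<in> edges T \<and>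
          white_end T (SOME f. f \<in> edges T \<and> white_end T f = white_end T e) = white_end T e"
      by (rule someI[of _ e]) (use that in auto)
    moreover have "white_end T e \<notin> black_verts T"
      using T that by (auto simp: bicolored_map_def)
    ultimately show ?thesis
      using that T w by (auto simp: \<phi>_def)
  qed
  have "bij_betw \<phi> (black_verts T) (black_verts U)"
  proof (rule bij_betw_imageI)
    show "inj_on \<phi> (black_verts T)"
      unfolding black_verts_eq[OF T] using b \<phi>b by (auto simp: inj_on_def)
    have "\<phi> ` black_verts T = black_end U ` \<psi> ` edges T"
      unfolding black_verts_eq[OF T] image_image using \<phi>b by (intro image_cong) auto
    then show "\<phi> ` black_verts T = black_verts U"
      using bij black_verts_eq[OF U] by (simp add: bij_betw_def)
  qed
  moreover have "bij_betw \<phi> (white_verts T) (white_verts U)"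
  proof (rule bij_betw_imageI)
    show "inj_on \<phi> (white_verts T)"
      unfolding white_verts_eq[OF T] using w \<phi>w by (auto simp: inj_on_def)
    have "\<phi> ` white_verts T = white_end U ` \<psi> ` edges T"
      unfolding white_verts_eq[OF T] image_image using \<phi>w by (intro image_cong) auto
    then show "\<phi> ` white_verts T = white_verts U"
      using bij white_verts_eq[OF U] by (simp add: bij_betw_def)
  qed
  ultimately show "isomorphic_maps T U"
    unfolding isomorphic_maps_def using iso \<phi>b \<phi>w by (intro exI[of _ \<phi>] exI[of _ \<psi>]) (auto simp: edge_iso_def)
qed

lemma isomorphic_maps_refl: "bicolored_map T \<Longrightarrow> isomorphic_maps T T"
  unfolding isomorphic_maps_iff by (rule exI[of _ id]) (simp add: edge_iso_def)

lemma isomorphic_maps_sym: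
  assumes T: "bicolored_map T" and U: "bicolored_map U" and "isomorphic_maps T U"
  shows "isomorphic_maps U T"
proof -
  obtain \<psi> where iso: "edge_iso T U \<psi>" using assms isomorphic_maps_iff by blast
  have bij: "bij_betw \<psi> (edges T) (edges U)" using iso by (simp add: edge_iso_def)
  let ?\<psi> = "inv_into (edges T) \<psi>"
  have "black_next T (?\<psi> f) = ?\<psi> (black_next U f) \<and> white_next T (?\<psi> f) = ?\<psi> (white_next U f)"
    if "f \<in> edges U" for f
  proof -
    have "f \<in> \<psi> ` edges T" using that bij by (simp add: bij_betw_def)
    then obtain e where e: "e \<in> edges T" "f = \<psi> e" by blast
    then show ?thesis
      using iso bij black_nextD(2)[OF T e(1)] white_nextD(2)[OF T e(1)]
      by (simp add: edge_iso_def bij_betw_inv_into_left)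
  qed
  then have "edge_iso U T ?\<psi>"
    unfolding edge_iso_def using bij_betw_inv_into[OF bij] by blast
  then show ?thesis using isomorphic_maps_iff[OF U T] by blast
qed

lemma isomorphic_maps_trans:
  assumes "isomorphic_maps T U" "isomorphic_maps U W"
  shows "isomorphic_maps T W"
proof -
  obtain \<phi> \<psi> where 1: "bij_betw \<phi> (black_verts T) (black_verts U) \<and>
            bij_betw \<phi> (white_verts T) (white_verts U) \<and>
            bij_betw \<psi> (edges T) (edges U) \<and>
            (\<forall>e \<in> edges T.
               black_end U (\<psi> e) = \<phi> (black_end T e) \<and>
               white_end U (\<psi> e) = \<phi> (white_end T e) \<and>
               black_next U (\<psi> e) = \<psi> (black_next T e) \<and>
               white_next U (\<psi> e) = \<psi> (white_next T e))"
    using assms(1) unfolding isomorphic_maps_def by (elim exE) (rule that)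
  obtain \<phi>' \<psi>' where 2: "bij_betw \<phi>' (black_verts U) (black_verts W) \<and>
            bij_betw \<phi>' (white_verts U) (white_verts W) \<and>
            bij_betw \<psi>' (edges U) (edges W) \<and>
            (\<forall>e \<in> edges U.
               black_end W (\<psi>' e) = \<phi>' (black_end U e) \<and>
               white_end W (\<psi>' e) = \<phi>' (white_end U e) \<and>
               black_next W (\<psi>' e) = \<psi>' (black_next U e) \<and>
               white_next W (\<psi>' e) = \<psi>' (white_next U e))"
    using assms(2) unfolding isomorphic_maps_def by (elim exE) (rule that)
  have mem: "\<psi> e \<in> edges U" if "e \<in> edges T" for e
    using 1 that by (blast dest: bij_betwE)
  show ?thesis
    unfolding isomorphic_maps_def
  proof (intro exI conjI ballI)
    show "bij_betw (\<phi>' \<circ> \<phi>) (black_verts T) (black_verts W)"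
      "bij_betw (\<phi>' \<circ> \<phi>) (white_verts T) (white_verts W)"
      "bij_betw (\<psi>' \<circ> \<psi>) (edges T) (edges W)"
      using 1 2 by (blast intro: bij_betw_trans)+
  qed (use 1 2 mem in simp_all)
qed

lemma edge_iso_black_star:
  assumes T: "bicolored_map T" and U: "bicolored_map U" and iso: "edge_iso T U \<psi>" and e: "e \<in> edges T"
  shows "card (black_star U (black_end U (\<psi> e))) = card (black_star T (black_end T e))"
proof -
  have bij: "bij_betw \<psi> (edges T) (edges U)" using iso by (simp add: edge_iso_def)
  have "black_star U (black_end U (\<psi> e)) = \<psi> ` black_star T (black_end T e)"
    (is "?L = ?R")
  proof
    show "?L \<subseteq> ?R"
    proof
      fix x assume x: "x \<in> ?L"
      then have "x \<in> \<psi> ` edges T" using bij by (simp add: bij_betw_def black_star_def)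
      then obtain y where y: "y \<in> edges T" "x = \<psi> y" by blast
      then show "x \<in> ?R" using x edge_iso_black_end[OF T U iso y(1) e] by (simp add: black_star_def)
    qed
    show "?R \<subseteq> ?L"
    proof
      fix x assume "x \<in> ?R"
      then obtain y where y: "y \<in> edges T" "x = \<psi> y" "black_end T y = black_end T e"
        by (auto simp: black_star_def)
      then show "x \<in> ?L" using edge_iso_black_end[OF T U iso y(1) e] bij_betwE[OF bij]
        by (simp add: black_star_def)
    qed
  qed
  moreover have "inj_on \<psi> (black_star T (black_end T e))"
    using bij by (auto simp: black_star_def bij_betw_def intro: inj_on_subset)
  ultimately show ?thesis by (simp add: card_image)
qed

lemma edge_iso_funpow_white:
  assumes T: "bicolored_map T" and iso: "edge_iso T U \<psi>" and e: "e \<in> edges T"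
  shows "(white_next U ^^ k) (\<psi> e) = \<psi> ((white_next T ^^ k) e)"
proof (induction k)
  case (Suc k)
  have "white_next U (\<psi> ((white_next T ^^ k) e)) = \<psi> (white_next T ((white_next T ^^ k) e))"
    using iso funpow_white_next[OF T e, of k] unfolding edge_iso_def by blast
  then show ?case using Suc by simp
qed simp

lemma isomorphic_black_degrees:
  assumes T: "bicolored_map T" and U: "bicolored_map U" and iso: "isomorphic_maps T U"
  shows "image_mset (\<lambda>v. card (black_star U v)) (mset_set (black_verts U)) =
         image_mset (\<lambda>v. card (black_star T v)) (mset_set (black_verts T))"
proof -
  obtain \<phi> \<psi> where H: "bij_betw \<phi> (black_verts T) (black_verts U) \<and>
            bij_betw \<phi> (white_verts T) (white_verts U) \<and>
            bij_betw \<psi> (edges T) (edges U) \<and>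
            (\<forall>e \<in> edges T.
               black_end U (\<psi> e) = \<phi> (black_end T e) \<and>
               white_end U (\<psi> e) = \<phi> (white_end T e) \<and>
               black_next U (\<psi> e) = \<psi> (black_next T e) \<and>
               white_next U (\<psi> e) = \<psi> (white_next T e))"
    using iso unfolding isomorphic_maps_def by (elim exE) (rule that)
  then have \<phi>: "bij_betw \<phi> (black_verts T) (black_verts U)"
     and e: "\<And>e. e \<in> edges T \<Longrightarrow> black_end U (\<psi> e) = \<phi> (black_end T e)"
     and i: "edge_iso T U \<psi>"
    by (simp_all add: edge_iso_def)
  have deg: "card (black_star U (\<phi> v)) = card (black_star T v)" if "v \<in> black_verts T" for v
  proof -
    obtain x where x: "x \<in> edges T" "v = black_end T x" using \<open>v \<in> black_verts T\<close> black_verts_eq[OF T] by blast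
    show ?thesis using edge_iso_black_star[OF T U i x(1)] e[OF x(1)] x(2) by simp
  qed
  have "mset_set (black_verts U) = image_mset \<phi> (mset_set (black_verts T))"
    using \<phi> by (subst image_mset_mset_set) (auto simp: bij_betw_def)
  moreover have fin: "finite (black_verts T)"
    unfolding black_verts_eq[OF T] using T by (simp add: bicolored_map_def)
  ultimately have "image_mset (\<lambda>v. card (black_star U v)) (mset_set (black_verts U)) =
      image_mset (\<lambda>v. card (black_star U (\<phi> v))) (mset_set (black_verts T))"
    by (simp add: multiset.map_comp o_def)
  also have "\<dots> = image_mset (\<lambda>v. card (black_star T v)) (mset_set (black_verts T))"
    using deg fin by (intro image_mset_cong) simp
  finally show ?thesis .
qed

lemma isomorphic_maps_swap:
  assumes T: "bicolored_map T" and U: "bicolored_map U" and iso: "isomorphic_maps T U"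
  shows "isomorphic_maps (swap_colors T) (swap_colors U)"
  using iso edge_iso_swap[of T U]
  unfolding isomorphic_maps_iff[OF T U]
    isomorphic_maps_iff[OF bicolored_map_swap_colors[OF T] bicolored_map_swap_colors[OF U]]
  by (rule ex_forward)

lemma isomorphic_passport:
  assumes T: "bicolored_map T" and U: "bicolored_map U" and iso: "isomorphic_maps T U"
  shows "passport T = passport U"
proof -
  have "card (edges T) = card (edges U)"
    using iso unfolding isomorphic_maps_iff[OF T U] edge_iso_def
    by (elim exE conjE) (rule bij_betw_same_card)
  then show ?thesis
    using isomorphic_black_degrees[OF T U iso] 
      isomorphic_black_degrees[OF bicolored_map_swap_colors[OF T] bicolored_map_swap_colors[OF U]
        isomorphic_maps_swap[OF T U iso]]
    unfolding passport_def swap_colors_simps by (simp only: prod.inject)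
qed

section \<open>Trees with the passport of the claim\<close>

text \<open>The equations of the claim force \<open>s = 6 * r - 4\<close>, \<open>p = 2 * r - 1\<close> and \<open>n = 8 * r - 4\<close>.\<close>

definition hub_passport :: "nat \<Rightarrow> nat multiset \<times> nat multiset \<times> nat" where
  "hub_passport r = (replicate_mset 2 r + replicate_mset (6 * r - 4) 1,
     replicate_mset (2 * r - 1) 4, 8 * r - 4)"

text \<open>Connectedness is derived from these assumptions in \<open>connected\<close>; for a
  preimage tree this replaces an analytic argument.\<close>

locale hub_map =
  fixes T :: "('v, 'e) bicolored_map" and r :: nat
  assumes map: "bicolored_map T" and acyclic: "\<not> has_cycle T" and r: "r \<ge> 2"
    and pass: "passport T = hub_passport r"
begin

definition hubs :: "'v set" where
  "hubs = {v \<in> black_verts T. card (black_star T v) = r}"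

lemma finite_edges: "finite (edges T)"
  using map by (simp add: bicolored_map_def)

lemma finite_black: "finite (black_verts T)"
  unfolding black_verts_eq[OF map] using finite_edges by simp

lemma finite_white: "finite (white_verts T)"
  unfolding white_verts_eq[OF map] using finite_edges by simp

lemma card_edges: "card (edges T) = 8 * r - 4"
  using pass by (simp add: passport_def hub_passport_def)

lemma black_degrees:
  "image_mset (\<lambda>v. card (black_star T v)) (mset_set (black_verts T)) =
     replicate_mset 2 r + replicate_mset (6 * r - 4) 1"
  using pass by (simp add: passport_def hub_passport_def)

lemma white_degrees:
  "image_mset (\<lambda>v. card (white_star T v)) (mset_set (white_verts T)) = replicate_mset (2 * r - 1) 4"
  using pass by (simp add: passport_def hub_passport_def)

lemma card_hubs: "card hubs = 2"
proof -
  have "card hubs = count (image_mset (\<lambda>v. card (black_star T v)) (mset_set (black_verts T))) r"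
    unfolding hubs_def using finite_black
    by (subst count_image_mset_eq_card_vimage) (simp_all add: eq_commute)
  \<comment> \<open>Here r > 1 keeps the leaves out of the count.\<close>
  also have "\<dots> = 2" unfolding black_degrees using r by simp
  finally show ?thesis .
qed

lemma leaf_degree:
  assumes "v \<in> black_verts T" "v \<notin> hubs"
  shows "card (black_star T v) = 1"
proof -
  have "card (black_star T v) \<in># image_mset (\<lambda>v. card (black_star T v)) (mset_set (black_verts T))"
    using assms finite_black by simp
  then show ?thesis using assms unfolding black_degrees hubs_def
    by (auto simp: in_replicate_mset split: if_splits)
qed

lemma white_degree:
  assumes "w \<in> white_verts T"
  shows "card (white_star T w) = 4"
proof -
  have "card (white_star T w) \<in># image_mset (\<lambda>v. card (white_star T v)) (mset_set (white_verts T))"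
    using assms finite_white by simp
  then show ?thesis unfolding white_degrees by (simp split: if_splits)
qed

lemma card_white: "card (white_verts T) = 2 * r - 1"
proof -
  have "size (image_mset (\<lambda>v. card (white_star T v)) (mset_set (white_verts T))) = 2 * r - 1"
    unfolding white_degrees by simp
  then show ?thesis by simp
qed

text \<open>A pair of parallel edges is a cycle with k = 1.\<close>

lemma no_parallel:
  assumes "e \<in> edges T" "f \<in> edges T" "white_end T e = white_end T f" "black_end T e = black_end T f"
  shows "e = f"
proof (rule ccontr)
  assume "e \<noteq> f"
  then have "has_cycle T"
    unfolding has_cycle_def using assms
    by - (rule exI[of _ "1::nat"], rule exI[of _ "\<lambda>_. e"], rule exI[of _ "\<lambda>_. f"], simp add: inj_on_def)
  then show False using acyclic by blast
qed

text \<open>Otherwise e, f, f', e' would close up to a cycle with k = 2.\<close>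

lemma no_square:
  assumes "e \<in> edges T" "f \<in> edges T" "e' \<in> edges T" "f' \<in> edges T"
    and "white_end T e = white_end T f" "white_end T e' = white_end T f'"
    and "black_end T e = black_end T e'" "black_end T f = black_end T f'"
    and "black_end T e \<noteq> black_end T f"
  shows "white_end T e = white_end T e'"
proof (rule ccontr)
  assume w: "white_end T e \<noteq> white_end T e'"
  have "has_cycle T"
    unfolding has_cycle_def
  proof (intro exI conjI allI impI)
    fix i :: nat assume "i < 2"
    then consider "i = 0" | "i = 1" by linarith
    then show "(if i = 0 then e else f') \<in> edges T" "(if i = 0 then f else e') \<in> edges T"
       "(if i = 0 then e else f') \<noteq> (if i = 0 then f else e')"
       "white_end T (if i = 0 then e else f') = white_end T (if i = 0 then f else e')"
       "black_end T (if i = 0 then f else e') = black_end T (if Suc i mod 2 = 0 then e else f')"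
      using assms by (cases; auto)+
  next
    have *: "{..<2::nat} = {0, 1}" by auto
    show "inj_on (\<lambda>i. black_end T (if i = 0 then e else f')) {..<2::nat}"
      using assms(8,9) unfolding * by simp
    show "inj_on (\<lambda>i. white_end T (if i = 0 then e else f')) {..<2::nat}"
      using assms(6) w unfolding * by simp
  qed simp
  then show False using acyclic by blast
qed

lemma card_white_nbrs:
  assumes "a \<in> hubs"
  shows "card (white_end T ` black_star T a) = r"
proof -
  have "inj_on (white_end T) (black_star T a)"
    by (rule inj_onI) (use no_parallel in \<open>auto simp: black_star_def\<close>)
  then show ?thesis using assms by (simp add: card_image hubs_def)
qed

lemma nbrs_subset: "white_end T ` black_star T a \<subseteq> white_verts T"
  using map by (auto simp: bicolored_map_def black_star_def)

text \<open>The two hubs have \<open>r\<close> white neighbours each, but there are only \<open>2 * r - 1\<close> white vertices.\<close>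

lemma common_white:
  assumes "a \<in> hubs" "b \<in> hubs" "a \<noteq> b"
  shows "\<exists>e\<in>edges T. \<exists>f\<in>edges T. black_end T e = a \<and> black_end T f = b \<and> white_end T e = white_end T f"
proof -
  let ?A = "white_end T ` black_star T a" and ?B = "white_end T ` black_star T b"
  have fin: "finite ?A" "finite ?B" using nbrs_subset finite_white finite_subset by blast+
  have sub: "?A \<union> ?B \<subseteq> white_verts T"
    using nbrs_subset by blast
  have "card (?A \<union> ?B) \<le> 2 * r - 1"
    using card_mono[OF finite_white sub] card_white by simp
  then have "?A \<inter> ?B \<noteq> {}"
    using card_Un_disjoint[OF fin] card_white_nbrs[OF assms(1)] card_white_nbrs[OF assms(2)] r by linarith
  then obtain w where "w \<in> ?A" "w \<in> ?B" by blast
  then show ?thesis unfolding black_star_def by (auto intro!: bexI)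
qed

text \<open>Inclusion and exclusion: two common neighbours of the hubs would form a square, so the
  union of the neighbourhoods has at least r + r - 1 elements, which is the number of all white
  vertices.\<close>

lemma white_nbrs_cover:
  assumes "a \<in> hubs" "b \<in> hubs" "a \<noteq> b"
  shows "white_verts T = white_end T ` black_star T a \<union> white_end T ` black_star T b"
proof -
  let ?A = "white_end T ` black_star T a" and ?B = "white_end T ` black_star T b"
  have fin: "finite ?A" "finite ?B" using nbrs_subset finite_white finite_subset by blast+
  have "x = y" if xy: "x \<in> ?A \<inter> ?B" "y \<in> ?A \<inter> ?B" for x y
  proof -
    obtain e f where e: "e \<in> edges T" "black_end T e = a" "white_end T e = x"
      and f: "f \<in> edges T" "black_end T f = b" "white_end T f = x"
      using xy(1) by (auto simp: black_star_def)
    obtain e' f' where e': "e' \<in> edges T" "black_end T e' = a" "white_end T e' = y"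
      and f': "f' \<in> edges T" "black_end T f' = b" "white_end T f' = y"
      using xy(2) by (auto simp: black_star_def)
    show ?thesis using no_square[OF e(1) f(1) e'(1) f'(1)] e f e' f' assms(3) by simp
  qed
  then have "card (?A \<inter> ?B) \<le> 1"
    unfolding One_nat_def card_le_Suc0_iff_eq[OF finite_Int[OF disjI1[OF fin(1)]]] by blast
  moreover have "r + r = card (?A \<union> ?B) + card (?A \<inter> ?B)"
    using card_Un_Int[OF fin] card_white_nbrs[OF assms(1)] card_white_nbrs[OF assms(2)] by simp
  ultimately have le: "card (white_verts T) \<le> card (?A \<union> ?B)"
    unfolding card_white by linarith
  have sub: "?A \<union> ?B \<subseteq> white_verts T"
    using nbrs_subset by blast
  show ?thesis
    using card_seteq[OF finite_white sub le] by (rule sym)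
qed

lemma white_next4:
  assumes "e \<in> edges T"
  shows "(white_next T ^^ 4) e = e"
    "\<lbrakk>f \<in> edges T; white_end T f = white_end T e\<rbrakk> \<Longrightarrow> \<exists>j<4. f = (white_next T ^^ j) e"
proof -
  have c: "cyclic_on (white_next T) (white_star T (white_end T e))" and e: "e \<in> white_star T (white_end T e)"
    using white_nextD[OF map assms] assms by (auto simp: white_star_def)
  have d: "card (white_star T (white_end T e)) = 4"
    using white_degree white_nextD[OF map assms] by simp
  show "(white_next T ^^ 4) e = e"
    using cyclic_on_funpow_card(1)[OF c e] unfolding d .
  assume f: "f \<in> edges T" "white_end T f = white_end T e"
  then have "f \<in> white_star T (white_end T e)" by (simp add: white_star_def)
  then show "\<exists>j<4. f = (white_next T ^^ j) e"
    using cyclic_on_funpow_card(2)[OF c e] unfolding d by blast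
qed

lemma black_next_hub:
  assumes "e \<in> edges T" "black_end T e \<in> hubs"
  shows "(black_next T ^^ r) e = e"
    "\<lbrakk>f \<in> edges T; black_end T f = black_end T e\<rbrakk> \<Longrightarrow> \<exists>k<r. f = (black_next T ^^ k) e"
proof -
  have c: "cyclic_on (black_next T) (black_star T (black_end T e))" and e: "e \<in> black_star T (black_end T e)"
    using black_nextD[OF map assms(1)] assms by (auto simp: black_star_def)
  have d: "card (black_star T (black_end T e)) = r"
    using assms by (simp add: hubs_def)
  show "(black_next T ^^ r) e = e"
    using cyclic_on_funpow_card(1)[OF c e] unfolding d .
  assume f: "f \<in> edges T" "black_end T f = black_end T e"
  then have "f \<in> black_star T (black_end T e)" by (simp add: black_star_def)
  then show "\<exists>k<r. f = (black_next T ^^ k) e"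
    using cyclic_on_funpow_card(2)[OF c e] unfolding d by blast
qed

lemma black_next_leaf:
  assumes "e \<in> edges T" "black_end T e \<notin> hubs"
  shows "black_next T e = e"
proof -
  have c: "cyclic_on (black_next T) (black_star T (black_end T e))" and e: "e \<in> black_star T (black_end T e)"
    using black_nextD[OF map assms(1)] assms by (auto simp: black_star_def)
  have d: "card (black_star T (black_end T e)) = 1"
    using leaf_degree assms black_nextD[OF map assms(1)] by simp
  show ?thesis
    using cyclic_on_funpow_card(1)[OF c e] unfolding d by simp
qed

end

text \<open>The invariant separating the two trees: \<open>d\<close> can only be 2 for one of them, and is 1 or 3,
  depending on the hub from which one starts, for the other.\<close>

definition hub_type :: "('v, 'e) bicolored_map \<Rightarrow> nat \<Rightarrow> nat \<Rightarrow> bool" where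
  "hub_type T r d \<longleftrightarrow> (\<exists>e\<in>edges T.
     black_end T e \<noteq> black_end T ((white_next T ^^ d) e) \<and>
     card (black_star T (black_end T e)) = r \<and>
     card (black_star T (black_end T ((white_next T ^^ d) e))) = r)"

lemma isomorphic_hub_type:
  assumes T: "bicolored_map T" and U: "bicolored_map U" and "isomorphic_maps T U" and "hub_type T r d"
  shows "hub_type U r d"
proof -
  obtain \<psi> where iso: "edge_iso T U \<psi>" using assms isomorphic_maps_iff by blast
  obtain e where e: "e \<in> edges T"
     "black_end T e \<noteq> black_end T ((white_next T ^^ d) e)"
     "card (black_star T (black_end T e)) = r"
     "card (black_star T (black_end T ((white_next T ^^ d) e))) = r"
    using assms(4) unfolding hub_type_def by blast
  have f: "(white_next T ^^ d) e \<in> edges T" using funpow_white_next[OF T e(1)] by blast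
  have "\<psi> e \<in> edges U" using iso e by (auto simp: edge_iso_def dest: bij_betwE)
  then show ?thesis
    unfolding hub_type_def
    using e f edge_iso_black_end[OF T U iso e(1) f] edge_iso_black_star[OF T U iso e(1)]
      edge_iso_black_star[OF T U iso f] edge_iso_funpow_white[OF T iso e(1), of d]
    by (intro bexI[of _ "\<psi> e"]) simp_all
qed

context hub_map
begin

lemma hub_type_exists: "\<exists>d\<in>{1,2,3}. hub_type T r d"
proof -
  obtain a b where ab: "hubs = {a, b}" "a \<noteq> b" using card_hubs by (auto simp: card_2_iff)
  then obtain e f where ef: "e \<in> edges T" "f \<in> edges T" "black_end T e = a" "black_end T f = b"
    "white_end T e = white_end T f" using common_white[of a b] by blast
  obtain j where j: "j < 4" "f = (white_next T ^^ j) e" using white_next4(2)[OF ef(1,2)] ef(5) by auto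
  have "j \<noteq> 0"
  proof
    assume "j = 0"
    then show False using j ef ab by simp
  qed
  then have "j \<in> {1,2,3}" using j by auto
  moreover have "card (black_star T a) = r" "card (black_star T b) = r"
    using ab(1) by (auto simp: hubs_def)
  ultimately show ?thesis unfolding hub_type_def using ef ab j
    by (intro bexI[of _ j] bexI[of _ e]) simp_all
qed

text \<open>Four turns around a white vertex are the identity, so from the other hub 4 - d turns
  lead back.\<close>

lemma hub_type_reverse:
  assumes "hub_type T r d" "d \<le> 4"
  shows "hub_type T r (4 - d)"
proof -
  obtain e where e: "e \<in> edges T"
     "black_end T e \<noteq> black_end T ((white_next T ^^ d) e)"
     "card (black_star T (black_end T e)) = r"
     "card (black_star T (black_end T ((white_next T ^^ d) e))) = r"
    using assms(1) unfolding hub_type_def by blast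
  have f: "(white_next T ^^ d) e \<in> edges T" using funpow_white_next[OF map e(1)] by blast
  have "(white_next T ^^ (4 - d)) ((white_next T ^^ d) e) = (white_next T ^^ (4 - d + d)) e"
    by (simp only: funpow_add o_apply)
  also have "\<dots> = e" using white_next4(1)[OF e(1)] assms(2) by simp
  finally show ?thesis unfolding hub_type_def using e f
    by (intro bexI[of _ "(white_next T ^^ d) e"]) simp_all
qed

text \<open>Every white vertex is next to a hub, the hubs share a white neighbour, and every black
  vertex lies on an edge; so each vertex is joined to the hub a.\<close>

lemma connected: "connected_map T"
proof -
  let ?R = "(adjacency T \<union> (adjacency T)\<inverse>)\<^sup>*"
  have sym: "sym ?R" by (intro sym_rtrancl sym_Un_converse)
  have be: "(black_end T e, white_end T e) \<in> ?R" if "e \<in> edges T" for e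
    using that by (intro r_into_rtrancl) (auto simp: adjacency_def)
  obtain a b where ab: "hubs = {a, b}" "a \<noteq> b" using card_hubs by (auto simp: card_2_iff)
  then obtain e f where ef: "e \<in> edges T" "f \<in> edges T" "black_end T e = a" "black_end T f = b"
    "white_end T e = white_end T f" using common_white[of a b] by blast
  have ba: "(b, a) \<in> ?R"
    using rtrancl_trans[OF be[OF ef(2), unfolded ef(5)[symmetric]] symD[OF sym be[OF ef(1)]]]
    unfolding ef(3,4) .
  have w: "(w, a) \<in> ?R" if "w \<in> white_verts T" for w
  proof -
    have "w \<in> white_end T ` black_star T a \<union> white_end T ` black_star T b"
      using white_nbrs_cover[of a b] ab that by simp
    then obtain g where g: "g \<in> edges T" "w = white_end T g" "black_end T g \<in> {a, b}"
      by (auto simp: black_star_def)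
    have ga: "(black_end T g, a) \<in> ?R"
    proof (cases "black_end T g = a")
      case False
      then have "black_end T g = b" using g(3) by simp
      then show ?thesis using ba by (simp only:)
    qed (simp only: rtrancl.rtrancl_refl)
    show ?thesis unfolding g(2) by (rule rtrancl_trans[OF symD[OF sym be[OF g(1)]] ga])
  qed
  have all: "(v, a) \<in> ?R" if "v \<in> black_verts T \<union> white_verts T" for v
  proof (cases "v \<in> white_verts T")
    case False
    with that have "v \<in> black_verts T" by simp
    then have "v \<in> black_end T ` edges T" unfolding black_verts_eq[OF map] .
    then obtain g where g: "g \<in> edges T" "v = black_end T g" by blast
    show ?thesis unfolding g(2) by (rule rtrancl_trans[OF be[OF g(1)] w[OF white_nextD(1)[OF map g(1)]]])
  qed (rule w)
  show ?thesis unfolding connected_map_def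
  proof (intro ballI)
    fix u v assume "u \<in> black_verts T \<union> white_verts T" "v \<in> black_verts T \<union> white_verts T"
    then show "(u, v) \<in> ?R" by (intro rtrancl_trans[OF all symD[OF sym all]])
  qed
qed

lemma plane_tree: "bicolored_plane_tree T"
  using map acyclic connected by (simp add: bicolored_plane_tree_def)

end

text \<open>The edge labelled \<open>(c, k, j)\<close> is reached from a hub (the second one if \<open>c\<close>) by \<open>k\<close> turns
  around the hub, starting at the common white neighbour, and \<open>j\<close> turns around the white end.
  The edges at the common white neighbour are only labelled from the first hub.\<close>

definition hub_labels :: "nat \<Rightarrow> (bool \<times> nat \<times> nat) set" where
  "hub_labels r = {(c, k, j). k < r \<and> j < 4 \<and> (c \<longrightarrow> 0 < k)}"

text \<open>The edge joining the second hub to the common white vertex bears the label (False, 0,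
  d), being d white turns away from (False, 0, 0). The cycle around the second hub therefore runs
  through (False, 0, d), (True, 1, 0), ..., (True, r - 1, 0). All other labels with j > 0 belong to
  leaves.\<close>

fun label_black_next :: "nat \<Rightarrow> nat \<Rightarrow> bool \<times> nat \<times> nat \<Rightarrow> bool \<times> nat \<times> nat" where
  "label_black_next r d (c, k, j) =
     (if j = 0 then (if Suc k < r then (c, Suc k, 0) else if c then (False, 0, d) else (False, 0, 0))
      else if (c, k, j) = (False, 0, d) then (True, 1, 0) else (c, k, j))"

fun label_white_next :: "bool \<times> nat \<times> nat \<Rightarrow> bool \<times> nat \<times> nat" where
  "label_white_next (c, k, j) = (c, k, Suc j mod 4)"

text \<open>Equality with the number of edges lets \<open>labelling\<close> deduce injectivity from
  surjectivity.\<close>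

lemma card_hub_labels: "card (hub_labels r) = 8 * r - 4"
proof -
  have eq: "hub_labels r = {False} \<times> {..<r} \<times> {..<4} \<union> {True} \<times> {1..<r} \<times> {..<4}"
    by (auto simp: hub_labels_def)
  show ?thesis unfolding eq by (subst card_Un_disjoint) (auto simp: card_cartesian_product)
qed

lemma label_next_in:
  assumes "x \<in> hub_labels r" "1 \<le> d" "d \<le> 3" "r \<ge> 2"
  shows "label_black_next r d x \<in> hub_labels r" "label_white_next x \<in> hub_labels r"
  using assms by (cases x; auto simp: hub_labels_def)+

context hub_map
begin

text \<open>The labels reach every edge because every white vertex is next to a hub, and counting
  gives the bijection. The rotations then have no freedom left: hubs have period r, white vertices
  have period 4, and edges at leaves are fixed by the black rotation.\<close>

lemma labelling:
  assumes type: "hub_type T r d" and d: "1 \<le> d" "d \<le> 3"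
  obtains L where "bij_betw L (hub_labels r) (edges T)"
    and "\<And>x. x \<in> hub_labels r \<Longrightarrow> black_next T (L x) = L (label_black_next r d x)"
    and "\<And>x. x \<in> hub_labels r \<Longrightarrow> white_next T (L x) = L (label_white_next x)"
proof -
  obtain e where e: "e \<in> edges T"
     "black_end T e \<noteq> black_end T ((white_next T ^^ d) e)"
     "card (black_star T (black_end T e)) = r"
     "card (black_star T (black_end T ((white_next T ^^ d) e))) = r"
    using type unfolding hub_type_def by blast
  define f where "f = (white_next T ^^ d) e"
  have f: "f \<in> edges T" and wf: "white_end T f = white_end T e"
    using funpow_white_next[OF map e(1)] by (simp_all add: f_def)
  define a b where "a = black_end T e" and "b = black_end T f"
  have ab: "a \<noteq> b" "a \<in> hubs" "b \<in> hubs"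
    using e f black_nextD(1)[OF map] by (auto simp: hubs_def a_def b_def f_def)
  have hubs: "hubs = {a, b}"
  proof (rule card_seteq[symmetric])
    show "finite hubs" using card_hubs by (intro card_ge_0_finite) simp
    show "{a, b} \<subseteq> hubs" using ab by simp
    show "card hubs \<le> card {a, b}" using ab(1) card_hubs by simp
  qed
  define E where "E c = (if c then f else e)" for c
  have E: "E c \<in> edges T" "black_end T (E c) = (if c then b else a)" for c
    using e f by (simp_all add: E_def a_def b_def)
  have Ehub: "black_end T (E c) \<in> hubs" for c using ab E by simp
  define L where "L = (\<lambda>(c, k, j). (white_next T ^^ j) ((black_next T ^^ k) (E c)))"
  have L: "L (c, k, j) = (white_next T ^^ j) ((black_next T ^^ k) (E c))" for c k j
    by (simp add: L_def)
  have Lk: "(black_next T ^^ k) (E c) \<in> edges T \<and> black_end T ((black_next T ^^ k) (E c)) = black_end T (E c)"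
    for c k using funpow_black_next[OF map E(1)] .
  have Lin: "L x \<in> edges T" for x
    using funpow_white_next[OF map conjunct1[OF Lk]] by (cases x) (simp add: L)
  have sur: "g \<in> L ` hub_labels r" if g: "g \<in> edges T" for g
  proof -
    have "white_end T g \<in> white_end T ` black_star T a \<union> white_end T ` black_star T b"
      using white_nextD(1)[OF map g] unfolding white_nbrs_cover[OF ab(2,3,1)] .
    then obtain h where h0: "h \<in> edges T" "white_end T g = white_end T h"
       and h1: "black_end T h = a \<or> black_end T h = b"
      unfolding black_star_def by blast
    obtain c where "black_end T h = (if c then b else a)"
      using h1 by (metis (full_types))
    then have h: "h \<in> edges T" "white_end T g = white_end T h" "black_end T h = black_end T (E c)"
      using h0 E(2) by simp_all
    obtain k where k: "k < r" "h = (black_next T ^^ k) (E c)"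
      using black_next_hub(2)[OF E(1) Ehub h(1,3)] by blast
    have w0: "\<exists>j<4. g = (white_next T ^^ j) h" if "h \<in> edges T" "white_end T g = white_end T h" for h
      using white_next4(2)[OF that(1) g that(2)] .
    show ?thesis
    \<comment> \<open>The labels (True, 0, j) do not exist: there the white end is the common one,
      and the edge is labelled from the first hub.\<close>
    proof (cases "c \<and> k = 0")
      case False
      obtain j where "j < 4" "g = (white_next T ^^ j) h" using w0 h by blast
      then have "g = L (c, k, j)" using k by (simp add: L)
      moreover have "(c, k, j) \<in> hub_labels r" using False k \<open>j < 4\<close> by (auto simp: hub_labels_def)
      ultimately show ?thesis by blast
    next
      case True
      then have "white_end T g = white_end T e" using h k wf by (simp add: E_def)
      then obtain j where "j < 4" "g = (white_next T ^^ j) e" using w0 e by blast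
      then have "g = L (False, 0, j)" by (simp add: L E_def)
      moreover have "(False, 0, j) \<in> hub_labels r" using r \<open>j < 4\<close> by (auto simp: hub_labels_def)
      ultimately show ?thesis by blast
    qed
  qed
  have im: "L ` hub_labels r = edges T" using sur Lin by blast
  have finl: "finite (hub_labels r)"
    using card_hub_labels[of r] r by (intro card_ge_0_finite) simp
  have inj: "inj_on L (hub_labels r)"
    by (rule eq_card_imp_inj_on[OF finl]) (simp add: im card_edges card_hub_labels)
  have "black_next T (L x) = L (label_black_next r d x)" if x: "x \<in> hub_labels r" for x
  proof -
    obtain c k j where xc: "x = (c, k, j)" by (cases x)
    have kj: "k < r" "j < 4" "c \<Longrightarrow> 0 < k" using x by (auto simp: xc hub_labels_def)
    have period: "(black_next T ^^ r) (E c) = E c" for c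
      using black_next_hub(1)[OF E(1) Ehub] .
    show ?thesis
    proof (cases "j = 0")
      case True
      have Lx: "black_next T (L x) = (black_next T ^^ Suc k) (E c)" by (simp add: xc L True)
      show ?thesis
      proof (cases "Suc k < r")
        case False
        then have "Suc k = r" using kj by simp
        then have "black_next T (L x) = E c" using Lx period by simp
        then show ?thesis using False True by (simp add: xc L E_def f_def)
      qed (simp add: Lx xc True L)
    next
      case j0: False
      show ?thesis
      proof (cases "(c, k, j) = (False, 0, d)")
        case True
        then show ?thesis using d by (simp add: xc L E_def f_def)
      next
        case False
        \<comment> \<open>An edge at a hub has a label with j = 0 or the label (False, 0, d); by
          injectivity that label would be x itself.\<close>
        have "black_end T (L x) \<notin> hubs"
        proof
          assume "black_end T (L x) \<in> hubs"
          then have "black_end T (L x) = a \<or> black_end T (L x) = b" unfolding hubs by simp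
          then obtain c' where "black_end T (L x) = (if c' then b else a)"
            by (metis (full_types))
          then have c': "black_end T (L x) = black_end T (E c')" using E(2) by simp
          obtain i where i: "i < r" "L x = (black_next T ^^ i) (E c')"
            using black_next_hub(2)[OF E(1) Ehub Lin c'] by blast
          have "\<exists>y\<in>hub_labels r. L x = L y \<and> (snd (snd y) = 0 \<or> y = (False, 0, d))"
          proof (cases "c' \<and> i = 0")
            case True
            then have "L x = L (False, 0, d)" using i by (simp add: L E_def f_def)
            moreover have "(False, 0, d) \<in> hub_labels r" using d r by (simp add: hub_labels_def)
            ultimately show ?thesis by force
          next
            case False
            then have "L x = L (c', i, 0)" using i by (simp add: L)
            moreover have "(c', i, 0) \<in> hub_labels r" using False i by (auto simp: hub_labels_def)
            ultimately show ?thesis by force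
          qed
          then obtain y where y: "y \<in> hub_labels r" "L x = L y" "snd (snd y) = 0 \<or> y = (False, 0, d)" by blast
          then have "x = y" using inj_onD[OF inj _ x] by blast
          then show False using y(3) j0 False xc by auto
        qed
        then have "black_next T (L x) = L x" by (rule black_next_leaf[OF Lin])
        moreover have "label_black_next r d x = x" using False j0 by (auto simp: xc)
        ultimately show ?thesis by simp
      qed
    qed
  qed
  moreover have "white_next T (L x) = L (label_white_next x)" if x: "x \<in> hub_labels r" for x
  proof -
    obtain c k j where xc: "x = (c, k, j)" by (cases x)
    have j: "j < 4" using x by (auto simp: xc hub_labels_def)
    show ?thesis
    proof (cases "Suc j = 4")
      case True
      have "white_next T (L x) = (white_next T ^^ Suc j) ((black_next T ^^ k) (E c))" by (simp add: xc L)
      also have "\<dots> = (black_next T ^^ k) (E c)"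
        unfolding True using white_next4(1) Lk by blast
      also have "\<dots> = L (label_white_next x)" by (simp add: xc L True)
      finally show ?thesis .
    next
      case False
      then show ?thesis using j by (simp add: xc L)
    qed
  qed
  moreover have "bij_betw L (hub_labels r) (edges T)"
    using inj im by (simp add: bij_betw_def)
  ultimately show ?thesis using that by blast
qed

end

text \<open>Both maps carry the same model rotations on \<open>hub_labels r\<close>, which depend on
  r and d only.\<close>

lemma isomorphic_if_same_hub_type:
  assumes "hub_map T r" "hub_map U r" "hub_type T r d" "hub_type U r d" and d: "1 \<le> d" "d \<le> 3"
  shows "isomorphic_maps T U"
proof -
  interpret T: hub_map T r by fact
  interpret U: hub_map U r by fact
  obtain L where L: "bij_betw L (hub_labels r) (edges T)"
    "\<And>x. x \<in> hub_labels r \<Longrightarrow> black_next T (L x) = L (label_black_next r d x)"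
    "\<And>x. x \<in> hub_labels r \<Longrightarrow> white_next T (L x) = L (label_white_next x)"
    using T.labelling[OF assms(3) d] by blast
  obtain M where M: "bij_betw M (hub_labels r) (edges U)"
    "\<And>x. x \<in> hub_labels r \<Longrightarrow> black_next U (M x) = M (label_black_next r d x)"
    "\<And>x. x \<in> hub_labels r \<Longrightarrow> white_next U (M x) = M (label_white_next x)"
    using U.labelling[OF assms(4) d] by blast
  define \<psi> where "\<psi> = M \<circ> inv_into (hub_labels r) L"
  have \<psi>: "\<psi> (L x) = M x" if "x \<in> hub_labels r" for x
    using that L(1) by (simp add: \<psi>_def bij_betw_inv_into_left)
  have "black_next U (\<psi> e) = \<psi> (black_next T e) \<and> white_next U (\<psi> e) = \<psi> (white_next T e)"
    if e: "e \<in> edges T" for e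
  proof -
    have "e \<in> L ` hub_labels r" using e L(1) by (simp add: bij_betw_def)
    then obtain x where x: "x \<in> hub_labels r" "e = L x" by blast
    show ?thesis
      unfolding x(2) \<psi>[OF x(1)] L(2,3)[OF x(1)] M(2,3)[OF x(1)]
      using label_next_in[OF x(1) d T.r] \<psi> by simp
  qed
  moreover have "bij_betw \<psi> (edges T) (edges U)"
    unfolding \<psi>_def using bij_betw_trans[OF bij_betw_inv_into[OF L(1)] M(1)] .
  ultimately have "edge_iso T U \<psi>" by (simp add: edge_iso_def)
  then show ?thesis using isomorphic_maps_iff[OF T.map U.map] by blast
qed

text \<open>Types 1 and 3 occur together by \<open>hub_type_reverse\<close>, so two maps cover the
  three possible types of T.\<close>

lemma hub_map_two_types:
  assumes "hub_map T r" "hub_map T1 r" "hub_map T2 r"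
    and "hub_type T1 r 2" "hub_type T2 r 1 \<or> hub_type T2 r 3"
  shows "isomorphic_maps T T1 \<or> isomorphic_maps T T2"
proof -
  interpret T: hub_map T r by fact
  obtain d where d: "d \<in> {1,2,3}" "hub_type T r d" using T.hub_type_exists by blast
  have "hub_type T2 r 1" "hub_type T2 r 3"
    using assms(5) hub_map.hub_type_reverse[OF assms(3), of 1] hub_map.hub_type_reverse[OF assms(3), of 3] by auto
  then show ?thesis
    using isomorphic_if_same_hub_type[OF assms(1,2) d(2)] isomorphic_if_same_hub_type[OF assms(1,3) d(2)] d(1) assms(4)
    by auto
qed

section \<open>Edges of a Shabat polynomial\<close>

lemma sum_order_complex:
  fixes p :: "complex poly"
  assumes "p \<noteq> 0"
  shows "(\<Sum>z | poly p z = 0. order z p) = degree p"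
proof -
  have "size (proots p) = (\<Sum>z\<in>set_mset (proots p). count (proots p) z)"
    by (simp add: size_multiset_overloaded_eq)
  then show ?thesis
    using assms by (simp add: size_proots_complex)
qed

lemma order_eq_1I:
  fixes p :: "complex poly"
  assumes "poly p z = 0" "poly (pderiv p) z \<noteq> 0"
  shows "order z p = 1"
proof -
  have "p \<noteq> 0" using assms by auto
  then have "order z p = Suc (order z (pderiv p))" using assms(1) by (rule order_pderiv)
  then show ?thesis using assms by (simp add: order_0I)
qed

lemma degree_diff_const:
  fixes F :: "'a::ab_group_add poly"
  assumes "degree F > 0"
  shows "degree (F - [:w:]) = degree F"
  unfolding diff_conv_add_uminus by (rule degree_add_eq_left) (simp add: assms)

lemma card_regular_fibre:
  fixes F :: "complex poly"
  assumes deg: "degree F > 0" and reg: "\<And>z. poly F z = w \<Longrightarrow> poly (pderiv F) z \<noteq> 0"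
  shows "card {z. poly F z = w} = degree F"
proof -
  let ?G = "F - [:w:]"
  have degG: "degree ?G = degree F" using deg by (rule degree_diff_const)
  then have G: "?G \<noteq> 0" using deg by auto
  have pd: "pderiv ?G = pderiv F" by (simp add: pderiv_diff pderiv_pCons)
  have "degree F = (\<Sum>z | poly ?G z = 0. order z ?G)" using sum_order_complex[OF G] degG by simp
  also have "\<dots> = (\<Sum>z | poly ?G z = 0. 1)"
    by (intro sum.cong refl order_eq_1I) (use reg pd in auto)
  finally show ?thesis by simp
qed

lemma card_fibre_le:
  fixes F :: "complex poly"
  assumes deg: "degree F > 0"
  shows "finite {z. poly F z = w}" "card {z. poly F z = w} \<le> degree F"
proof -
  let ?G = "F - [:w:]"
  have degG: "degree ?G = degree F" using deg by (rule degree_diff_const)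
  then have G: "?G \<noteq> 0" using deg by auto
  show "finite {z. poly F z = w}" "card {z. poly F z = w} \<le> degree F"
    using poly_roots_finite[OF G] card_poly_roots_bound[OF G] degG by simp_all
qed

lemma poly_fibre_nonempty:
  fixes F :: "complex poly"
  assumes "degree F > 0"
  shows "\<exists>z. poly F z = w"
proof -
  have "degree (F - [:w:]) = degree F" using assms by (rule degree_diff_const)
  then have "\<not> constant (poly (F - [:w:]))" using assms by (simp add: constant_degree)
  then obtain z where "poly (F - [:w:]) z = 0" using fundamental_theorem_of_algebra by blast
  then show ?thesis by auto
qed

lemma finite_separated:
  fixes R :: "'a::metric_space set"
  assumes "finite R"
  obtains d where "d > 0" "\<And>x y. x \<in> R \<Longrightarrow> y \<in> R \<Longrightarrow> x \<noteq> y \<Longrightarrow> d \<le> dist x y"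
proof -
  let ?D = "insert 1 ((\<lambda>(x, y). dist x y) ` {(x, y). x \<in> R \<and> y \<in> R \<and> x \<noteq> y})"
  have "finite {(x, y). x \<in> R \<and> y \<in> R \<and> x \<noteq> y}"
    by (rule finite_subset[of _ "R \<times> R"]) (use assms in auto)
  then have fin: "finite ?D" by simp
  show ?thesis
  proof (rule that[of "Min ?D"])
    show "Min ?D > 0" using fin by (subst Min_gr_iff) auto
    show "Min ?D \<le> dist x y" if "x \<in> R" "y \<in> R" "x \<noteq> y" for x y
      using fin that by (intro Min_le) auto
  qed
qed

lemma poly_holomorphic_on: "poly F holomorphic_on A"
  unfolding holomorphic_on_def field_differentiable_def
  by (meson poly_DERIV has_field_derivative_at_within)

text \<open>Over the complement of the critical values all fibres have \<open>degree F\<close> points, so the sheets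
  through one fibre exhaust the preimage of a small neighbourhood.\<close>

lemma poly_covering_space:
  fixes F :: "complex poly"
  assumes deg: "degree F > 0" and S: "open S"
    and reg: "\<And>z. poly F z \<in> S \<Longrightarrow> poly (pderiv F) z \<noteq> 0"
  shows "covering_space (poly F -` S) (poly F) S"
proof -
  have sheets: "\<exists>T. w \<in> T \<and> openin (top_of_set S) T \<and>
         (\<exists>V. \<Union>V = poly F -` S \<inter> poly F -` T \<and>
              (\<forall>U\<in>V. openin (top_of_set (poly F -` S)) U) \<and> pairwise disjnt V \<and>
              (\<forall>U\<in>V. \<exists>q. homeomorphism U T (poly F) q))" if w: "w \<in> S" for w
  proof -
    define R where "R = {z. poly F z = w}"
    have finR: "finite R" unfolding R_def by (rule card_fibre_le[OF deg])
    have cardR: "card R = degree F"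
      unfolding R_def by (rule card_regular_fibre[OF deg]) (use reg w in auto)
    obtain d where d: "d > 0" "\<And>x y. x \<in> R \<Longrightarrow> y \<in> R \<Longrightarrow> x \<noteq> y \<Longrightarrow> d \<le> dist x y"
      using finite_separated[OF finR] by blast
    \<comment> \<open>Radii of at most half the separation of the fibre keep the sheets
      disjoint.\<close>
    have "\<exists>r>0. r \<le> d / 2 \<and> open (poly F ` ball z r) \<and> inj_on (poly F) (ball z r)" if "z \<in> R" for z
    proof -
      have "deriv (poly F) z = poly (pderiv F) z" by (simp add: poly_DERIV DERIV_imp_deriv)
      then have "deriv (poly F) z \<noteq> 0" using reg that w by (simp add: R_def)
      then obtain r where "r > 0" "ball z r \<subseteq> ball z (d / 2)" "open (poly F ` ball z r)" "inj_on (poly F) (ball z r)"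
        by (rule has_complex_derivative_locally_invertible[OF poly_holomorphic_on[of F "ball z (d / 2)"], rotated 2])
          (use d(1) in auto)
      then show ?thesis using d(1) by (intro exI[of _ r]) (auto simp: ball_subset_ball_iff)
    qed
    then obtain r where r: "\<And>z. z \<in> R \<Longrightarrow> r z > 0" "\<And>z. z \<in> R \<Longrightarrow> r z \<le> d / 2"
       "\<And>z. z \<in> R \<Longrightarrow> open (poly F ` ball z (r z))" "\<And>z. z \<in> R \<Longrightarrow> inj_on (poly F) (ball z (r z))"
      by metis
    define T where "T = S \<inter> (\<Inter>z\<in>R. poly F ` ball z (r z))"
    have openT: "open T" unfolding T_def using S finR r(3) by auto
    have wT: "w \<in> T"
    proof -
      have "w \<in> poly F ` ball z (r z)" if "z \<in> R" for z
        using that r(1)[OF that] by (intro image_eqI[of _ _ z]) (auto simp: R_def)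
      then show ?thesis using w by (auto simp: T_def)
    qed
    define U where "U z = ball z (r z) \<inter> poly F -` T" for z
    have contF: "continuous_on A (poly F)" for A by (intro continuous_intros)
    have openU: "open (U z)" for z
      unfolding U_def using openT contF by (intro open_Int open_ball) (simp add: open_vimage)
    have disjU: "U z \<inter> U z' = {}" if zz: "z \<in> R" "z' \<in> R" "z \<noteq> z'" for z z'
    proof -
      have "ball z (r z) \<inter> ball z' (r z') = {}"
        using d(2)[OF zz] r(2)[OF zz(1)] r(2)[OF zz(2)] by (intro disjoint_ballI) simp
      then show ?thesis by (auto simp: U_def)
    qed
    have "\<Union>(U ` R) = poly F -` S \<inter> poly F -` T"
    proof
      show "\<Union>(U ` R) \<subseteq> poly F -` S \<inter> poly F -` T" by (auto simp: U_def T_def)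
      show "poly F -` S \<inter> poly F -` T \<subseteq> \<Union>(U ` R)"
      proof
        fix x assume "x \<in> poly F -` S \<inter> poly F -` T"
        then have xT: "poly F x \<in> T" by simp
        show "x \<in> \<Union>(U ` R)"
        proof (rule ccontr)
          \<comment> \<open>Together with one point from each sheet, x would be point number degree
            F + 1 of its fibre.\<close>
          assume x: "x \<notin> \<Union>(U ` R)"
          have "\<exists>y. y \<in> U z \<and> poly F y = poly F x" if "z \<in> R" for z
          proof -
            have "poly F x \<in> poly F ` ball z (r z)" using xT that by (simp add: T_def)
            then obtain y where "y \<in> ball z (r z)" "poly F x = poly F y" by blast
            then show ?thesis using xT by (intro exI[of _ y]) (simp add: U_def)
          qed
          then obtain y where y: "\<And>z. z \<in> R \<Longrightarrow> y z \<in> U z" "\<And>z. z \<in> R \<Longrightarrow> poly F (y z) = poly F x"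
            by metis
          have inj: "inj_on y R"
          proof (rule inj_onI, rule ccontr)
            fix z z' assume z: "z \<in> R" "z' \<in> R" "y z = y z'" "z \<noteq> z'"
            show False using disjU[OF z(1,2,4)] y(1)[OF z(1)] y(1)[OF z(2)] z(3) by auto
          qed
          have "x \<notin> y ` R" using x y(1) by blast
          then have "card (insert x (y ` R)) = Suc (degree F)"
            using finR card_image[OF inj] cardR by simp
          moreover have "insert x (y ` R) \<subseteq> {u. poly F u = poly F x}" using y(2) by auto
          ultimately show False
            using card_mono[OF card_fibre_le(1)[OF deg], of "insert x (y ` R)" "poly F x"]
              card_fibre_le(2)[OF deg, of "poly F x"] by simp
        qed
      qed
    qed
    moreover have "openin (top_of_set (poly F -` S)) (U z)" for z
    proof -
      have "U z \<subseteq> poly F -` S" by (auto simp: U_def T_def)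
      then show ?thesis using openU openin_open_eq open_vimage[OF S contF] by auto
    qed
    moreover have "pairwise disjnt (U ` R)"
      unfolding pairwise_image using disjU by (auto simp: pairwise_def disjnt_def)
    moreover have "\<exists>q. homeomorphism (U z) T (poly F) q" if z: "z \<in> R" for z
    proof -
      have im: "poly F ` U z = T"
      proof
        show "T \<subseteq> poly F ` U z"
        proof
          fix t assume t: "t \<in> T"
          then obtain y where "y \<in> ball z (r z)" "t = poly F y" using z by (auto simp: T_def)
          then show "t \<in> poly F ` U z" using t by (auto simp: U_def)
        qed
      qed (auto simp: U_def)
      have "inj_on (poly F) (U z)" using r(4)[OF z] by (rule inj_on_subset) (auto simp: U_def)
      then obtain q where "homeomorphism (U z) (poly F ` U z) (poly F) q"
        using invariance_of_domain_homeomorphism[OF openU contF] by blast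
      then show ?thesis unfolding im by blast
    qed
    ultimately show ?thesis
      using wT openT by (intro exI[of _ T] conjI exI[of _ "U ` R"]) (auto simp: openin_open_eq S T_def)
  qed
  show ?thesis
    unfolding covering_space_def
  proof (intro conjI ballI sheets)
    show "continuous_on (poly F -` S) (poly F)" by (intro continuous_intros)
    show "poly F ` (poly F -` S) = S" using poly_fibre_nonempty[OF deg] by (auto simp: image_iff) metis
  qed
qed

definition unit_segment :: "complex set" where
  "unit_segment = open_segment 0 1"

lemma unit_segment_iff: "w \<in> unit_segment \<longleftrightarrow> (\<exists>t::real. 0 < t \<and> t < 1 \<and> w = of_real t)"
  by (auto simp: unit_segment_def in_segment scaleR_conv_of_real)

lemma unit_segment_reflect: "1 - w \<in> unit_segment \<longleftrightarrow> w \<in> unit_segment"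
proof -
  have "1 - w \<in> unit_segment" if w: "w \<in> unit_segment" for w
  proof -
    obtain t where "0 < t" "t < 1" "w = of_real t" using w unit_segment_iff by blast
    then show ?thesis unfolding unit_segment_iff by (intro exI[of _ "1 - t"]) simp
  qed
  from this[of w] this[of "1 - w"] show ?thesis by auto
qed

lemma preimage_edges_unit: "preimage_edges F 0 1 = components (poly F -` unit_segment)"
  by (simp add: preimage_edges_def unit_segment_def)

lemma shabat_regular:
  assumes "shabat F 0 1" "poly F z \<notin> {0, 1}"
  shows "poly (pderiv F) z \<noteq> 0"
  using assms by (auto simp: shabat_def)

text \<open>The inverse branch of \<open>F\<close> through a point of the edge is defined on the whole segment.\<close>

lemma edge_bij:
  assumes F: "shabat F 0 1" and e: "e \<in> preimage_edges F 0 1"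
  shows "bij_betw (poly F) e unit_segment"
proof -
  let ?S = "- {0, 1 :: complex}"
  have cov: "covering_space (poly F -` ?S) (poly F) ?S"
    by (rule poly_covering_space) (use F shabat_regular in \<open>auto simp: shabat_def\<close>)
  have eS: "e \<subseteq> poly F -` unit_segment" and con: "connected e" and ne: "e \<noteq> {}"
    using e in_components_subset in_components_connected in_components_nonempty
    unfolding preimage_edges_unit by blast+
  have segS: "unit_segment \<subseteq> ?S" by (auto simp: unit_segment_iff)
  have conv: "convex unit_segment" by (simp add: unit_segment_def)
  obtain a where a: "a \<in> e" using ne by blast
  have aS: "poly F a \<in> unit_segment" using a eS by auto
  \<comment> \<open>The branch is the lift of the identity of the segment, which is convex and hence
    simply connected, with value a over F(a).\<close>
  obtain g where g: "continuous_on unit_segment g" "g \<in> unit_segment \<rightarrow> poly F -` ?S" "g (poly F a) = a"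
      "\<And>y. y \<in> unit_segment \<Longrightarrow> poly F (g y) = y"
    by (rule covering_space_lift_strong[OF cov, of a "poly F a" unit_segment "\<lambda>y. y"])
      (use aS segS conv in \<open>auto intro: convex_imp_simply_connected convex_imp_locally_path_connected\<close>)
  have sub: "g ` unit_segment \<subseteq> e"
  proof (rule components_maximal)
    show "e \<in> components (poly F -` unit_segment)" using e by (simp add: preimage_edges_unit)
    show "connected (g ` unit_segment)" by (intro connected_continuous_image g convex_connected conv)
    show "e \<inter> g ` unit_segment \<noteq> {}" using a aS g(3) by force
  qed (use g(4) in auto)
  \<comment> \<open>Both g after F and the identity lift F along the connected set e, and they agree
    at a.\<close>
  have inv: "g (poly F z) = z" if z: "z \<in> e" for z
  proof (rule covering_space_lift_unique[OF cov, where f = "poly F" and T = e and a = a])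
    show "continuous_on e (\<lambda>z. g (poly F z))"
      by (rule continuous_on_compose2[OF g(1)]) (use eS in \<open>auto intro!: continuous_intros\<close>)
    show "(\<lambda>z. g (poly F z)) \<in> e \<rightarrow> poly F -` ?S" using g(2) eS by auto
  qed (use g a z con eS segS in \<open>auto intro!: continuous_intros\<close>)
  show ?thesis
    by (rule bij_betw_byWitness[where f' = g]) (use inv g(4) eS sub in auto)
qed

section \<open>Edges at a root\<close>

text \<open>Write F = (z - v)^m q with q(v) \<noteq> 0. Near v the factor q has a holomorphic m-th
  root, and z - v times that root is a coordinate whose m-th power is F.\<close>

lemma root_coordinate:
  fixes F :: "complex poly"
  assumes F: "F \<noteq> 0" and v: "poly F v = 0"
  obtains \<phi> g N \<rho> c where "0 < \<rho>" "open N" "v \<in> N" "homeomorphism N (ball 0 \<rho>) \<phi> g"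
    "\<phi> v = 0" "\<And>z. z \<in> N \<Longrightarrow> poly F z = \<phi> z ^ order v F"
    "((\<lambda>z. \<phi> z / (z - v)) \<longlongrightarrow> c) (at v)" "c \<noteq> 0"
proof -
  define m where "m = order v F"
  have m: "m > 0" using F v by (simp add: m_def order_gt_0_iff)
  obtain q where q: "F = [:- v, 1:] ^ m * q" "\<not> [:- v, 1:] dvd q"
    using order_decomp[OF F, of v] by (auto simp: m_def)
  have qv: "poly q v \<noteq> 0" using q(2) by (simp add: poly_eq_0_iff_dvd)
  have "((\<lambda>z. poly q z / poly q v) \<longlongrightarrow> poly q v / poly q v) (at v)"
    using DERIV_isCont[OF poly_DERIV[of q v]] qv unfolding isCont_def by (intro tendsto_intros)
  then have "((\<lambda>z. poly q z / poly q v) \<longlongrightarrow> 1) (at v)" using qv by simp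
  then have "eventually (\<lambda>z. dist (poly q z / poly q v) 1 < 1) (at v)"
    by (rule tendstoD) simp
  then obtain \<delta> where \<delta>: "\<delta> > 0" "\<And>z. z \<noteq> v \<Longrightarrow> dist z v < \<delta> \<Longrightarrow> dist (poly q z / poly q v) 1 < 1"
    unfolding eventually_at by auto
  have \<delta>': "dist (poly q z / poly q v) 1 < 1" if "dist z v < \<delta>" for z
    using \<delta>(2)[of z] that qv by (cases "z = v") auto
  let ?B = "ball v \<delta>"
  have nonneg: "poly q z / poly q v \<notin> \<real>\<^sub>\<le>\<^sub>0" if "z \<in> ?B" for z
  proof
    assume "poly q z / poly q v \<in> \<real>\<^sub>\<le>\<^sub>0"
    then have "Re (1 - poly q z / poly q v) \<ge> 1" by (auto elim!: nonpos_Reals_cases)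
    moreover have "norm (1 - poly q z / poly q v) < 1"
      using \<delta>'[of z] that by (simp add: dist_norm norm_minus_commute)
    ultimately show False using complex_Re_le_cmod[of "1 - poly q z / poly q v"] by linarith
  qed
  \<comment> \<open>Dividing by q(v) keeps the argument of \<open>Ln\<close> close to 1, away from
    the cut; \<open>\<kappa>\<close> restores the root of q(v) and becomes the derivative of the
    coordinate at v.\<close>
  define \<kappa> where "\<kappa> = exp (Ln (poly q v) / of_nat m)"
  define \<psi> where "\<psi> z = exp (Ln (poly q z / poly q v) / of_nat m)" for z
  define \<phi> where "\<phi> z = (z - v) * (\<kappa> * \<psi> z)" for z
  have pow: "exp (w / of_nat m) ^ m = exp w" for w :: complex
    using m by (simp flip: exp_of_nat_mult)
  have holq: "(\<lambda>z. poly q z / poly q v) holomorphic_on ?B"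
    using poly_holomorphic_on[of q] qv by (intro holomorphic_intros)
  have hol\<psi>: "\<psi> holomorphic_on ?B"
    unfolding \<psi>_def using holq nonneg m by (intro holomorphic_intros) auto
  have hol: "\<phi> holomorphic_on ?B"
    unfolding \<phi>_def by (intro holomorphic_intros hol\<psi>)
  have Fphi: "poly F z = \<phi> z ^ m" if "z \<in> ?B" for z
  proof -
    have "poly q z / poly q v \<noteq> 0" using nonneg[OF that] by auto
    then have "(\<kappa> * \<psi> z) ^ m = poly q z"
      using qv by (simp add: power_mult_distrib \<kappa>_def \<psi>_def pow)
    then show ?thesis by (simp add: q(1) \<phi>_def power_mult_distrib poly_power)
  qed
  have "isCont \<psi> v"
    using hol\<psi> \<delta>(1) by (meson holomorphic_on_imp_continuous_on continuous_on_eq_continuous_at open_ball centre_in_ball)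
  then have "\<psi> \<midarrow>v\<rightarrow> \<psi> v" by (simp add: isCont_def)
  moreover have \<psi>v: "\<psi> v = 1" using qv by (simp add: \<psi>_def)
  ultimately have "(\<lambda>z. \<kappa> * \<psi> z) \<midarrow>v\<rightarrow> \<kappa>" by (auto intro!: tendsto_eq_intros)
  then have lim: "(\<lambda>z. \<phi> z / (z - v)) \<midarrow>v\<rightarrow> \<kappa>"
    by (rule Lim_transform_eventually) (auto simp: eventually_at \<phi>_def intro!: exI[of _ 1])
  have "(\<phi> has_field_derivative \<kappa>) (at v)"
    unfolding has_field_derivative_iff using lim by (simp add: \<phi>_def)
  then have "deriv \<phi> v \<noteq> 0" by (simp add: DERIV_imp_deriv \<kappa>_def)
  then obtain r where r: "r > 0" "ball v r \<subseteq> ?B" "open (\<phi> ` ball v r)" "inj_on \<phi> (ball v r)"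
    by (rule has_complex_derivative_locally_invertible[OF hol, rotated 2]) (use \<delta>(1) in auto)
  have "0 \<in> \<phi> ` ball v r" using r(1) by (intro image_eqI[of _ _ v]) (auto simp: \<phi>_def)
  then obtain \<rho> where \<rho>: "\<rho> > 0" "ball 0 \<rho> \<subseteq> \<phi> ` ball v r"
    using r(3) by (meson openE)
  define N where "N = ball v r \<inter> \<phi> -` ball 0 \<rho>"
  have cont: "continuous_on (ball v r) \<phi>"
    using hol r(2) holomorphic_on_imp_continuous_on holomorphic_on_subset by blast
  have openN: "open N" unfolding N_def using cont by (intro continuous_open_preimage) auto
  have im: "\<phi> ` N = ball 0 \<rho>" using \<rho>(2) by (auto simp: N_def)
  have "continuous_on N \<phi>" "inj_on \<phi> N"
    using cont r(4) by (auto simp: N_def intro: continuous_on_subset inj_on_subset)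
  then obtain g where "homeomorphism N (\<phi> ` N) \<phi> g"
    using invariance_of_domain_homeomorphism[OF openN, of \<phi>] by blast
  then have "homeomorphism N (ball 0 \<rho>) \<phi> g" by (simp add: im)
  moreover have "v \<in> N" using r(1) \<rho>(1) by (simp add: N_def \<phi>_def)
  moreover have "poly F z = \<phi> z ^ order v F" if "z \<in> N" for z
    using Fphi that r(2) by (auto simp: N_def m_def)
  ultimately show ?thesis
    using that[of \<rho> N \<phi> g \<kappa>] \<rho>(1) openN lim by (simp add: \<phi>_def \<kappa>_def)
qed

lemma cis_root_eq_iff:
  fixes j k m :: nat
  assumes "j < m" "k < m"
  shows "cis (2 * pi * j / m) = cis (2 * pi * k / m) \<longleftrightarrow> j = k"
proof
  assume "cis (2 * pi * j / m) = cis (2 * pi * k / m)"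
  then have "cis (2 * pi * j / m) * cis (- (2 * pi * k / m)) = 1"
    by (simp add: cis_mult)
  then have "cis (2 * pi * (real j - real k) / m) = 1"
    by (simp add: cis_mult algebra_simps diff_divide_distrib)
  then have "cos (2 * pi * (real j - real k) / m) = 1" by (simp add: complex_eq_iff)
  then obtain i :: int where "2 * pi * (real j - real k) / m = i * 2 * pi" by (auto simp: cos_one_2pi_int)
  then have "2 * pi * ((real j - real k) / m) = 2 * pi * i" by (simp add: mult_ac)
  then have "(real j - real k) / m = i"
    by (rule mult_left_cancel[THEN iffD1, rotated]) simp
  moreover have "real m \<noteq> 0" using assms by simp
  ultimately have "real j - real k = real_of_int i * real m"
    by (rule nonzero_divide_eq_eq[THEN iffD1, rotated])
  then have "real_of_int (int j - int k) = real_of_int (i * int m)" by simp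
  then have eq: "int j - int k = i * int m" by (simp only: of_int_eq_iff)
  then have "\<bar>i * int m\<bar> < int m" using assms by linarith
  have "i = 0"
  proof (rule ccontr)
    assume "i \<noteq> 0"
    then have "1 * int m \<le> \<bar>i\<bar> * int m" by (intro mult_right_mono) simp_all
    then show False using \<open>\<bar>i * int m\<bar> < int m\<close> by (simp add: abs_mult)
  qed
  then show "j = k" using eq by simp
qed simp

text \<open>The edges at a root \<open>v\<close> of order \<open>m\<close> are the \<open>m\<close> preimages of rays in the coordinate above.\<close>

lemma star_at_root:
  assumes F: "shabat F 0 1" and v: "poly F v = 0"
  obtains \<epsilon> u where "bij_betw \<epsilon> {..<order v F} {e \<in> preimage_edges F 0 1. v \<in> closure e}"
    "norm u = 1"
    "\<And>k. k < order v F \<Longrightarrow> direction v (\<epsilon> k) = u * cis (2 * pi * k / order v F)"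
    "\<And>k w. \<lbrakk>k < order v F; w \<in> closure (\<epsilon> k); poly F w = 0\<rbrakk> \<Longrightarrow> w = v"
    "\<And>k. k < order v F \<Longrightarrow> v islimpt \<epsilon> k"
    "\<And>k. k < order v F \<Longrightarrow> ((\<lambda>z. sgn (z - v)) \<longlongrightarrow> direction v (\<epsilon> k)) (at v within \<epsilon> k)"
proof -
  have F0: "F \<noteq> 0" using F by (auto simp: shabat_def)
  define m where "m = order v F"
  have m: "m > 0" using F0 v by (simp add: m_def order_gt_0_iff)
  obtain \<phi> g N \<rho> c where \<rho>: "0 < \<rho>" and N: "open N" "v \<in> N" and hom: "homeomorphism N (ball 0 \<rho>) \<phi> g"
    and \<phi>v: "\<phi> v = 0" and F\<phi>: "\<And>z. z \<in> N \<Longrightarrow> poly F z = \<phi> z ^ m"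
    and lim: "((\<lambda>z. \<phi> z / (z - v)) \<longlongrightarrow> c) (at v)" and c: "c \<noteq> 0"
    by (rule root_coordinate[OF F0 v, folded m_def]) (rule that)
  have g\<phi>: "g (\<phi> z) = z" if "z \<in> N" for z using hom that by (simp add: homeomorphism_def)
  have \<phi>g: "\<phi> (g y) = y" "g y \<in> N" if "norm y < \<rho>" for y
    using hom that by (auto simp: homeomorphism_def)
  have contg: "continuous_on (ball 0 \<rho>) g" using hom by (simp add: homeomorphism_def)
  \<comment> \<open>The bound 1 keeps the values inside the segment, and \<open>\<rho> ^ m\<close>
    keeps their m-th roots inside the disc.\<close>
  define \<tau> where "\<tau> = min 1 (\<rho> ^ m)"
  have \<tau>: "0 < \<tau>" "\<tau> \<le> 1" "\<tau> \<le> \<rho> ^ m" using \<rho> by (auto simp: \<tau>_def)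
  define ray where "ray k t = of_real (root m t) * cis (2 * pi * real k / real m)" for k and t :: real
  have nray: "norm (ray k t) = root m t" if "0 \<le> t" for k t
    using that m by (simp add: ray_def norm_mult)
  have ray\<rho>: "norm (ray k t) < \<rho>" if "0 \<le> t" "t < \<tau>" for k t
  proof -
    have "root m t < root m (\<rho> ^ m)" using that \<tau> m by (intro real_root_less_mono) auto
    then show ?thesis using nray[OF that(1)] \<rho> m by (simp add: real_root_power_cancel)
  qed
  have raypow: "ray k t ^ m = of_real t" if "0 \<le> t" for k t
  proof -
    have "cis (2 * pi * real k / real m) ^ m = cis (2 * pi * real k)"
      unfolding Complex.DeMoivre using m by simp
    also have "\<dots> = 1" by (rule cis_multiple_2pi) simp
    finally show ?thesis
      using that m by (simp add: ray_def power_mult_distrib flip: of_real_power)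
  qed
  have contray: "continuous_on A (ray k)" for A k
    unfolding ray_def by (intro continuous_intros)
  define J where "J k = (\<lambda>t. g (ray k t)) ` {0<..<\<tau>}" for k
  have JI: "g (ray k t) \<in> J k" if "0 < t" "t < \<tau>" for k t
    using that by (simp add: J_def)
  have FJ: "poly F (g (ray k t)) = of_real t" if "0 \<le> t" "t < \<tau>" for k t
    using F\<phi>[OF \<phi>g(2)[OF ray\<rho>[OF that]]] \<phi>g(1)[OF ray\<rho>[OF that]] raypow[OF that(1)] by simp
  have contgr: "continuous_on {0..<\<tau>} (\<lambda>t. g (ray k t))" for k
    by (rule continuous_on_compose2[OF contg contray]) (use ray\<rho> in auto)
  have Jsub: "J k \<subseteq> poly F -` unit_segment" for k
    unfolding J_def unit_segment_iff using FJ \<tau> by (force simp: unit_segment_iff)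
  have conJ: "connected (J k)" for k
    unfolding J_def by (intro connected_continuous_image continuous_on_subset[OF contgr]) auto
  have "g (ray k (\<tau> / 2)) \<in> J k" for k using \<tau> by (auto simp: J_def)
  then have neJ: "J k \<noteq> {}" for k by blast
  have "\<exists>e. e \<in> preimage_edges F 0 1 \<and> J k \<subseteq> e" for k
  proof -
    have "poly F -` unit_segment \<noteq> {}" using Jsub[of k] neJ[of k] by blast
    then obtain e where "e \<in> components (poly F -` unit_segment)" "J k \<subseteq> e"
      using exists_component_superset[OF Jsub[of k] _ conJ[of k]] by blast
    then show ?thesis unfolding preimage_edges_unit by blast
  qed
  then obtain \<epsilon> where \<epsilon>: "\<And>k. \<epsilon> k \<in> preimage_edges F 0 1" "\<And>k. J k \<subseteq> \<epsilon> k" by metis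
  \<comment> \<open>F is injective on an edge, so the only point of the edge with value t is the one
    on the ray.\<close>
  have on_ray: "z = g (ray k t)" if z: "z \<in> \<epsilon> k" "poly F z = of_real t" "0 < t" "t < \<tau>" for z k t
  proof -
    have "inj_on (poly F) (\<epsilon> k)" using edge_bij[OF F \<epsilon>(1)] by (simp add: bij_betw_def)
    moreover have "g (ray k t) \<in> \<epsilon> k" using JI[OF z(3,4)] \<epsilon>(2)[of k] by blast
    ultimately show ?thesis using FJ[of t k] z
      by (intro inj_onD[of "poly F" "\<epsilon> k" z "g (ray k t)"]) simp_all
  qed
  have real_F: "\<exists>t. 0 < t \<and> t < 1 \<and> poly F z = of_real t" if "z \<in> e" "e \<in> preimage_edges F 0 1" for z e
  proof -
    have "poly F z \<in> unit_segment"
      using that in_components_subset unfolding preimage_edges_unit by blast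
    then show ?thesis by (simp add: unit_segment_iff)
  qed
  have limpt: "v islimpt \<epsilon> k" for k
  proof -
    have "((\<lambda>t. g (ray k t)) \<longlongrightarrow> g (ray k 0)) (at 0 within {0..<\<tau>})"
      using contgr[of k] \<tau> by (auto simp: continuous_on_def)
    then have "((\<lambda>t. g (ray k t)) \<longlongrightarrow> g (ray k 0)) (at 0 within {0<..<\<tau>})"
      by (rule tendsto_within_subset) auto
    moreover have "g (ray k 0) = v" using g\<phi>[OF N(2)] \<phi>v by (simp add: ray_def)
    ultimately have lim: "((\<lambda>t. g (ray k t)) \<longlongrightarrow> v) (at 0 within {0<..<\<tau>})" by simp
    have nb: "at 0 within {0<..<\<tau>} \<noteq> bot" using \<tau> by (simp add: trivial_limit_within islimpt_greaterThanLessThan1)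
    show ?thesis
      unfolding islimpt_def
    proof (intro allI impI)
      fix W assume W: "v \<in> W" "open W"
      have "eventually (\<lambda>t. g (ray k t) \<in> W) (at 0 within {0<..<\<tau>})"
        using topological_tendstoD[OF lim W(2,1)] .
      moreover have "eventually (\<lambda>t. t \<in> {0<..<\<tau>}) (at 0 within {0<..<\<tau>})"
        by (simp add: eventually_at_filter)
      ultimately have "eventually (\<lambda>t. g (ray k t) \<in> W \<and> t \<in> {0<..<\<tau>}) (at 0 within {0<..<\<tau>})"
        by eventually_elim simp
      then obtain t where t: "g (ray k t) \<in> W" "t \<in> {0<..<\<tau>}"
        using eventually_happens'[OF nb] by blast
      have "g (ray k t) \<in> \<epsilon> k" using t JI[of t k] \<epsilon>(2)[of k] by auto
      moreover have "g (ray k t) \<noteq> v" using FJ[of t k] t v by auto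
      ultimately show "\<exists>y\<in>\<epsilon> k. y \<in> W \<and> y \<noteq> v" using t by blast
    qed
  qed
  \<comment> \<open>Points of the edge tending to w have values tending to 0, hence eventually lie
    on the ray and tend to v.\<close>
  have uniq: "w = v" if w: "w \<in> closure (\<epsilon> k)" "poly F w = 0" for w k
  proof -
    obtain x where x: "\<And>n. x n \<in> \<epsilon> k" "x \<longlonglongrightarrow> w"
      using w(1) unfolding closure_sequential by blast
    obtain t where t: "\<And>n. 0 < t n" "\<And>n. t n < 1" "\<And>n. poly F (x n) = of_real (t n)"
      using real_F[OF x(1) \<epsilon>(1)] by metis
    have "(\<lambda>n. poly F (x n)) \<longlonglongrightarrow> 0"
      using x(2) w(2) isCont_tendsto_compose[OF DERIV_isCont[OF poly_DERIV[of F w]] x(2)] by simp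
    then have "(\<lambda>n. complex_of_real (t n)) \<longlonglongrightarrow> of_real 0" by (simp add: t(3))
    then have t0: "t \<longlonglongrightarrow> 0" by (simp only: tendsto_of_real_iff)
    have ev: "eventually (\<lambda>n. t n < \<tau>) sequentially" using order_tendstoD(2)[OF t0 \<tau>(1)] .
    then have "eventually (\<lambda>n. g (ray k (t n)) = x n) sequentially"
      by eventually_elim (use on_ray x(1) t in metis)
    moreover have "(\<lambda>n. g (ray k (t n))) \<longlonglongrightarrow> g (ray k 0)"
    proof (rule continuous_on_tendsto_compose[OF contgr t0])
      show "eventually (\<lambda>n. t n \<in> {0..<\<tau>}) sequentially"
        using ev by eventually_elim (use t(1) in \<open>auto intro: less_imp_le\<close>)
    qed (use \<tau> in auto)
    ultimately have "x \<longlonglongrightarrow> g (ray k 0)" by (rule Lim_transform_eventually[rotated])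
    then have "w = g (ray k 0)" using x(2) LIMSEQ_unique by blast
    then show ?thesis using g\<phi>[OF N(2)] \<phi>v by (simp add: ray_def)
  qed
  have evN: "eventually (\<lambda>z. z \<in> N \<and> dist (poly F z) 0 < \<tau>) (at v within A)" for A
  proof -
    have "eventually (\<lambda>z. z \<in> N) (at v within A)" using N by (auto simp: eventually_at_topological)
    moreover have "(poly F \<longlongrightarrow> 0) (at v within A)"
      using DERIV_isCont[OF poly_DERIV[of F v]] v by (auto simp: isCont_def intro: tendsto_within_subset)
    then have "eventually (\<lambda>z. dist (poly F z) 0 < \<tau>) (at v within A)"
      using \<tau>(1) by (rule tendstoD)
    ultimately show ?thesis by eventually_elim simp
  qed
  \<comment> \<open>Near v the coordinate is asymptotic to c (z - v), so the directions at v are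
    those of the rays divided by \<open>sgn c\<close>.\<close>
  define u where "u = inverse (sgn c)"
  have dirlim: "((\<lambda>z. sgn (z - v)) \<longlongrightarrow> u * cis (2 * pi * k / m)) (at v within \<epsilon> k)" for k
  proof -
    have "((\<lambda>z. \<phi> z / (z - v)) \<longlongrightarrow> c) (at v within \<epsilon> k)" using lim by (rule tendsto_within_subset) simp
    then have sgnlim: "((\<lambda>z. sgn (\<phi> z / (z - v))) \<longlongrightarrow> sgn c) (at v within \<epsilon> k)" using c by (rule tendsto_sgn)
    have "sgn c \<noteq> 0" using c by (simp add: sgn_zero_iff)
    then have "((\<lambda>z. cis (2 * pi * k / m) / sgn (\<phi> z / (z - v))) \<longlongrightarrow> cis (2 * pi * k / m) / sgn c) (at v within \<epsilon> k)"
      by (rule tendsto_divide[OF tendsto_const sgnlim])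
    moreover have "eventually (\<lambda>z. cis (2 * pi * k / m) / sgn (\<phi> z / (z - v)) = sgn (z - v)) (at v within \<epsilon> k)"
    proof -
      have "eventually (\<lambda>z. z \<in> \<epsilon> k) (at v within \<epsilon> k)" by (simp add: eventually_at_filter)
      with evN show ?thesis
      proof eventually_elim
        case (elim z)
        obtain t where t: "0 < t" "t < 1" "poly F z = of_real t" using real_F[OF elim(2) \<epsilon>(1)] by blast
        have t\<tau>: "t < \<tau>" using elim(1) t by simp
        have z: "z = g (ray k t)" using on_ray[OF elim(2) t(3,1) t\<tau>] .
        have "\<phi> z = ray k t" unfolding z using \<phi>g(1) ray\<rho> t(1) t\<tau> by simp
        moreover have "sgn (ray k t) = cis (2 * pi * k / m)"
          using t(1) m by (simp add: ray_def sgn_mult sgn_of_real sgn_eq norm_mult)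
        moreover have "sgn (\<phi> z) \<noteq> 0" using calculation t(1) by simp
        moreover have "z \<noteq> v" using t v by auto
        ultimately show ?case
          by (simp add: sgn_divide divide_simps)
      qed
    qed
    ultimately have "((\<lambda>z. sgn (z - v)) \<longlongrightarrow> cis (2 * pi * k / m) / sgn c) (at v within \<epsilon> k)"
      by (rule Lim_transform_eventually)
    then show ?thesis by (simp add: u_def divide_inverse mult.commute)
  qed
  have dir: "direction v (\<epsilon> k) = u * cis (2 * pi * k / m)" for k
    unfolding direction_def
    by (rule tendsto_Lim[OF _ dirlim]) (use limpt in \<open>simp add: trivial_limit_within\<close>)
  have nu: "norm u = 1" using c by (simp add: u_def norm_inverse norm_sgn)
  have "bij_betw \<epsilon> {..<m} {e \<in> preimage_edges F 0 1. v \<in> closure e}"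
    unfolding bij_betw_def
  proof
    show "inj_on \<epsilon> {..<m}"
    proof (rule inj_onI)
      fix j k assume jk: "j \<in> {..<m}" "k \<in> {..<m}" "\<epsilon> j = \<epsilon> k"
      have "u * cis (2 * pi * j / m) = u * cis (2 * pi * k / m)"
        unfolding dir[symmetric] jk(3) ..
      moreover have "u \<noteq> 0" using nu by auto
      ultimately show "j = k" using cis_root_eq_iff[of j m k] jk by simp
    qed
    show "\<epsilon> ` {..<m} = {e \<in> preimage_edges F 0 1. v \<in> closure e}"
    proof (intro equalityI subsetI)
      fix e assume "e \<in> \<epsilon> ` {..<m}"
      then show "e \<in> {e \<in> preimage_edges F 0 1. v \<in> closure e}"
        using \<epsilon>(1) limpt by (auto simp: closure_def)
    next
      fix e assume "e \<in> {e \<in> preimage_edges F 0 1. v \<in> closure e}"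
      then have e: "e \<in> preimage_edges F 0 1" "v \<in> closure e" by auto
      have "v \<notin> e" using real_F[of v e] e(1) v by auto
      then have "at v within e \<noteq> bot" using e(2) by (simp add: closure_def trivial_limit_within)
      moreover have "eventually (\<lambda>z. z \<in> e) (at v within e)" by (simp add: eventually_at_filter)
      with evN[of e] have "eventually (\<lambda>z. z \<in> N \<and> dist (poly F z) 0 < \<tau> \<and> z \<in> e) (at v within e)"
        by eventually_elim simp
      ultimately obtain z where z: "z \<in> N" "dist (poly F z) 0 < \<tau>" "z \<in> e"
        using eventually_happens' by blast
      obtain t where t: "0 < t" "t < 1" "poly F z = of_real t" using real_F[OF z(3) e(1)] by blast
      have t\<tau>: "t < \<tau>" using z(2) t by simp
      \<comment> \<open>An m-th root of a positive number lies on one of the m rays, so e shares the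
        point z with some \<open>\<epsilon> k\<close> and, both being components, equals it.\<close>
      have "\<phi> z ^ m = of_real t" using F\<phi>[OF z(1)] t by simp
      then have "(\<phi> z / of_real (root m t)) ^ m = 1"
        using t m by (simp add: power_divide flip: of_real_power)
      then have "\<phi> z / of_real (root m t) \<in> {z. z ^ m = 1}" by simp
      moreover have "1 \<le> m" using m by simp
      ultimately obtain k where k: "k < m" "\<phi> z / of_real (root m t) = exp (2 * of_real pi * \<i> * of_nat k / of_nat m)"
        unfolding complex_roots_unity[OF \<open>1 \<le> m\<close>] by blast
      have "exp (2 * of_real pi * \<i> * of_nat k / of_nat m) = cis (2 * pi * k / m)"
        unfolding cis_conv_exp by (rule arg_cong[of _ _ exp]) (simp add: field_simps)
      then have "\<phi> z = ray k t" using k(2) t m by (simp add: ray_def field_simps)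
      then have "z = g (ray k t)" using g\<phi>[OF z(1)] by simp
      then have "z \<in> \<epsilon> k" using JI[OF t(1) t\<tau>, of k] \<epsilon>(2)[of k] by auto
      then have "e = \<epsilon> k"
        using components_eq[of e "poly F -` unit_segment" "\<epsilon> k"] e(1) \<epsilon>(1) z(3)
        unfolding preimage_edges_unit by blast
      then show "e \<in> \<epsilon> ` {..<m}" using k(1) by simp
    qed
  qed
  moreover have "((\<lambda>z. sgn (z - v)) \<longlongrightarrow> direction v (\<epsilon> k)) (at v within \<epsilon> k)" for k
    unfolding dir by (rule dirlim)
  ultimately show ?thesis
    using that[of \<epsilon> u] nu dir uniq limpt unfolding m_def by blast
qed

section \<open>The map of a Shabat polynomial\<close>

lemma Arg2pi_cis: "0 \<le> t \<Longrightarrow> t < 2 * pi \<Longrightarrow> Arg2pi (cis t) = t"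
  by (rule Arg2pi_unique[of 1]) (simp_all add: cis_conv_exp)

text \<open>Counterclockwise steps between equidistant directions; as in \<open>ccw_angle\<close>, a full turn if they agree.\<close>

definition ccw_steps :: "nat \<Rightarrow> nat \<Rightarrow> nat \<Rightarrow> nat" where
  "ccw_steps m k j = (if j = k then m else if k < j then j - k else j + m - k)"

lemma ccw_angle_cis:
  assumes "j < m" "k < m" "norm u = 1"
  shows "ccw_angle (u * cis (2 * pi * real k / real m)) (u * cis (2 * pi * real j / real m)) =
    2 * pi * real (ccw_steps m k j) / real m"
proof (cases "j = k")
  case True
  then show ?thesis using assms by (simp add: ccw_angle_def ccw_steps_def)
next
  case False
  have u: "u \<noteq> 0" using assms by auto
  have m: "real m > 0" using assms by simp
  let ?s = "ccw_steps m k j"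
  have "u * cis (2 * pi * real j / real m) / (u * cis (2 * pi * real k / real m)) =
      cis (2 * pi * real j / real m - 2 * pi * real k / real m)"
    using u by (simp add: cis_divide)
  also have "\<dots> = cis (2 * pi * real ?s / real m)"
  proof (cases "k < j")
    case True
    then show ?thesis by (simp add: ccw_steps_def of_nat_diff right_diff_distrib diff_divide_distrib)
  next
    case nless: False
    have "2 * pi * real ?s / real m = (2 * pi * real j / real m - 2 * pi * real k / real m) + 2 * pi"
      using nless False assms m by (simp add: ccw_steps_def of_nat_diff field_simps)
    then show ?thesis by (simp add: cis_mult[symmetric])
  qed
  finally have quot: "u * cis (2 * pi * real j / real m) / (u * cis (2 * pi * real k / real m)) =
      cis (2 * pi * real ?s / real m)" .
  have "?s < m" using False assms by (auto simp: ccw_steps_def)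
  then have "2 * pi * real ?s / real m < 2 * pi" using m by (simp add: divide_less_eq)
  then have "Arg2pi (cis (2 * pi * real ?s / real m)) = 2 * pi * real ?s / real m"
    by (intro Arg2pi_cis) simp_all
  moreover have "u * cis (2 * pi * real k / real m) \<noteq> u * cis (2 * pi * real j / real m)"
    using u cis_root_eq_iff[OF assms(2,1)] False by auto
  ultimately show ?thesis unfolding ccw_angle_def quot by simp
qed

text \<open>Unlike the value of \<open>arg_min\<close>, this can be transported along an affine map; the minimiser is unique.\<close>

definition is_next_edge :: "complex set set \<Rightarrow> complex \<Rightarrow> complex set \<Rightarrow> complex set \<Rightarrow> bool" where
  "is_next_edge E v e = is_arg_min (\<lambda>e'. ccw_angle (direction v e) (direction v e')) (\<lambda>e'. e' \<in> E \<and> v \<in> closure e')"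

lemma next_edge_some: "next_edge E v e = (SOME e'. is_next_edge E v e e')"
  by (simp add: next_edge_def arg_min_def is_next_edge_def)

text \<open>With equidistant directions, one step is the strictly smallest angle.\<close>

lemma is_next_edge_star:
  assumes bij: "bij_betw \<epsilon> {..<m} {e \<in> E. v \<in> closure e}" and u: "norm u = 1"
    and dir: "\<And>k. k < m \<Longrightarrow> direction v (\<epsilon> k) = u * cis (2 * pi * real k / real m)"
    and k: "k < m"
  shows "is_next_edge E v (\<epsilon> k) e' \<longleftrightarrow> e' = \<epsilon> (Suc k mod m)"
proof -
  define f where "f e' = ccw_angle (direction v (\<epsilon> k)) (direction v e')" for e'
  define P where "P e' \<longleftrightarrow> e' \<in> E \<and> v \<in> closure e'" for e'
  have f: "f (\<epsilon> j) = 2 * pi * real (ccw_steps m k j) / real m" if "j < m" for j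
    unfolding f_def dir[OF that] dir[OF k] by (rule ccw_angle_cis[OF that k u])
  let ?j = "Suc k mod m"
  have j: "?j < m" using k by simp
  have P: "P (\<epsilon> i)" if "i < m" for i using bij_betwE[OF bij] that by (auto simp: P_def)
  \<comment> \<open>For m = 1 the successor is the edge itself, reached by the full turn, which
    counts as m = 1 step.\<close>
  have steps1: "ccw_steps m k ?j = 1"
    using k by (cases "Suc k = m") (auto simp: ccw_steps_def)
  have less: "f (\<epsilon> ?j) < f e" if e: "P e" "e \<noteq> \<epsilon> ?j" for e
  proof -
    have "e \<in> \<epsilon> ` {..<m}" using bij e(1) by (simp add: bij_betw_def P_def)
    then obtain i where i: "i < m" "e = \<epsilon> i" by auto
    then have "i \<noteq> ?j" using e(2) by auto
    then have "1 < ccw_steps m k i"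
      using k i(1) by (cases "Suc k = m") (auto simp: ccw_steps_def)
    then show ?thesis unfolding i(2) f[OF i(1)] f[OF j] steps1
      using k by (intro divide_strict_right_mono mult_strict_left_mono) auto
  qed
  have "is_arg_min f P (\<epsilon> ?j)"
    unfolding is_arg_min_def using P[OF j] less by (metis less_asym less_irrefl)
  moreover have "x = \<epsilon> ?j" if "is_arg_min f P x" for x
    using that less[of x] P[OF j] unfolding is_arg_min_def by blast
  ultimately show ?thesis unfolding is_next_edge_def f_def[abs_def] P_def[abs_def] by blast
qed

lemma next_edge_star:
  assumes "bij_betw \<epsilon> {..<m} {e \<in> E. v \<in> closure e}" "norm u = 1"
    and "\<And>k. k < m \<Longrightarrow> direction v (\<epsilon> k) = u * cis (2 * pi * real k / real m)" "k < m"
  shows "next_edge E v (\<epsilon> k) = \<epsilon> (Suc k mod m)"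
  unfolding next_edge_some by (rule some_equality) (simp_all add: is_next_edge_star[OF assms])

section \<open>The ends of an edge\<close>

lemma bounded_poly_le:
  fixes F :: "complex poly"
  assumes "degree F > 0"
  shows "bounded {z. norm (poly F z) \<le> B}"
proof -
  obtain a p where F: "F = pCons a p" by (cases F)
  then have "p \<noteq> 0" using assms by auto
  then obtain r where r: "\<And>z. r \<le> norm z \<Longrightarrow> B + 1 \<le> norm (poly F z)"
    using poly_infinity[of p "B + 1" a] F by blast
  have "norm z \<le> r" if "norm (poly F z) \<le> B" for z
    using r[of z] that by linarith
  then show ?thesis unfolding bounded_iff by blast
qed

lemma edge_subset: "e \<in> preimage_edges F 0 1 \<Longrightarrow> e \<subseteq> poly F -` unit_segment"
  unfolding preimage_edges_unit by (rule in_components_subset)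

lemma closure_unit_segment: "closure unit_segment = of_real ` {0..1}"
  by (auto simp: unit_segment_def closure_open_segment in_segment scaleR_conv_of_real)

lemma bounded_edge:
  assumes F: "shabat F 0 1" and e: "e \<in> preimage_edges F 0 1"
  shows "bounded e"
proof (rule bounded_subset)
  show "bounded {z. norm (poly F z) \<le> 1}"
    by (rule bounded_poly_le) (use F in \<open>simp add: shabat_def\<close>)
  show "e \<subseteq> {z. norm (poly F z) \<le> 1}"
  proof
    fix z assume "z \<in> e"
    then have "poly F z \<in> unit_segment" using edge_subset[OF e] by blast
    then show "z \<in> {z. norm (poly F z) \<le> 1}" by (auto simp: unit_segment_iff)
  qed
qed

text \<open>The closure of an edge is compact, so its image is closed; it contains the open segment
  and hence the end 0.\<close>

lemma edge_has_root_end: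
  assumes F: "shabat F 0 1" and e: "e \<in> preimage_edges F 0 1"
  shows "\<exists>v \<in> closure e. poly F v = 0"
proof -
  have "compact (closure e)" using bounded_edge[OF assms] by simp
  then have "compact (poly F ` closure e)" by (intro compact_continuous_image continuous_intros)
  then have "closed (poly F ` closure e)" by (rule compact_imp_closed)
  moreover have "unit_segment \<subseteq> poly F ` closure e"
    using image_mono[OF closure_subset[of e], of "poly F"] edge_bij[OF assms] by (simp add: bij_betw_def)
  ultimately have "closure unit_segment \<subseteq> poly F ` closure e" by (rule closure_minimal[rotated])
  moreover have "0 \<in> closure unit_segment" unfolding closure_unit_segment by force
  ultimately have "0 \<in> poly F ` closure e" by blast
  then show ?thesis by force
qed

lemma edge_end_eqI:
  assumes F: "shabat F 0 1" and e: "e \<in> preimage_edges F 0 1" and v: "v \<in> closure e" "poly F v = 0"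
  shows "edge_end F 0 e = v"
proof -
  obtain \<epsilon> u where bij: "bij_betw \<epsilon> {..<order v F} {e \<in> preimage_edges F 0 1. v \<in> closure e}"
    and "norm u = 1"
    and "\<And>k. k < order v F \<Longrightarrow> direction v (\<epsilon> k) = u * cis (2 * pi * k / order v F)"
    and uniq: "\<And>k w. \<lbrakk>k < order v F; w \<in> closure (\<epsilon> k); poly F w = 0\<rbrakk> \<Longrightarrow> w = v"
    and "\<And>k. k < order v F \<Longrightarrow> v islimpt \<epsilon> k"
    and "\<And>k. k < order v F \<Longrightarrow> ((\<lambda>z. sgn (z - v)) \<longlongrightarrow> direction v (\<epsilon> k)) (at v within \<epsilon> k)"
    by (rule star_at_root[OF F v(2)]) (rule that)
  have "e \<in> \<epsilon> ` {..<order v F}" using bij e v by (simp add: bij_betw_def)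
  then obtain k where k: "k < order v F" "e = \<epsilon> k" by auto
  show ?thesis
    unfolding edge_end_def
  proof (rule the_equality)
    show "v \<in> closure e \<and> poly F v = 0" using v by simp
    show "w = v" if "w \<in> closure e \<and> poly F w = 0" for w
      using uniq[OF k(1), of w] that k(2) by simp
  qed
qed

lemma edge_end_root:
  assumes F: "shabat F 0 1" and e: "e \<in> preimage_edges F 0 1"
  shows "edge_end F 0 e \<in> closure e" "poly F (edge_end F 0 e) = 0"
proof -
  obtain v where v: "v \<in> closure e" "poly F v = 0" using edge_has_root_end[OF assms] by blast
  then show "edge_end F 0 e \<in> closure e" "poly F (edge_end F 0 e) = 0"
    using edge_end_eqI[OF assms v] by simp_all
qed

lemma star_eq:
  assumes F: "shabat F 0 1" and v: "poly F v = 0"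
  shows "{e \<in> preimage_edges F 0 1. edge_end F 0 e = v} = {e \<in> preimage_edges F 0 1. v \<in> closure e}"
  using edge_end_eqI[OF F _ _ v] edge_end_root(1)[OF F] by blast

text \<open>In the numbering of \<open>star_at_root\<close>, \<open>next_edge\<close> is the shift
  of indices modulo the order, which is a single cycle. The conclusions no longer mention the
  numbering.\<close>

lemma root_star_cyclic:
  assumes F: "shabat F 0 1" and v: "poly F v = 0"
  defines "E \<equiv> preimage_edges F 0 1"
  defines "S \<equiv> {e \<in> E. edge_end F 0 e = v}"
  shows "card S = order v F"
    and "cyclic_on (\<lambda>e. next_edge E (edge_end F 0 e) e) S"
    and "\<And>e. e \<in> S \<Longrightarrow> direction v (next_edge E v e) = direction v e * cis (2 * pi / order v F)"
    and "\<And>e. e \<in> S \<Longrightarrow> v islimpt e"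
    and "\<And>e. e \<in> S \<Longrightarrow> ((\<lambda>z. sgn (z - v)) \<longlongrightarrow> direction v e) (at v within e)"
    and "\<And>e e'. e \<in> S \<Longrightarrow> is_next_edge E v e e' \<longleftrightarrow> e' = next_edge E v e"
proof -
  define m where "m = order v F"
  have F0: "F \<noteq> 0" using F by (auto simp: shabat_def)
  have m: "m > 0" using F0 v by (simp add: m_def order_gt_0_iff)
  obtain \<epsilon> :: "nat \<Rightarrow> complex set" and u :: complex where bij: "bij_betw \<epsilon> {..<m} {e \<in> E. v \<in> closure e}" and u: "norm u = 1"
    and dir: "\<And>k. k < m \<Longrightarrow> direction v (\<epsilon> k) = u * cis (2 * pi * real k / real m)"
    and "\<And>k w. \<lbrakk>k < m; w \<in> closure (\<epsilon> k); poly F w = 0\<rbrakk> \<Longrightarrow> w = v"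
    and lim: "\<And>k. k < m \<Longrightarrow> v islimpt \<epsilon> k"
    and sgnlim: "\<And>k. k < m \<Longrightarrow> ((\<lambda>z. sgn (z - v)) \<longlongrightarrow> direction v (\<epsilon> k)) (at v within \<epsilon> k)"
    by (rule star_at_root[OF F v, folded m_def E_def]) (rule that, assumption+)
  have S: "S = {e \<in> E. v \<in> closure e}" unfolding S_def E_def by (rule star_eq[OF F v])
  have img: "S = \<epsilon> ` {..<m}" using bij unfolding S bij_betw_def by simp
  show "card S = order v F" using bij_betw_same_card[OF bij] unfolding S m_def by simp
  have nxt: "next_edge E v (\<epsilon> k) = \<epsilon> (Suc k mod m)" if "k < m" for k
    by (rule next_edge_star[OF bij u dir that])
  let ?f = "\<lambda>e. next_edge E (edge_end F 0 e) e"
  have f: "?f (\<epsilon> k) = \<epsilon> (Suc k mod m)" if "k < m" for k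
  proof -
    have "\<epsilon> k \<in> S" using that img by blast
    then show ?thesis using nxt[OF that] by (simp add: S_def)
  qed
  have iter: "(?f ^^ k) (\<epsilon> 0) = \<epsilon> (k mod m)" for k
  proof (induction k)
    case (Suc k)
    have "(?f ^^ Suc k) (\<epsilon> 0) = ?f (\<epsilon> (k mod m))" using Suc by simp
    also have "\<dots> = \<epsilon> (Suc k mod m)" using f[of "k mod m"] m by (simp add: mod_Suc_eq)
    finally show ?case .
  qed simp
  have "orbit ?f (\<epsilon> 0) = S"
  proof (intro equalityI subsetI)
    fix e assume "e \<in> orbit ?f (\<epsilon> 0)"
    then obtain n where "e = (?f ^^ n) (\<epsilon> 0)" unfolding orbit_altdef by blast
    then show "e \<in> S" using m by (simp add: iter img)
  next
    fix e assume "e \<in> S"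
    then obtain k where k: "k < m" "e = \<epsilon> k" using img by auto
    \<comment> \<open>The orbit consists of positive iterates only, so k = 0 is reached after a full
      round.\<close>
    then have "e = (?f ^^ (k + m)) (\<epsilon> 0)" unfolding iter by simp
    moreover have "0 < k + m" using m by simp
    ultimately show "e \<in> orbit ?f (\<epsilon> 0)" unfolding orbit_altdef by blast
  qed
  then show "cyclic_on ?f S" using m img unfolding cyclic_on_def by blast
  show "direction v (next_edge E v e) = direction v e * cis (2 * pi / order v F)" if "e \<in> S" for e
  proof -
    obtain k where k: "k < m" "e = \<epsilon> k" using \<open>e \<in> S\<close> img by auto
    have "cis (2 * pi * real (Suc k mod m) / real m) = cis (2 * pi * real k / real m) * cis (2 * pi / real m)"
    proof (cases "Suc k = m")
      case True
      have "2 * pi * real k / real m + 2 * pi / real m = 2 * pi * (real (Suc k) / real m)"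
        by (simp add: add_divide_distrib algebra_simps)
      also have "\<dots> = 2 * pi" using m unfolding True by simp
      finally have "2 * pi * real k / real m + 2 * pi / real m = 2 * pi" .
      then show ?thesis using True by (simp add: cis_mult)
    next
      case False
      then show ?thesis using k by (simp add: cis_mult field_simps)
    qed
    then show ?thesis using k m by (simp add: nxt dir mult.assoc flip: m_def)
  qed
  show "v islimpt e" if "e \<in> S" for e using that lim img by auto
  show "((\<lambda>z. sgn (z - v)) \<longlongrightarrow> direction v e) (at v within e)" if "e \<in> S" for e
    using that sgnlim img by auto
  show "is_next_edge E v e e' \<longleftrightarrow> e' = next_edge E v e" if "e \<in> S" for e e'
  proof -
    obtain k where k: "k < m" "e = \<epsilon> k" using \<open>e \<in> S\<close> img by auto
    show ?thesis unfolding k(2) nxt[OF k(1)] by (rule is_next_edge_star[OF bij u dir k(1)])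
  qed
qed

lemma edges_eq_stars:
  assumes F: "shabat F 0 1"
  shows "preimage_edges F 0 1 = (\<Union>v\<in>{v. poly F v = 0}. {e \<in> preimage_edges F 0 1. edge_end F 0 e = v})"
  using edge_end_root(2)[OF F] by blast

text \<open>Every edge ends in exactly one root, and a root carries as many edges as its order; the
  orders add up to the degree.\<close>

lemma shabat_finite_edges:
  assumes F: "shabat F 0 1"
  shows "finite (preimage_edges F 0 1)" "card (preimage_edges F 0 1) = degree F"
proof -
  let ?S = "\<lambda>v. {e \<in> preimage_edges F 0 1. edge_end F 0 e = v}"
  have F0: "F \<noteq> 0" using F by (auto simp: shabat_def)
  have fin: "finite {v. poly F v = 0}" using poly_roots_finite[OF F0] .
  have finS: "finite (?S v)" if "poly F v = 0" for v
    using finite_cyclic_on[OF root_star_cyclic(2)[OF F that]] .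
  show "finite (preimage_edges F 0 1)"
    by (subst edges_eq_stars[OF F]) (use fin finS in auto)
  have "card (preimage_edges F 0 1) = card (\<Union>v\<in>{v. poly F v = 0}. ?S v)"
    by (subst edges_eq_stars[OF F]) simp
  also have "\<dots> = (\<Sum>v\<in>{v. poly F v = 0}. card (?S v))"
    by (rule card_UN_disjoint) (use fin finS in auto)
  also have "\<dots> = (\<Sum>v\<in>{v. poly F v = 0}. order v F)"
    by (intro sum.cong refl) (use root_star_cyclic(1)[OF F] in auto)
  also have "\<dots> = degree F" by (rule sum_order_complex[OF F0])
  finally show "card (preimage_edges F 0 1) = degree F" .
qed

text \<open>The local results above concern roots of F, the black ends. The reflection exchanges 0
  and 1 and fixes the segment, so it carries them over to the white ends.\<close>

lemma shabat_reflect: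
  assumes "shabat F 0 1" shows "shabat (1 - F) 0 1"
proof -
  have "degree (1 - F) = degree F"
    using degree_diff_const[of F 1] assms by (metis degree_minus minus_diff_eq one_pCons shabat_def)
  then show ?thesis using assms by (auto simp: shabat_def pderiv_diff)
qed

lemma preimage_edges_reflect: "preimage_edges (1 - F) 0 1 = preimage_edges F 0 1"
proof -
  have "poly (1 - F) -` unit_segment = poly F -` unit_segment"
    using unit_segment_reflect by auto
  then show ?thesis by (simp add: preimage_edges_unit)
qed

lemma edge_end_reflect: "edge_end (1 - F) 0 e = edge_end F 1 e" "edge_end (1 - F) 1 e = edge_end F 0 e"
  by (simp_all add: edge_end_def eq_commute[of 1])

lemma shabat_tree_reflect: "shabat_tree (1 - F) 0 1 = swap_colors (shabat_tree F 0 1)"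
  by (simp add: shabat_tree_def swap_colors_def preimage_edges_reflect edge_end_reflect fun_eq_iff
      eq_commute[of 1])

lemma shabat_tree_simps:
  "black_verts (shabat_tree F c d) = {z. poly F z = c}"
  "white_verts (shabat_tree F c d) = {z. poly F z = d}"
  "edges (shabat_tree F c d) = preimage_edges F c d"
  "black_end (shabat_tree F c d) = edge_end F c"
  "white_end (shabat_tree F c d) = edge_end F d"
  "black_next (shabat_tree F c d) = (\<lambda>e. next_edge (preimage_edges F c d) (edge_end F c e) e)"
  "white_next (shabat_tree F c d) = (\<lambda>e. next_edge (preimage_edges F c d) (edge_end F d e) e)"
  by (simp_all add: shabat_tree_def)

lemma card_black_star_shabat:
  assumes "shabat F 0 1" "poly F v = 0"
  shows "card (black_star (shabat_tree F 0 1) v) = order v F"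
  using root_star_cyclic(1)[OF assms] by (simp add: black_star_def shabat_tree_simps)

lemma card_white_star_shabat:
  assumes "shabat F 0 1" "poly F v = 1"
  shows "card (white_star (shabat_tree F 0 1) v) = order v (1 - F)"
  using card_black_star_shabat[OF shabat_reflect[OF assms(1)], of v] assms(2)
  by (simp add: shabat_tree_reflect)

lemma shabat_tree_map:
  assumes F: "shabat F 0 1"
  shows "bicolored_map (shabat_tree F 0 1)"
proof -
  have half: "edge_end F 0 ` preimage_edges F 0 1 \<subseteq> {z. poly F z = 0} \<and>
     (\<forall>v\<in>{z. poly F z = 0}. cyclic_on (black_next (shabat_tree F 0 1)) (black_star (shabat_tree F 0 1) v))"
    if F: "shabat F 0 1" for F
    using edge_end_root(2)[OF F] root_star_cyclic(2)[OF F] by (auto simp: black_star_def shabat_tree_simps)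
  have "preimage_edges F 0 1 \<noteq> {}"
    using shabat_finite_edges(2)[OF F] F by (auto simp: shabat_def)
  then show ?thesis
    using half[OF F] half[OF shabat_reflect[OF F]] shabat_finite_edges(1)[OF F]
    unfolding bicolored_map_def shabat_tree_reflect
    by (simp add: shabat_tree_simps edge_end_reflect[abs_def] preimage_edges_reflect eq_commute[of 1]) auto
qed

section \<open>Acyclicity\<close>

text \<open>Maximum principle: \<open>Im F\<close> would vanish on a bounded component of the complement.\<close>

lemma connected_complement_real:
  fixes F :: "complex poly"
  assumes deg: "degree F > 0" and K: "compact K" and real: "\<And>z. z \<in> K \<Longrightarrow> poly F z \<in> \<real>"
  shows "connected (- K)"
proof (rule ccontr)
  assume discon: "\<not> connected (- K)"
  have bdd: "bounded (- (- K))" using compact_imp_bounded[OF K] by simp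
  obtain C where C: "C \<in> components (- K)" "bounded C"
    by (rule cobounded_has_bounded_component[OF bdd discon]) (simp, rule that, assumption+)
  have openC: "open C" using open_Compl[OF compact_imp_closed[OF K]] C(1) by (rule open_components)
  have conC: "connected C" and neC: "C \<noteq> {}"
    using in_components_connected[OF C(1)] in_components_nonempty[OF C(1)] .
  have fr: "frontier C \<subseteq> K"
    using frontier_of_components_closed_complement[OF compact_imp_closed[OF K] C(1)] .
  have Im0: "Im (s * poly F z) \<ge> 0" if z: "z \<in> C" and s: "s \<in> {1, -1}" for z and s :: complex
  proof -
    \<comment> \<open>The modulus of this function is exp (- Im (s F)), which is 1 on the frontier;
      the signs s = 1 and s = -1 together force Im F = 0 on C.\<close>
    let ?f = "\<lambda>z. exp (\<i> * (s * poly F z))"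
    have "norm (?f z) \<le> 1"
    proof (rule maximum_modulus_frontier[OF _ _ C(2) _ z])
      show "?f holomorphic_on interior C"
        by (intro holomorphic_intros poly_holomorphic_on)
      show "continuous_on (closure C) ?f" by (intro continuous_intros)
      show "norm (?f w) \<le> 1" if "w \<in> frontier C" for w
      proof -
        have "poly F w \<in> \<real>" using real fr that by blast
        then have "Im (poly F w) = 0" by (simp add: complex_is_Real_iff)
        then show ?thesis using s by auto
      qed
    qed
    then show ?thesis by simp
  qed
  have reals: "poly F ` C \<subseteq> \<real>"
  proof
    fix w assume "w \<in> poly F ` C"
    then obtain z where z: "z \<in> C" "w = poly F z" by blast
    then show "w \<in> \<real>" using Im0[OF z(1), of 1] Im0[OF z(1), of "-1"] by (simp add: complex_is_Real_iff)
  qed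
  have "\<not> poly F constant_on C"
  proof
    assume "poly F constant_on C"
    then obtain c where c: "\<And>z. z \<in> C \<Longrightarrow> poly F z = c" by (auto simp: constant_on_def)
    then have "C \<subseteq> {z. poly F z = c}" by blast
    then have "finite C" using card_fibre_le(1)[OF deg] by (rule finite_subset)
    then show False using finite_imp_not_open neC openC by blast
  qed
  \<comment> \<open>A nonempty open set does not fit into the real line; a point straight above a
    value of F is the witness.\<close>
  then have "open (poly F ` C)"
    using open_mapping_thm[OF poly_holomorphic_on openC conC openC subset_refl] by blast
  moreover obtain z where z: "z \<in> C" using neC by blast
  ultimately obtain e where e: "e > 0" "ball (poly F z) e \<subseteq> poly F ` C"
    by (meson openE imageI)
  have "poly F z + \<i> * of_real (e / 2) \<in> ball (poly F z) e"
    using e(1) by (simp add: dist_norm norm_mult)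
  then have "poly F z + \<i> * of_real (e / 2) \<in> \<real>" using e(2) reals by blast
  moreover have "poly F z \<in> \<real>" using z reals by blast
  ultimately show False using e(1) by (simp add: complex_is_Real_iff)
qed

text \<open>A limit point with a value strictly between 0 and 1 could be added to e without losing
  connectedness, so maximality of the component puts it in e. The remaining limit points are the two
  unique ends.\<close>

lemma closure_edge:
  assumes F: "shabat F 0 1" and e: "e \<in> preimage_edges F 0 1"
  shows "closure e = insert (edge_end F 0 e) (insert (edge_end F 1 e) e)"
proof
  have e': "e \<in> preimage_edges (1 - F) 0 1" using e by (simp add: preimage_edges_reflect)
  note w = edge_end_root[OF shabat_reflect[OF F] e', unfolded edge_end_reflect]
  show "insert (edge_end F 0 e) (insert (edge_end F 1 e) e) \<subseteq> closure e"
    using edge_end_root(1)[OF F e] w(1) closure_subset by auto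
  show "closure e \<subseteq> insert (edge_end F 0 e) (insert (edge_end F 1 e) e)"
  proof
    fix z assume z: "z \<in> closure e"
    have "poly F ` closure e \<subseteq> closure (poly F ` e)"
      by (intro image_closure_subset continuous_intros closure_subset) simp
    also have "\<dots> = of_real ` {0..1}"
      using edge_bij[OF F e] by (simp add: bij_betw_def closure_unit_segment)
    finally obtain t :: real where t: "0 \<le> t" "t \<le> 1" "poly F z = of_real t" using z by auto
    consider "t = 0" | "t = 1" | "0 < t" "t < 1" using t by linarith
    then show "z \<in> insert (edge_end F 0 e) (insert (edge_end F 1 e) e)"
    proof cases
      case 1
      then show ?thesis using edge_end_eqI[OF F e z] t by simp
    next
      case 2
      then show ?thesis using edge_end_eqI[OF shabat_reflect[OF F] e' z] t by (simp add: edge_end_reflect)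
    next
      case 3
      have "insert z e \<subseteq> e"
      proof (rule components_maximal)
        show "e \<in> components (poly F -` unit_segment)" using e by (simp add: preimage_edges_unit)
        show "connected (insert z e)"
          by (rule connected_intermediate_closure[of e])
            (use e z closure_subset in \<open>auto simp: preimage_edges_unit intro: in_components_connected\<close>)
        show "insert z e \<subseteq> poly F -` unit_segment"
          using edge_subset[OF e] 3 t by (auto simp: unit_segment_iff)
        show "e \<inter> insert z e \<noteq> {}"
          using e in_components_nonempty unfolding preimage_edges_unit by blast
      qed
      then show ?thesis by simp
    qed
  qed
qed

lemma white_end_value:
  assumes F: "shabat F 0 1" and e: "e \<in> preimage_edges F 0 1"
  shows "poly F (edge_end F 1 e) = 1"
  using edge_end_root(2)[OF shabat_reflect[OF F], of e] e
  by (simp add: preimage_edges_reflect edge_end_reflect)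

lemma closure_edge_real:
  assumes "shabat F 0 1" "e \<in> preimage_edges F 0 1" "z \<in> closure e"
  shows "poly F z \<in> \<real>"
proof (cases "z \<in> e")
  case True
  then have "poly F z \<in> unit_segment" using edge_subset[OF assms(2)] by blast
  then show ?thesis by (auto simp: unit_segment_iff)
next
  case False
  then have "z = edge_end F 0 e \<or> z = edge_end F 1 e" using assms(3) closure_edge[OF assms(1,2)] by simp
  then show ?thesis using edge_end_root(2)[OF assms(1,2)] white_end_value[OF assms(1,2)] by auto
qed

text \<open>An inner point of e has a value strictly between 0 and 1, so it is not an end of f, and
  distinct components share no inner point.\<close>

lemma closure_edges_Int:
  assumes F: "shabat F 0 1" and e: "e \<in> preimage_edges F 0 1" and f: "f \<in> preimage_edges F 0 1" and "e \<noteq> f"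
  shows "closure e \<inter> closure f \<subseteq> {edge_end F 0 e, edge_end F 1 e}"
proof
  fix z assume z: "z \<in> closure e \<inter> closure f"
  show "z \<in> {edge_end F 0 e, edge_end F 1 e}"
  proof (rule ccontr)
    assume n: "z \<notin> {edge_end F 0 e, edge_end F 1 e}"
    then have ze: "z \<in> e" using z closure_edge[OF F e] by auto
    then have "poly F z \<notin> {0, 1}" using edge_subset[OF e] by (auto simp: unit_segment_iff)
    then have "z \<in> f"
      using z closure_edge[OF F f] edge_end_root(2)[OF F f] white_end_value[OF F f] by auto
    then show False
      using components_eq[of e "poly F -` unit_segment" f] e f ze assms(4)
      unfolding preimage_edges_unit by blast
  qed
qed

text \<open>A cycle consists of an edge and a connected rest meeting it in its two ends only; by
  Janiszewski's theorem it would separate the plane.\<close>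

lemma shabat_tree_acyclic:
  assumes F: "shabat F 0 1"
  shows "\<not> has_cycle (shabat_tree F 0 1)"
proof
  let ?E = "preimage_edges F 0 1" and ?b = "edge_end F 0" and ?w = "edge_end F 1"
  assume "has_cycle (shabat_tree F 0 1)"
  then obtain k x y where k: "0 < (k::nat)"
    and xy: "\<And>i. i < k \<Longrightarrow> x i \<in> ?E" "\<And>i. i < k \<Longrightarrow> y i \<in> ?E" "\<And>i. i < k \<Longrightarrow> x i \<noteq> y i"
      "\<And>i. i < k \<Longrightarrow> ?w (x i) = ?w (y i)" "\<And>i. i < k \<Longrightarrow> ?b (y i) = ?b (x (Suc i mod k))"
    and inj: "inj_on (\<lambda>i. ?b (x i)) {..<k}" "inj_on (\<lambda>i. ?w (x i)) {..<k}"
    unfolding has_cycle_def shabat_tree_simps by blast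
  have cl: "?b e \<in> closure e" "?w e \<in> closure e" "compact (closure e)" "connected (closure e)"
    if "e \<in> ?E" for e
  proof -
    show "?b e \<in> closure e" "?w e \<in> closure e" by (simp_all add: closure_edge[OF F that])
    show "compact (closure e)" using bounded_edge[OF F that] by simp
    show "connected (closure e)"
      using in_components_connected[OF that[unfolded preimage_edges_unit]]
      by (rule connected_imp_connected_closure)
  qed
  \<comment> \<open>\<open>U (k - 1)\<close> is the cycle without its edge \<open>x 0\<close>, built
    up as a path so that connectedness follows by induction.\<close>
  define U where "U j = closure (y 0) \<union> (\<Union>i\<in>{1..j}. closure (x i) \<union> closure (y i))" for j
  have U_Suc: "U (Suc j) = U j \<union> (closure (x (Suc j)) \<union> closure (y (Suc j)))" for j
    by (auto simp: U_def atLeastAtMostSuc_conv)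
  have yU: "closure (y j) \<subseteq> U j" for j by (cases j) (auto simp: U_def)
  have conU: "connected (U j)" if "j < k" for j
    using that
  proof (induction j)
    case 0
    then show ?case using cl(4)[OF xy(2)[OF k]] by (simp add: U_def)
  next
    case (Suc j)
    have "?w (x (Suc j)) \<in> closure (x (Suc j)) \<inter> closure (y (Suc j))"
      using cl(2)[OF xy(1)[OF Suc.prems]] cl(2)[OF xy(2)[OF Suc.prems]] xy(4)[OF Suc.prems] by simp
    then have 1: "connected (closure (x (Suc j)) \<union> closure (y (Suc j)))"
      using cl(4)[OF xy(1)[OF Suc.prems]] cl(4)[OF xy(2)[OF Suc.prems]] by (intro connected_Un) auto
    have j: "j < k" using Suc.prems by simp
    have "?b (y j) = ?b (x (Suc j))" using xy(5)[OF j] Suc.prems by simp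
    then have "?b (y j) \<in> U j \<inter> (closure (x (Suc j)) \<union> closure (y (Suc j)))"
      using cl(1)[OF xy(2)[OF j]] cl(1)[OF xy(1)[OF Suc.prems]] yU[of j] by auto
    then have "U j \<inter> (closure (x (Suc j)) \<union> closure (y (Suc j))) \<noteq> {}" by blast
    then show ?case unfolding U_Suc by (rule connected_Un[OF Suc.IH[OF j] 1])
  qed
  let ?S = "closure (x 0)" and ?T = "U (k - 1)"
  have k1: "k - 1 < k" using k by simp
  have mem: "\<exists>e\<in>?E. e \<noteq> x 0 \<and> z \<in> closure e" if "z \<in> ?T" for z
  proof -
    \<comment> \<open>Injectivity on the ends keeps \<open>x 0\<close> from reappearing later in the
      cycle.\<close>
    have "x i \<noteq> x 0 \<and> y i \<noteq> x 0" if i: "1 \<le> i" "i \<le> k - 1" for i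
    proof -
      have ik: "i < k" "i \<noteq> 0" using i k by auto
      have "?b (x i) \<noteq> ?b (x 0)" using inj_onD[OF inj(1), of i 0] ik k by auto
      moreover have "?w (y i) \<noteq> ?w (x 0)" using inj_onD[OF inj(2), of i 0] ik k xy(4)[OF ik(1)] by auto
      ultimately show ?thesis by auto
    qed
    moreover have "x i \<in> ?E \<and> y i \<in> ?E" if "i \<le> k - 1" for i
      using xy(1,2)[of i] that k by auto
    moreover have "y 0 \<noteq> x 0" using xy(3)[OF k] by simp
    ultimately show ?thesis using that unfolding U_def by fastforce
  qed
  have compT: "compact ?T"
    unfolding U_def using cl(3) xy(1,2) k by (intro compact_Un compact_UN) auto
  have x0: "x 0 \<in> ?E" using xy(1) k by simp
  have "connected (- (?S \<union> ?T))"
  proof (rule connected_complement_real)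
    show "degree F > 0" using F by (simp add: shabat_def)
    show "compact (?S \<union> ?T)" using compT cl(3)[OF x0] by (rule compact_Un[rotated])
    show "poly F z \<in> \<real>" if "z \<in> ?S \<union> ?T" for z
      using that mem[of z] x0 closure_edge_real[OF F] by blast
  qed
  \<comment> \<open>The union does not separate the plane, so the intersection is connected; but it
    consists of the two ends of \<open>x 0\<close>.\<close>
  then have con: "connected (?S \<inter> ?T)"
    using Janiszewski_dual[OF cl(3)[OF x0] compT cl(4)[OF x0] conU[OF k1]] by blast
  have "?S \<inter> ?T = {?b (x 0), ?w (x 0)}"
  proof
    show "?S \<inter> ?T \<subseteq> {?b (x 0), ?w (x 0)}"
    proof
      fix z assume z: "z \<in> ?S \<inter> ?T"
      then obtain e where "e \<in> ?E" "e \<noteq> x 0" "z \<in> closure e" using mem by blast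
      then show "z \<in> {?b (x 0), ?w (x 0)}" using closure_edges_Int[OF F x0, of e] z by blast
    qed
    have "?w (x 0) \<in> closure (y 0)" using cl(2)[OF xy(2)[OF k]] xy(4)[OF k] by simp
    moreover have "?b (x 0) \<in> closure (y (k - 1))"
      using cl(1)[OF xy(2)[OF k1]] xy(5)[OF k1] k by simp
    ultimately show "{?b (x 0), ?w (x 0)} \<subseteq> ?S \<inter> ?T"
      using cl(1,2)[OF x0] yU[of "k - 1"] by (auto simp: U_def)
  qed
  then have "\<exists>a. {?b (x 0), ?w (x 0)} = {a}"
    using connected_finite_iff_sing[OF con] by auto
  then have "?b (x 0) = ?w (x 0)" by auto
  then show False using edge_end_root(2)[OF F x0] white_end_value[OF F x0] by simp
qed

section \<open>Equivalent polynomials\<close>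

lemma components_vimage_subset:
  fixes \<phi> \<sigma> :: "complex \<Rightarrow> complex"
  assumes cont: "continuous_on UNIV \<phi>" "continuous_on UNIV \<sigma>"
    and inv: "\<And>z. \<sigma> (\<phi> z) = z" "\<And>z. \<phi> (\<sigma> z) = z"
    and e: "e \<in> components (\<phi> -` S)"
  shows "\<phi> ` e \<in> components S"
proof -
  have e': "e \<noteq> {}" "e \<subseteq> \<phi> -` S" "connected e"
     "\<And>d. \<lbrakk>d \<noteq> {}; e \<subseteq> d; d \<subseteq> \<phi> -` S; connected d\<rbrakk> \<Longrightarrow> d = e"
    using e unfolding in_components_maximal by blast+
  have "connected (\<phi> ` e)"
    by (rule connected_continuous_image[OF continuous_on_subset[OF cont(1)] e'(3)]) simp
  moreover have "d = \<phi> ` e" if d: "d \<noteq> {}" "\<phi> ` e \<subseteq> d" "d \<subseteq> S" "connected d" for d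
  proof -
    have "\<sigma> ` d = e"
    proof (rule e'(4))
      show "connected (\<sigma> ` d)"
        by (rule connected_continuous_image[OF continuous_on_subset[OF cont(2)] d(4)]) simp
      show "e \<subseteq> \<sigma> ` d" using image_mono[OF d(2), of \<sigma>] by (simp add: image_image inv)
    qed (use d inv in auto)
    then have "\<phi> ` \<sigma> ` d = \<phi> ` e" by simp
    then show ?thesis by (simp add: image_image inv)
  qed
  ultimately show ?thesis
    unfolding in_components_maximal using e'(1,2) by blast
qed

lemma components_vimage_iff:
  fixes \<phi> \<sigma> :: "complex \<Rightarrow> complex"
  assumes cont: "continuous_on UNIV \<phi>" "continuous_on UNIV \<sigma>"
    and inv: "\<And>z. \<sigma> (\<phi> z) = z" "\<And>z. \<phi> (\<sigma> z) = z"
  shows "e \<in> components (\<phi> -` S) \<longleftrightarrow> \<phi> ` e \<in> components S"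
proof
  assume "\<phi> ` e \<in> components S"
  moreover have "S = \<sigma> -` \<phi> -` S" by (simp add: vimage_def inv)
  ultimately have "\<phi> ` e \<in> components (\<sigma> -` \<phi> -` S)" by simp
  from components_vimage_subset[OF cont(2,1) inv(2,1) this]
  show "e \<in> components (\<phi> -` S)" by (simp add: image_image inv)
qed (rule components_vimage_subset[OF assms])

lemma root_end_facts:
  assumes F: "shabat F 0 1" and e: "e \<in> preimage_edges F 0 1"
  defines "v \<equiv> edge_end F 0 e"
  shows "v \<in> closure e \<and> poly F v = 0"
    and "w \<in> closure e \<Longrightarrow> poly F w = 0 \<Longrightarrow> w = v"
    and "e' \<in> preimage_edges F 0 1 \<Longrightarrow> v \<in> closure e' \<Longrightarrow>
      ((\<lambda>z. sgn (z - v)) \<longlongrightarrow> direction v e') (at v within e')"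
    and "is_next_edge (preimage_edges F 0 1) v e e' \<longleftrightarrow> e' = next_edge (preimage_edges F 0 1) v e"
proof -
  show v: "v \<in> closure e \<and> poly F v = 0" unfolding v_def using edge_end_root[OF F e] by simp
  show "w \<in> closure e \<Longrightarrow> poly F w = 0 \<Longrightarrow> w = v"
    unfolding v_def using edge_end_eqI[OF F e] by simp
  have v0: "poly F v = 0" using v by simp
  have st: "((\<lambda>z. sgn (z - v)) \<longlongrightarrow> direction v f) (at v within f)"
    "is_next_edge (preimage_edges F 0 1) v f f' \<longleftrightarrow> f' = next_edge (preimage_edges F 0 1) v f"
    if "f \<in> preimage_edges F 0 1" "edge_end F 0 f = v" for f f'
    using root_star_cyclic(5,6)[OF F v0, of f] that by simp_all
  show "((\<lambda>z. sgn (z - v)) \<longlongrightarrow> direction v e') (at v within e')"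
    if e': "e' \<in> preimage_edges F 0 1" "v \<in> closure e'"
    by (rule st(1)[OF e'(1) edge_end_eqI[OF F e' v0]])
  show "is_next_edge (preimage_edges F 0 1) v e e' \<longleftrightarrow> e' = next_edge (preimage_edges F 0 1) v e"
    by (rule st(2)[OF e meta_eq_to_obj_eq[OF v_def, symmetric]])
qed

text \<open>The critical value c is a parameter, so that the transport along affine maps below is
  carried out once for both colours.\<close>

lemma end_facts:
  assumes F: "shabat F 0 1" and c: "c = 0 \<or> c = 1" and e: "e \<in> preimage_edges F 0 1"
  shows "edge_end F c e \<in> closure e \<and> poly F (edge_end F c e) = c"
    and "w \<in> closure e \<Longrightarrow> poly F w = c \<Longrightarrow> w = edge_end F c e"
    and "e' \<in> preimage_edges F 0 1 \<Longrightarrow> edge_end F c e \<in> closure e' \<Longrightarrow>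
      ((\<lambda>z. sgn (z - edge_end F c e)) \<longlongrightarrow> direction (edge_end F c e) e') (at (edge_end F c e) within e')"
    and "is_next_edge (preimage_edges F 0 1) (edge_end F c e) e e' \<longleftrightarrow>
      e' = next_edge (preimage_edges F 0 1) (edge_end F c e) e"
proof -
  note 0 = root_end_facts[OF F e]
  note 1 = root_end_facts[OF shabat_reflect[OF F], unfolded preimage_edges_reflect edge_end_reflect, OF e]
  show "edge_end F c e \<in> closure e \<and> poly F (edge_end F c e) = c"
    by (rule disjE[OF c]) (use 0(1) 1(1) in simp_all)
  show "w \<in> closure e \<Longrightarrow> poly F w = c \<Longrightarrow> w = edge_end F c e"
    by (rule disjE[OF c]) (use 0(2)[of w] 1(2)[of w] in simp_all)
  show "((\<lambda>z. sgn (z - edge_end F c e)) \<longlongrightarrow> direction (edge_end F c e) e') (at (edge_end F c e) within e')"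
    if "e' \<in> preimage_edges F 0 1" "edge_end F c e \<in> closure e'"
    by (rule disjE[OF c]) (use 0(3)[of e'] 1(3)[of e'] that in simp_all)
  show "is_next_edge (preimage_edges F 0 1) (edge_end F c e) e e' \<longleftrightarrow>
      e' = next_edge (preimage_edges F 0 1) (edge_end F c e) e"
    by (rule disjE[OF c]) (use 0(4)[of e'] 1(4)[of e'] in simp_all)
qed

locale affine_change =
  fixes F G :: "complex poly" and A B a b :: complex
  assumes F: "shabat F 0 1" and A: "A \<noteq> 0" and a: "a \<noteq> 0"
    and G: "G = smult A (F \<circ>\<^sub>p [:b, a:]) + [:B:]"
begin

definition \<phi> :: "complex \<Rightarrow> complex" where "\<phi> z = a * z + b"
definition \<sigma> :: "complex \<Rightarrow> complex" where "\<sigma> z = (z - b) / a"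

lemma inv: "\<sigma> (\<phi> z) = z" "\<phi> (\<sigma> z) = z"
  using a by (simp_all add: \<phi>_def \<sigma>_def)

lemma cont: "continuous_on S \<phi>" "continuous_on S \<sigma>"
  unfolding \<phi>_def \<sigma>_def using a by (intro continuous_intros; simp)+

lemma img: "\<phi> ` \<sigma> ` S = S" "\<sigma> ` \<phi> ` S = S"
  by (simp_all add: image_image inv)

lemma poly_G: "poly G z = A * poly F (\<phi> z) + B"
  by (simp add: G poly_pcompose \<phi>_def algebra_simps)

lemma poly_G_eq: "poly G z = A * c + B \<longleftrightarrow> poly F (\<phi> z) = c"
  using A by (simp add: poly_G)

lemma shabat_G: "shabat G B (A + B)"
proof -
  have "degree G = degree F"
  proof -
    have "degree (F \<circ>\<^sub>p [:b, a:]) = degree F" using a by (simp add: degree_pcompose)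
    then have "degree (smult A (F \<circ>\<^sub>p [:b, a:])) = degree F" using A by simp
    moreover have "degree F > 0" using F by (simp add: shabat_def)
    ultimately show ?thesis unfolding G by (subst degree_add_eq_left) simp_all
  qed
  moreover have "poly (pderiv G) z = A * a * poly (pderiv F) (\<phi> z)" for z
    by (simp add: G pderiv_add pderiv_smult pderiv_pcompose pderiv_pCons poly_pcompose \<phi>_def algebra_simps)
  ultimately show ?thesis using F A a poly_G_eq[of _ 0] poly_G_eq[of _ 1] by (auto simp: shabat_def)
qed

lemma edges_G: "e \<in> preimage_edges G B (A + B) \<longleftrightarrow> \<phi> ` e \<in> preimage_edges F 0 1"
proof -
  have "poly G z \<in> open_segment B (A + B) \<longleftrightarrow> poly F (\<phi> z) \<in> unit_segment" for z
  proof -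
    have "poly G z = of_real (1 - u) * B + of_real u * (A + B) \<longleftrightarrow> poly F (\<phi> z) = of_real u" for u :: real
    proof -
      have "of_real (1 - u) * B + of_real u * (A + B) = A * of_real u + B" by (simp add: algebra_simps)
      then show ?thesis using poly_G_eq[of z "of_real u"] by simp
    qed
    then show ?thesis
      using A by (auto simp: in_segment unit_segment_iff scaleR_conv_of_real)
  qed
  then have "poly G -` open_segment B (A + B) = \<phi> -` poly F -` unit_segment" by auto
  then show ?thesis
    unfolding preimage_edges_unit preimage_edges_def[of G]
    using components_vimage_iff[OF cont inv] by simp
qed

lemma closure_iff: "z \<in> closure e \<longleftrightarrow> \<phi> z \<in> closure (\<phi> ` e)"
proof
  assume z: "z \<in> closure e"
  have "\<phi> ` closure e \<subseteq> closure (\<phi> ` e)"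
    by (rule image_closure_subset[OF cont(1)]) (simp_all add: closure_subset)
  then show "\<phi> z \<in> closure (\<phi> ` e)" using z by blast
next
  assume z: "\<phi> z \<in> closure (\<phi> ` e)"
  have "\<sigma> ` closure (\<phi> ` e) \<subseteq> closure e"
    by (rule image_closure_subset[OF cont(2)]) (simp_all add: img closure_subset)
  then have "\<sigma> (\<phi> z) \<in> closure e" using z by blast
  then show "z \<in> closure e" by (simp add: inv)
qed

context
  fixes c :: complex and e :: "complex set"
  assumes c: "c = 0 \<or> c = 1" and e: "e \<in> preimage_edges G B (A + B)"
begin

lemma edge_end_G: "\<phi> (edge_end G (A * c + B) e) = edge_end F c (\<phi> ` e)"
proof -
  have e': "\<phi> ` e \<in> preimage_edges F 0 1" using e edges_G by simp
  note v = end_facts(1,2)[OF F c e']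
  have "edge_end G (A * c + B) e = \<sigma> (edge_end F c (\<phi> ` e))"
    unfolding edge_end_def[of G]
  proof (rule the_equality)
    show "\<sigma> (edge_end F c (\<phi> ` e)) \<in> closure e \<and> poly G (\<sigma> (edge_end F c (\<phi> ` e))) = A * c + B"
      using v(1) by (simp add: closure_iff[of _ e] poly_G_eq inv)
    show "w = \<sigma> (edge_end F c (\<phi> ` e))" if "w \<in> closure e \<and> poly G w = A * c + B" for w
      using that v(2)[of "\<phi> w"] inv(1)[of w] by (simp add: closure_iff[of _ e] poly_G_eq)
  qed
  then show ?thesis by (simp add: inv)
qed

text \<open>The affine map has constant derivative a, so it turns every direction by
  \<open>sgn a\<close>. Since \<open>ccw_angle\<close> depends on the quotient of two directions, it
  is unaffected.\<close>

lemma direction_G: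
  assumes e': "e' \<in> preimage_edges G B (A + B)" and v: "edge_end G (A * c + B) e \<in> closure e'"
  shows "direction (edge_end F c (\<phi> ` e)) (\<phi> ` e') = sgn a * direction (edge_end G (A * c + B) e) e'"
proof -
  let ?w = "edge_end G (A * c + B) e"
  have ee: "\<phi> ` e \<in> preimage_edges F 0 1" "\<phi> ` e' \<in> preimage_edges F 0 1" using e e' edges_G by simp_all
  have w: "edge_end F c (\<phi> ` e) = \<phi> ?w" by (simp add: edge_end_G)
  let ?D = "direction (\<phi> ?w) (\<phi> ` e')"
  have "((\<lambda>z. sgn (z - \<phi> ?w)) \<longlongrightarrow> ?D) (at (\<phi> ?w) within \<phi> ` e')"
    using end_facts(3)[OF F c ee] v by (simp add: w closure_iff[of _ e'])
  moreover have "filterlim \<phi> (at (\<phi> ?w) within \<phi> ` e') (at ?w within e')"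
    unfolding filterlim_at
  proof
    show "eventually (\<lambda>z. \<phi> z \<in> \<phi> ` e' \<and> \<phi> z \<noteq> \<phi> ?w) (at ?w within e')"
      using inv(1) by (auto simp: eventually_at_filter intro!: always_eventually) metis
    show "(\<phi> \<longlongrightarrow> \<phi> ?w) (at ?w within e')"
      using cont(1)[of UNIV] by (simp add: continuous_on_def) (meson tendsto_within_subset subset_UNIV)
  qed
  ultimately have "((\<lambda>z. sgn (\<phi> z - \<phi> ?w)) \<longlongrightarrow> ?D) (at ?w within e')"
    by (rule filterlim_compose)
  moreover have "sgn (\<phi> z - \<phi> ?w) = sgn a * sgn (z - ?w)" for z
    by (simp add: \<phi>_def sgn_mult flip: right_diff_distrib)
  ultimately have "((\<lambda>z. inverse (sgn a) * (sgn a * sgn (z - ?w))) \<longlongrightarrow> inverse (sgn a) * ?D) (at ?w within e')"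
    by (simp add: tendsto_mult_left)
  moreover have sa: "sgn a \<noteq> 0" using a by (simp add: sgn_zero_iff)
  ultimately have lim: "((\<lambda>z. sgn (z - ?w)) \<longlongrightarrow> inverse (sgn a) * ?D) (at ?w within e')"
    by (simp flip: mult.assoc)
  have "?w \<notin> e'"
  proof
    assume "?w \<in> e'"
    then have "poly F (\<phi> ?w) \<in> unit_segment" using edge_subset[OF ee(2)] by blast
    moreover have "poly F (\<phi> ?w) = c" using end_facts(1)[OF F c ee(1)] by (simp add: w)
    ultimately show False using c by (auto simp: unit_segment_iff)
  qed
  then have "at ?w within e' \<noteq> bot" using v by (simp add: closure_def trivial_limit_within)
  then have "direction ?w e' = inverse (sgn a) * ?D"
    unfolding direction_def[of ?w] using lim by (rule tendsto_Lim)
  then show ?thesis using sa by (simp add: w)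
qed

text \<open>The two minimisation problems correspond under the affine map. Uniqueness of the
  minimiser, known on the side of F, makes the choices behind \<open>next_edge\<close> correspond
  too.\<close>

lemma next_edge_G:
  "\<phi> ` next_edge (preimage_edges G B (A + B)) (edge_end G (A * c + B) e) e =
     next_edge (preimage_edges F 0 1) (edge_end F c (\<phi> ` e)) (\<phi> ` e)"
proof -
  let ?w = "edge_end G (A * c + B) e" and ?EG = "preimage_edges G B (A + B)" and ?EF = "preimage_edges F 0 1"
  have e': "\<phi> ` e \<in> ?EF" using e edges_G by simp
  have w: "edge_end F c (\<phi> ` e) = \<phi> ?w" by (simp add: edge_end_G)
  have wcl: "?w \<in> closure e" using end_facts(1)[OF F c e'] by (simp add: w closure_iff[of _ e])
  define PG where "PG x \<longleftrightarrow> x \<in> ?EG \<and> ?w \<in> closure x" for x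
  define PF where "PF x \<longleftrightarrow> x \<in> ?EF \<and> \<phi> ?w \<in> closure x" for x
  define fG where "fG x = ccw_angle (direction ?w e) (direction ?w x)" for x
  define fF where "fF x = ccw_angle (direction (\<phi> ?w) (\<phi> ` e)) (direction (\<phi> ?w) x)" for x
  have P: "PG x \<longleftrightarrow> PF (\<phi> ` x)" for x by (simp add: PG_def PF_def edges_G closure_iff[of _ x])
  have sa: "sgn a \<noteq> 0" using a by (simp add: sgn_zero_iff)
  have f: "fG x = fF (\<phi> ` x)" if "PG x" for x
    using direction_G[OF e wcl] direction_G[of x] that sa
    by (simp add: fG_def fF_def PG_def w ccw_angle_def)
  have "is_arg_min fG PG x \<longleftrightarrow> is_arg_min fF PF (\<phi> ` x)" for x
  proof -
    have "(\<exists>y. PG y \<and> fG y < fG x) \<longleftrightarrow> (\<exists>y. PF y \<and> fF y < fF (\<phi> ` x))" if "PG x"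
    proof
      assume "\<exists>y. PF y \<and> fF y < fF (\<phi> ` x)"
      then obtain y where "PF y" "fF y < fF (\<phi> ` x)" by blast
      then have "PG (\<sigma> ` y)" "fG (\<sigma> ` y) < fG x" using P[of "\<sigma> ` y"] f[of "\<sigma> ` y"] f[OF that] by (simp_all add: img)
      then show "\<exists>y. PG y \<and> fG y < fG x" by blast
    qed (use P f that in auto)
    then show ?thesis unfolding is_arg_min_def using P by blast
  qed
  then have iff: "is_next_edge ?EG ?w e x \<longleftrightarrow> is_next_edge ?EF (\<phi> ?w) (\<phi> ` e) (\<phi> ` x)" for x
    unfolding is_next_edge_def fG_def[abs_def] fF_def[abs_def] PG_def[abs_def] PF_def[abs_def] .
  let ?N = "next_edge ?EF (\<phi> ?w) (\<phi> ` e)"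
  have N: "is_next_edge ?EF (\<phi> ?w) (\<phi> ` e) x \<longleftrightarrow> x = ?N" for x
    using end_facts(4)[OF F c e', of x] by (simp add: w)
  have "next_edge ?EG ?w e = \<sigma> ` ?N"
    unfolding next_edge_some[of ?EG]
  proof (rule some_equality)
    show "is_next_edge ?EG ?w e (\<sigma> ` ?N)" unfolding iff N img ..
    show "x = \<sigma> ` ?N" if "is_next_edge ?EG ?w e x" for x
      using that unfolding iff N by (metis img(2))
  qed
  then show ?thesis by (simp add: img w)
qed

end

lemma isomorphic: "isomorphic_maps (shabat_tree G B (A + B)) (shabat_tree F 0 1)"
  unfolding isomorphic_maps_def
proof (intro exI conjI ballI)
  have bij: "bij_betw \<phi> {z. poly G z = A * c + B} {z. poly F z = c}" for c
    by (rule bij_betw_byWitness[where f' = \<sigma>]) (auto simp: inv poly_G_eq)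
  show "bij_betw \<phi> (black_verts (shabat_tree G B (A + B))) (black_verts (shabat_tree F 0 1))"
    using bij[of 0] by (simp add: shabat_tree_simps)
  show "bij_betw \<phi> (white_verts (shabat_tree G B (A + B))) (white_verts (shabat_tree F 0 1))"
    using bij[of 1] by (simp add: shabat_tree_simps)
  show "bij_betw ((`) \<phi>) (edges (shabat_tree G B (A + B))) (edges (shabat_tree F 0 1))"
    by (rule bij_betw_byWitness[where f' = "(`) \<sigma>"]) (auto simp: img shabat_tree_simps edges_G)
next
  fix e assume "e \<in> edges (shabat_tree G B (A + B))"
  then have e: "e \<in> preimage_edges G B (A + B)" by (simp add: shabat_tree_simps)
  note 0 = edge_end_G[of 0, OF _ e] next_edge_G[of 0, OF _ e]
  note 1 = edge_end_G[of 1, OF _ e] next_edge_G[of 1, OF _ e]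
  show "black_end (shabat_tree F 0 1) (\<phi> ` e) = \<phi> (black_end (shabat_tree G B (A + B)) e)"
    "white_end (shabat_tree F 0 1) (\<phi> ` e) = \<phi> (white_end (shabat_tree G B (A + B)) e)"
    "black_next (shabat_tree F 0 1) (\<phi> ` e) = \<phi> ` black_next (shabat_tree G B (A + B)) e"
    "white_next (shabat_tree F 0 1) (\<phi> ` e) = \<phi> ` white_next (shabat_tree G B (A + B)) e"
    using 0 1 by (simp_all add: shabat_tree_simps)
qed

text \<open>Proved directly and not by \<open>isomorphic_maps_sym\<close>, which asks for bicolored
  maps on both sides; \<open>shabat_tree_map\<close> provides them for the critical values 0 and 1
  only.\<close>

lemma isomorphic': "isomorphic_maps (shabat_tree F 0 1) (shabat_tree G B (A + B))"
  unfolding isomorphic_maps_def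
proof (intro exI conjI ballI)
  have bij: "bij_betw \<sigma> {z. poly F z = c} {z. poly G z = A * c + B}" for c
    by (rule bij_betw_byWitness[where f' = \<phi>]) (auto simp: inv poly_G_eq)
  show "bij_betw \<sigma> (black_verts (shabat_tree F 0 1)) (black_verts (shabat_tree G B (A + B)))"
    using bij[of 0] by (simp add: shabat_tree_simps)
  show "bij_betw \<sigma> (white_verts (shabat_tree F 0 1)) (white_verts (shabat_tree G B (A + B)))"
    using bij[of 1] by (simp add: shabat_tree_simps)
  show "bij_betw ((`) \<sigma>) (edges (shabat_tree F 0 1)) (edges (shabat_tree G B (A + B)))"
    by (rule bij_betw_byWitness[where f' = "(`) \<phi>"]) (auto simp: img shabat_tree_simps edges_G)
next
  fix e assume "e \<in> edges (shabat_tree F 0 1)"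
  then have e: "\<sigma> ` e \<in> preimage_edges G B (A + B)" by (simp add: shabat_tree_simps edges_G img)
  note 0 = edge_end_G[of 0, OF _ e, THEN arg_cong[of _ _ \<sigma>]]
    next_edge_G[of 0, OF _ e, THEN arg_cong[of _ _ "(`) \<sigma>"]]
  note 1 = edge_end_G[of 1, OF _ e, THEN arg_cong[of _ _ \<sigma>]]
    next_edge_G[of 1, OF _ e, THEN arg_cong[of _ _ "(`) \<sigma>"]]
  show "black_end (shabat_tree G B (A + B)) (\<sigma> ` e) = \<sigma> (black_end (shabat_tree F 0 1) e)"
    "white_end (shabat_tree G B (A + B)) (\<sigma> ` e) = \<sigma> (white_end (shabat_tree F 0 1) e)"
    "black_next (shabat_tree G B (A + B)) (\<sigma> ` e) = \<sigma> ` black_next (shabat_tree F 0 1) e"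
    "white_next (shabat_tree G B (A + B)) (\<sigma> ` e) = \<sigma> ` white_next (shabat_tree F 0 1) e"
    using 0 1 by (simp_all add: shabat_tree_simps img inv)
qed

end

lemma shabat_equivalent_tree:
  assumes F: "shabat F 0 1" and eq: "shabat_equivalent F 0 1 G d1 d2"
  shows "shabat G d1 d2" "isomorphic_maps (shabat_tree G d1 d2) (shabat_tree F 0 1)"
    "isomorphic_maps (shabat_tree F 0 1) (shabat_tree G d1 d2)"
proof -
  obtain A B a b where ab: "A \<noteq> 0" "a \<noteq> 0" "G = smult A (F \<circ>\<^sub>p [:b, a:]) + [:B:]" "d1 = B" "d2 = A + B"
    using eq unfolding shabat_equivalent_def by auto
  then interpret affine_change F G A B a b by unfold_locales (use F in auto)
  show "shabat G d1 d2" "isomorphic_maps (shabat_tree G d1 d2) (shabat_tree F 0 1)"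
    "isomorphic_maps (shabat_tree F 0 1) (shabat_tree G d1 d2)"
    using shabat_G isomorphic isomorphic' ab by simp_all
qed

lemma shabat_equivalent_trans:
  assumes "shabat_equivalent F c1 c2 G d1 d2" "shabat_equivalent G d1 d2 H e1 e2"
  shows "shabat_equivalent F c1 c2 H e1 e2"
proof -
  obtain A B a b where 1: "A \<noteq> 0" "a \<noteq> 0" "G = smult A (F \<circ>\<^sub>p [:b, a:]) + [:B:]" "d1 = A * c1 + B" "d2 = A * c2 + B"
    using assms(1) unfolding shabat_equivalent_def by blast
  obtain A' B' a' b' where 2: "A' \<noteq> 0" "a' \<noteq> 0" "H = smult A' (G \<circ>\<^sub>p [:b', a':]) + [:B':]" "e1 = A' * d1 + B'" "e2 = A' * d2 + B'"
    using assms(2) unfolding shabat_equivalent_def by blast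
  have "poly H z = poly (smult (A' * A) (F \<circ>\<^sub>p [:b + a * b', a * a':]) + [:A' * B + B':]) z" for z
    by (simp add: 1 2 poly_pcompose algebra_simps)
  then have "H = smult (A' * A) (F \<circ>\<^sub>p [:b + a * b', a * a':]) + [:A' * B + B':]" by (simp add: poly_eq_poly_eq_iff[symmetric] fun_eq_iff)
  then show ?thesis
    unfolding shabat_equivalent_def using 1 2
    by (intro exI[of _ "A' * A"] exI[of _ "A' * B + B'"] exI[of _ "a * a'"] exI[of _ "b + a * b'"])
      (simp add: algebra_simps)
qed

lemma shabat_equivalent_sym:
  assumes "shabat_equivalent F c1 c2 G d1 d2"
  shows "shabat_equivalent G d1 d2 F c1 c2"
proof -
  obtain A B a b where 1: "A \<noteq> 0" "a \<noteq> 0" "G = smult A (F \<circ>\<^sub>p [:b, a:]) + [:B:]" "d1 = A * c1 + B" "d2 = A * c2 + B"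
    using assms(1) unfolding shabat_equivalent_def by blast
  have "poly F z = poly (smult (1 / A) (G \<circ>\<^sub>p [:- b / a, 1 / a:]) + [:- B / A:]) z" for z
    using 1(1,2) by (simp add: 1(3) poly_pcompose field_simps)
  then have "F = smult (1 / A) (G \<circ>\<^sub>p [:- b / a, 1 / a:]) + [:- B / A:]" by (simp add: poly_eq_poly_eq_iff[symmetric] fun_eq_iff)
  then show ?thesis
    unfolding shabat_equivalent_def using 1
    by (intro exI[of _ "1 / A"] exI[of _ "- B / A"] exI[of _ "1 / a"] exI[of _ "- b / a"])
      (simp add: field_simps)
qed

section \<open>The polynomials of the claim\<close>

lemma poly_eq_by_pderiv:
  fixes p q :: "complex poly"
  assumes "pderiv p = pderiv q" "poly p x = poly q x"
  shows "p = q"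
proof -
  have "pderiv (p - q) = 0" using assms(1) by (simp add: pderiv_diff)
  then have "degree (p - q) = 0" by (simp add: pderiv_eq_0_iff)
  then obtain c where c: "p - q = [:c:]" by (rule degree_eq_zeroE)
  have "poly (p - q) x = 0" using assms(2) by simp
  then have "c = 0" unfolding c by simp
  then show ?thesis using c by simp
qed

lemma poly_extI:
  fixes p q :: "complex poly"
  assumes "\<And>x. poly p x = poly q x"
  shows "p = q"
  using assms by (simp add: poly_eq_poly_eq_iff[symmetric] fun_eq_iff)

text \<open>With m = r - 1 this is the sum in the claim: the binomial expansion of (x^2 - 1)^m,
  integrated term by term from 0.\<close>

definition odd_primitive :: "nat \<Rightarrow> complex poly" where
  "odd_primitive m = (\<Sum>k = 0..m. monom ((- 1) ^ k * of_nat (m choose k) / of_nat (2 * m + 1 - 2 * k)) (2 * m + 1 - 2 * k))"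

lemma pderiv_odd_primitive: "pderiv (odd_primitive m) = [:- 1, 0, 1:] ^ m"
proof -
  have term_eq: "pderiv (monom ((- 1) ^ k * of_nat (m choose k) / of_nat (2 * m + 1 - 2 * k)) (2 * m + 1 - 2 * k)) =
      of_nat (m choose k) * [:- 1:] ^ k * (monom 1 2 :: complex poly) ^ (m - k)" if k: "k \<le> m" for k
  proof -
    have n: "2 * m + 1 - 2 * k \<noteq> 0" and n1: "2 * m + 1 - 2 * k - 1 = 2 * (m - k)" using k by auto
    have nz: "(of_nat (2 * m + 1 - 2 * k) :: complex) \<noteq> 0" using n unfolding of_nat_eq_0_iff .
    have rhs: "of_nat (m choose k) * [:- 1:] ^ k * (monom 1 2 :: complex poly) ^ (m - k) =
        monom ((- 1) ^ k * of_nat (m choose k)) (2 * (m - k))"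
    proof -
      have "[:- 1 :: complex:] ^ k = [:(- 1) ^ k:]" by (induction k) simp_all
      moreover have "(monom 1 2 :: complex poly) ^ (m - k) = monom 1 (2 * (m - k))"
        by (simp add: monom_power)
      ultimately show ?thesis by (simp add: of_nat_poly smult_monom)
    qed
    show ?thesis
      unfolding pderiv_monom n1 rhs times_divide_eq_right nonzero_mult_div_cancel_left[OF nz] ..
  qed
  have "pderiv (odd_primitive m) = (\<Sum>k\<le>m. of_nat (m choose k) * [:- 1:] ^ k * (monom 1 2) ^ (m - k))"
    unfolding odd_primitive_def higher_pderiv_sum[of "Suc 0", simplified] atLeast0AtMost by (intro sum.cong refl term_eq) simp
  also have "\<dots> = ([:- 1:] + monom 1 2) ^ m" by (rule binomial_ring[symmetric])
  also have "[:- 1:] + monom 1 2 = ([:- 1, 0, 1:] :: complex poly)"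
    by (simp add: monom_altdef numeral_2_eq_2)
  finally show ?thesis .
qed

lemma odd_primitive_0: "poly (odd_primitive m) 0 = 0"
  unfolding odd_primitive_def poly_sum poly_monom by (intro sum.neutral) auto

lemma odd_primitive_minus: "poly (odd_primitive m) (- x) = - poly (odd_primitive m) x"
proof -
  have "odd_primitive m \<circ>\<^sub>p [:0, - 1:] = - odd_primitive m"
  proof (rule poly_eq_by_pderiv[where x = 0])
    have "[:- 1, 0, 1:] ^ m \<circ>\<^sub>p [:0, - 1:] = ([:- 1, 0, 1:] :: complex poly) ^ m"
      by (rule poly_extI) (simp add: poly_pcompose poly_power)
    then show "pderiv (odd_primitive m \<circ>\<^sub>p [:0, - 1:]) = pderiv (- odd_primitive m)"
      by (simp add: pderiv_pcompose pderiv_odd_primitive pderiv_minus pderiv_pCons)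
  qed (simp add: poly_pcompose odd_primitive_0)
  then have "poly (odd_primitive m \<circ>\<^sub>p [:0, - 1:]) x = poly (- odd_primitive m) x" by simp
  then show ?thesis by (simp add: poly_pcompose)
qed

text \<open>Differentiating \<open>x (x^2 - 1)^(m + 1)\<close> gives the recursion of the Wallis integrals.\<close>

lemma odd_primitive_Suc:
  "of_nat (2 * m + 3) * poly (odd_primitive (Suc m)) 1 = - of_nat (2 * m + 2) * poly (odd_primitive m) 1"
proof -
  let ?q = "[:- 1, 0, 1:] :: complex poly"
  let ?L = "smult (of_nat (2 * m + 3)) (odd_primitive (Suc m)) + smult (of_nat (2 * m + 2)) (odd_primitive m)"
  have "?L = [:0, 1:] * ?q ^ Suc m"
  proof (rule poly_eq_by_pderiv[where x = 0])
    have 1: "pderiv (?q ^ Suc m) = smult (of_nat (2 * m + 2)) ([:0, 1:] * ?q ^ m)"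
      unfolding pderiv_power_Suc by (simp add: pderiv_pCons) 
    have "pderiv ([:0, 1:] * ?q ^ Suc m) = ?q ^ Suc m + smult (of_nat (2 * m + 2)) ([:0, 0, 1:] * ?q ^ m)"
      unfolding pderiv_mult 1 by (simp add: pderiv_pCons)
    also have "\<dots> = smult (of_nat (2 * m + 3)) (?q ^ Suc m) + smult (of_nat (2 * m + 2)) (?q ^ m)"
      by (rule poly_extI) (simp add: poly_power algebra_simps)
    finally show "pderiv ?L = pderiv ([:0, 1:] * ?q ^ Suc m)"
      by (simp only: pderiv_add pderiv_smult pderiv_odd_primitive)
  qed (simp add: odd_primitive_0)
  then have "poly ?L 1 = 0" by simp
  then have "of_nat (2 * m + 3) * poly (odd_primitive (Suc m)) 1 + of_nat (2 * m + 2) * poly (odd_primitive m) 1 = 0"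
    by (simp only: poly_add poly_smult)
  then show ?thesis unfolding mult_minus_left by (rule eq_neg_iff_add_eq_0[THEN iffD2])
qed

lemma double_fact_nonzero: "double_fact m \<noteq> 0"
  by (induction m rule: double_fact.induct) auto

text \<open>This value explains the constant \<open>K\<close>: multiplied by \<open>K\<close> it
  becomes 1/2, and by oddness the values of P at 1 and -1 then differ by 1.\<close>

lemma odd_primitive_1:
  "poly (odd_primitive m) 1 = (- 1) ^ m * of_nat (double_fact (2 * m)) / of_nat (double_fact (2 * m + 1))"
proof (induction m)
  case 0
  then show ?case by (simp add: odd_primitive_def poly_monom)
next
  case (Suc m)
  have nz: "(of_nat (2 * m + 3) :: complex) \<noteq> 0" "(of_nat (double_fact (2 * m + 1)) :: complex) \<noteq> 0"
    using double_fact_nonzero[of "2 * m + 1"] unfolding of_nat_eq_0_iff by simp_all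
  have d: "double_fact (2 * Suc m) = (2 * m + 2) * double_fact (2 * m)"
    "double_fact (2 * Suc m + 1) = (2 * m + 3) * double_fact (2 * m + 1)"
    by (simp_all add: numeral_2_eq_2 numeral_3_eq_3)
  have "poly (odd_primitive (Suc m)) 1 = - of_nat (2 * m + 2) * poly (odd_primitive m) 1 / of_nat (2 * m + 3)"
    using odd_primitive_Suc[of m] nz(1) nonzero_mult_div_cancel_left[OF nz(1), of "poly (odd_primitive (Suc m)) 1"]
    by (simp only:)
  note step = this
  have "- A * (e * X / Y) / B = - 1 * e * (A * X) / (B * Y)" for A e X Y B :: complex
    by (simp add: mult_ac)
  then show ?case unfolding step Suc.IH d of_nat_mult power_Suc .
qed


section \<open>Polynomials of the form 1 - h^4 with two hubs\<close>

lemma order_linear_power_mult: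
  fixes \<alpha> \<beta> \<kappa> :: complex
  assumes "\<alpha> \<noteq> \<beta>" "\<kappa> \<noteq> 0"
  shows "order v (smult \<kappa> ([:- \<alpha>, 1:] ^ k * [:- \<beta>, 1:] ^ k)) = (if v = \<alpha> \<or> v = \<beta> then k else 0)"
proof -
  have lin: "order v ([:- x, 1:] ^ k) = (if v = x then k else 0)" for x
    using order_power_n_n[of x k] by (auto intro!: order_0I)
  have "order v (smult \<kappa> ([:- \<alpha>, 1:] ^ k * [:- \<beta>, 1:] ^ k)) = order v ([:- \<alpha>, 1:] ^ k * [:- \<beta>, 1:] ^ k)"
    using assms(2) by (simp add: order_smult)
  also have "\<dots> = order v ([:- \<alpha>, 1:] ^ k) + order v ([:- \<beta>, 1:] ^ k)"
    by (rule order_mult) simp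
  finally show ?thesis using assms(1) by (auto simp: lin)
qed

text \<open>The critical points of 1 - h^4 are the zeros of h, with value 1, and the critical points
  of h; \<open>h_ab\<close> gives the latter the value 0 and so makes them the hubs.\<close>

locale quartic =
  fixes h :: "complex poly" and \<alpha> \<beta> \<kappa> :: complex and r :: nat
  assumes r: "r \<ge> 2" and ab: "\<alpha> \<noteq> \<beta>" and \<kappa>: "\<kappa> \<noteq> 0"
    and pderiv_h: "pderiv h = smult \<kappa> ([:- \<alpha>, 1:] ^ (r - 1) * [:- \<beta>, 1:] ^ (r - 1))"
    and h_ab: "poly h \<alpha> ^ 4 = 1" "poly h \<beta> ^ 4 = 1"
begin

definition F :: "complex poly" where "F = 1 - h ^ 4"

lemma poly_F: "poly F z = 1 - poly h z ^ 4"
  by (simp add: F_def poly_power)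

lemma pderiv_F: "pderiv F = - smult 4 (h ^ 3) * pderiv h"
  by (simp add: F_def pderiv_diff pderiv_power)

lemma poly_pderiv_h: "poly (pderiv h) z = \<kappa> * ((z - \<alpha>) * (z - \<beta>)) ^ (r - 1)"
  by (simp add: pderiv_h poly_power power_mult_distrib)

lemma pderiv_h_0: "poly (pderiv h) z = 0 \<longleftrightarrow> z = \<alpha> \<or> z = \<beta>"
  using r \<kappa> by (auto simp: pderiv_h poly_power)

lemma degree_h: "degree h = 2 * r - 1"
proof -
  have "degree (pderiv h) = (r - 1) + (r - 1)"
    using \<kappa> by (simp add: pderiv_h degree_mult_eq degree_power_eq)
  then show ?thesis using degree_pderiv[of h] r by simp
qed

lemma degree_F: "degree F = 8 * r - 4"
proof -
  have "degree (h ^ 4) = 4 * (2 * r - 1)"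
    using degree_h r by (subst degree_power_eq) auto
  moreover have "degree (- (h ^ 4) + 1) = degree (- (h ^ 4))"
    using calculation r by (intro degree_add_eq_left) simp
  ultimately show ?thesis by (simp add: F_def)
qed

lemma h_nonzero: "poly h \<alpha> \<noteq> 0" "poly h \<beta> \<noteq> 0"
  using h_ab by auto

lemma shabat: "shabat F 0 1"
  using degree_F r h_ab pderiv_h_0 by (auto simp: shabat_def pderiv_F poly_F poly_power)

lemma order_black:
  assumes "poly F v = 0"
  shows "order v F = (if v = \<alpha> \<or> v = \<beta> then r else 1)"
proof -
  have F0: "F \<noteq> 0" using degree_F r by auto
  have hv: "poly h v \<noteq> 0" using assms by (auto simp: poly_F)
  have "order v (pderiv F) = order v (- smult 4 (h ^ 3)) + order v (pderiv h)"
    unfolding pderiv_F by (rule order_mult) (use hv \<kappa> in \<open>auto simp: pderiv_h\<close>)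
  also have "order v (- smult 4 (h ^ 3)) = 0" using hv by (intro order_0I) (simp add: poly_power)
  also have "order v (pderiv h) = (if v = \<alpha> \<or> v = \<beta> then r - 1 else 0)"
    unfolding pderiv_h by (rule order_linear_power_mult[OF ab \<kappa>])
  finally show ?thesis using order_pderiv[OF F0 assms] r by auto
qed

text \<open>The zeros of h are simple, because h vanishes at neither of its critical points.\<close>

lemma order_white:
  assumes "poly F v = 1"
  shows "order v (1 - F) = 4"
proof -
  have hv: "poly h v = 0" using assms by (simp add: poly_F)
  then have "v \<noteq> \<alpha>" "v \<noteq> \<beta>" using h_nonzero by auto
  then have "order v h = 1" using pderiv_h_0 by (intro order_eq_1I hv) auto
  moreover have "h \<noteq> 0" using degree_h r by auto
  then have "order v (h ^ k) = k * order v h" for k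
    by (induction k) (simp_all add: order_mult)
  ultimately show ?thesis by (simp add: F_def)
qed

lemma card_white: "card {z. poly F z = 1} = 2 * r - 1"
proof -
  have "{z. poly F z = 1} = {z. poly h z = 0}" by (auto simp: poly_F)
  also have "card \<dots> = degree h"
    by (rule card_regular_fibre) (use degree_h r pderiv_h_0 h_nonzero in auto)
  finally show ?thesis by (simp add: degree_h)
qed

lemma black_multiset:
  "image_mset (\<lambda>v. order v F) (mset_set {v. poly F v = 0}) = replicate_mset 2 r + replicate_mset (6 * r - 4) 1"
proof -
  let ?B = "{v. poly F v = 0}" and ?R = "{v. poly F v = 0} - {\<alpha>, \<beta>}"
  have F0: "F \<noteq> 0" using degree_F r by auto
  have fin: "finite ?B" using poly_roots_finite[OF F0] .
  have B: "?B = insert \<alpha> (insert \<beta> ?R)" using h_ab by (auto simp: poly_F)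
  have ord: "order \<alpha> F = r" "order \<beta> F = r" "\<And>v. v \<in> ?R \<Longrightarrow> order v F = 1"
    using order_black h_ab by (simp_all add: poly_F)
  \<comment> \<open>The orders add up to the degree and the hubs take 2 r of it, which leaves 6 r -
    4 simple roots.\<close>
  have "8 * r - 4 = (\<Sum>v\<in>insert \<alpha> (insert \<beta> ?R). order v F)"
    using sum_order_complex[OF F0] B degree_F by simp
  also have "\<dots> = 2 * r + (\<Sum>v\<in>?R. order v F)"
    using fin ab by (subst sum.insert, simp_all add: ord(1,2))
  also have "(\<Sum>v\<in>?R. order v F) = card ?R" using ord(3) by simp
  finally have card: "card ?R = 6 * r - 4" by simp
  have "image_mset (\<lambda>v. order v F) (mset_set ?R) = image_mset (\<lambda>v. 1) (mset_set ?R)"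
    using fin ord(3) by (intro image_mset_cong) simp
  then have R: "image_mset (\<lambda>v. order v F) (mset_set ?R) = replicate_mset (6 * r - 4) 1"
    using card by (simp add: image_mset_const_eq)
  have "mset_set ?B = {#\<alpha>, \<beta>#} + mset_set ?R"
    by (subst B) (use fin ab in simp)
  then show ?thesis using R ord by (simp add: numeral_2_eq_2)
qed

end

section \<open>Types of the two trees\<close>

context quartic
begin

lemma hub_map: "hub_map (shabat_tree F 0 1) r"
proof
  show "bicolored_map (shabat_tree F 0 1)" by (rule shabat_tree_map[OF shabat])
  show "\<not> has_cycle (shabat_tree F 0 1)" by (rule shabat_tree_acyclic[OF shabat])
  show "r \<ge> 2" by (rule r)
  have F0: "F \<noteq> 0" using degree_F r by auto
  have finw: "finite {z. poly F z = 1}" using card_white r by (intro card_ge_0_finite) simp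
  have "image_mset (\<lambda>v. card (black_star (shabat_tree F 0 1) v)) (mset_set {z. poly F z = 0}) =
      image_mset (\<lambda>v. order v F) (mset_set {z. poly F z = 0})"
    using poly_roots_finite[OF F0] by (intro image_mset_cong) (simp add: card_black_star_shabat[OF shabat])
  moreover have "image_mset (\<lambda>v. card (white_star (shabat_tree F 0 1) v)) (mset_set {z. poly F z = 1}) =
      image_mset (\<lambda>v. 4) (mset_set {z. poly F z = 1})"
    using finw by (intro image_mset_cong) (simp add: card_white_star_shabat[OF shabat] order_white)
  ultimately show "passport (shabat_tree F 0 1) = hub_passport r"
    using black_multiset card_white shabat_finite_edges(2)[OF shabat] degree_F
    by (simp add: passport_def hub_passport_def shabat_tree_simps image_mset_const_eq)
qed

text \<open>Along an edge \<open>sgn h\<close> is a constant fourth root of unity. It is the value of \<open>h\<close> at the black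
  end, and up to the factor \<open>sgn (h' w)\<close> the direction of the edge at its white end \<open>w\<close>.\<close>

lemma edge_direction:
  assumes e: "e \<in> preimage_edges F 0 1"
  shows "direction (edge_end F 1 e) e = poly h (edge_end F 0 e) / sgn (poly (pderiv h) (edge_end F 1 e))"
proof -
  let ?b = "edge_end F 0 e" and ?w = "edge_end F 1 e"
  have b: "?b \<in> closure e" "poly F ?b = 0" using edge_end_root[OF shabat e] .
  have w: "?w \<in> closure e" "poly F ?w = 1" using end_facts(1)[OF shabat _ e, of 1] by auto
  have hw: "poly h ?w = 0" using w(2) by (simp add: poly_F)
  have con: "connected e" and ne: "e \<noteq> {}"
    using e in_components_connected in_components_nonempty unfolding preimage_edges_unit by blast+
  have h0: "poly h z \<noteq> 0" and root: "sgn (poly h z) ^ 4 = 1" if "z \<in> e" for z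
  proof -
    have "poly F z \<in> unit_segment" using edge_subset[OF e] that by blast
    then obtain t where t: "0 < t" "t < 1" "1 - poly h z ^ 4 = of_real t"
      unfolding unit_segment_iff poly_F by blast
    have h4: "poly h z ^ 4 = of_real (1 - t)" using t(3) by (simp add: algebra_simps)
    then show "poly h z \<noteq> 0" using t by auto
    have "sgn (poly h z) ^ 4 = sgn (poly h z ^ 4)" by (simp add: eval_nat_numeral sgn_mult)
    also have "\<dots> = 1" using t by (simp only: h4 sgn_of_real) simp
    finally show "sgn (poly h z) ^ 4 = 1" .
  qed
  have "continuous_on e (\<lambda>z. sgn (poly h z))"
    using h0 by (intro continuous_intros) auto
  then have "connected ((\<lambda>z. sgn (poly h z)) ` e)" using con by (rule connected_continuous_image)
  moreover have "(\<lambda>z. sgn (poly h z)) ` e \<subseteq> {z. z ^ 4 = 1}" using root by auto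
  then have "finite ((\<lambda>z. sgn (poly h z)) ` e)" by (rule finite_subset) (simp add: finite_roots_unity)
  \<comment> \<open>A nonempty connected set of fourth roots of unity is a single point.\<close>
  ultimately obtain \<epsilon> where "(\<lambda>z. sgn (poly h z)) ` e = {\<epsilon>}"
    using connected_finite_iff_sing ne by blast
  then have \<epsilon>: "sgn (poly h z) = \<epsilon>" if "z \<in> e" for z using that by blast
  \<comment> \<open>In this form the constancy of the sign is a closed condition, so it passes to
    the black end, where h has modulus 1.\<close>
  have "e \<subseteq> {z. poly h z = \<epsilon> * of_real (norm (poly h z))}"
    using \<epsilon> h0 by (auto simp: sgn_div_norm scaleR_conv_of_real field_simps)
  moreover have "closed {z. poly h z = \<epsilon> * of_real (norm (poly h z))}"
    by (intro closed_Collect_eq continuous_intros)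
  ultimately have "closure e \<subseteq> {z. poly h z = \<epsilon> * of_real (norm (poly h z))}" by (rule closure_minimal)
  then have "poly h ?b = \<epsilon> * of_real (norm (poly h ?b))" using b(1) by blast
  moreover have "norm (poly h ?b) = 1"
  proof -
    have "norm (poly h ?b) ^ 4 = 1 ^ 4" using b(2) by (simp add: poly_F flip: norm_power)
    then show ?thesis by (rule power_eq_imp_eq_base) simp_all
  qed
  ultimately have hb: "poly h ?b = \<epsilon>" by simp
  have h'w: "poly (pderiv h) ?w \<noteq> 0" using pderiv_h_0 h_nonzero hw by auto
  have we: "?w \<notin> e" using h0 hw by auto
  have "((\<lambda>z. (poly h z - poly h ?w) / (z - ?w)) \<longlongrightarrow> poly (pderiv h) ?w) (at ?w within e)"
    using poly_DERIV[of h ?w] unfolding has_field_derivative_iff by (rule tendsto_within_subset) simp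
  then have "((\<lambda>z. sgn (poly h z / (z - ?w))) \<longlongrightarrow> sgn (poly (pderiv h) ?w)) (at ?w within e)"
    using h'w unfolding hw diff_zero by (rule tendsto_sgn)
  moreover have "eventually (\<lambda>z. sgn (poly h z / (z - ?w)) = \<epsilon> / sgn (z - ?w)) (at ?w within e)"
    using \<epsilon> by (auto simp: eventually_at_filter sgn_divide)
  ultimately have "((\<lambda>z. \<epsilon> / sgn (z - ?w)) \<longlongrightarrow> sgn (poly (pderiv h) ?w)) (at ?w within e)"
    by (rule Lim_transform_eventually)
  moreover have "sgn (poly (pderiv h) ?w) \<noteq> 0" using h'w by (simp add: sgn_zero_iff)
  ultimately have "((\<lambda>z. \<epsilon> / (\<epsilon> / sgn (z - ?w))) \<longlongrightarrow> \<epsilon> / sgn (poly (pderiv h) ?w)) (at ?w within e)"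
    by (intro tendsto_divide tendsto_const)
  moreover have "\<epsilon> \<noteq> 0" using hb b(2) by (auto simp: poly_F)
  ultimately have "((\<lambda>z. sgn (z - ?w)) \<longlongrightarrow> \<epsilon> / sgn (poly (pderiv h) ?w)) (at ?w within e)"
    by simp
  moreover have "at ?w within e \<noteq> bot" using w(1) we by (simp add: closure_def trivial_limit_within)
  ultimately show ?thesis unfolding direction_def hb by (intro tendsto_Lim)
qed

text \<open>At a vertex of degree 4 a turn multiplies the direction by \<open>\<i>\<close>; the
  factor \<open>sgn (h' w)\<close> of \<open>edge_direction\<close> is the same for both edges and
  cancels.\<close>

lemma white_next_value:
  assumes e: "e \<in> edges (shabat_tree F 0 1)"
  shows "poly h (black_end (shabat_tree F 0 1) (white_next (shabat_tree F 0 1) e)) =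
    \<i> * poly h (black_end (shabat_tree F 0 1) e)"
proof -
  let ?T = "shabat_tree F 0 1" and ?w = "edge_end F 1 e"
  let ?f = "white_next ?T e"
  have e': "e \<in> preimage_edges F 0 1" using e by (simp add: shabat_tree_simps)
  have f: "?f \<in> preimage_edges F 0 1" "edge_end F 1 ?f = ?w"
    using white_nextD(2,3)[OF shabat_tree_map[OF shabat] e] by (simp_all add: shabat_tree_simps)
  have w: "poly F ?w = 1" using end_facts(1)[OF shabat _ e', of 1] by auto
  have w': "poly (1 - F) ?w = 0" using w by simp
  have "direction ?w ?f = direction ?w e * cis (2 * pi / 4)"
    using root_star_cyclic(3)[OF shabat_reflect[OF shabat] w', of e] e'
    by (simp add: preimage_edges_reflect edge_end_reflect order_white[OF w] shabat_tree_simps)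
  also have "cis (2 * pi / 4) = \<i>" by (simp add: complex_eq_iff)
  finally have "poly h (edge_end F 0 ?f) / sgn (poly (pderiv h) ?w) =
     poly h (edge_end F 0 e) / sgn (poly (pderiv h) ?w) * \<i>"
    using edge_direction[OF f(1)] edge_direction[OF e'] unfolding f(2) by simp
  moreover have "poly h ?w = 0" using w by (simp add: poly_F)
  then have "sgn (poly (pderiv h) ?w) \<noteq> 0" using pderiv_h_0 h_nonzero by (auto simp: sgn_zero_iff)
  ultimately show ?thesis by (simp add: shabat_tree_simps field_simps)
qed

text \<open>The disjunction is there because the d turns may start at either hub.\<close>

lemma hub_type_value:
  assumes "hub_type (shabat_tree F 0 1) r d"
  shows "poly h \<beta> = \<i> ^ d * poly h \<alpha> \<or> poly h \<alpha> = \<i> ^ d * poly h \<beta>"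
proof -
  let ?T = "shabat_tree F 0 1"
  obtain e where e: "e \<in> edges ?T"
     "black_end ?T e \<noteq> black_end ?T ((white_next ?T ^^ d) e)"
     "card (black_star ?T (black_end ?T e)) = r"
     "card (black_star ?T (black_end ?T ((white_next ?T ^^ d) e))) = r"
    using assms unfolding hub_type_def by blast
  note map = shabat_tree_map[OF shabat]
  have pow: "(white_next ?T ^^ k) e \<in> edges ?T" for k
    using funpow_white_next[OF map e(1)] by blast
  have val: "poly h (black_end ?T ((white_next ?T ^^ k) e)) = \<i> ^ k * poly h (black_end ?T e)" for k
    by (induction k) (simp_all add: white_next_value[OF pow])
  have hub: "v = \<alpha> \<or> v = \<beta>" if "v \<in> black_verts ?T" "card (black_star ?T v) = r" for v
    using that order_black[of v] r by (auto simp: shabat_tree_simps card_black_star_shabat[OF shabat] split: if_splits)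
  have "black_end ?T e = \<alpha> \<or> black_end ?T e = \<beta>"
    using hub[OF black_nextD(1)[OF map e(1)] e(3)] .
  moreover have "black_end ?T ((white_next ?T ^^ d) e) = \<alpha> \<or> black_end ?T ((white_next ?T ^^ d) e) = \<beta>"
    using hub[OF black_nextD(1)[OF map pow] e(4)] .
  ultimately show ?thesis using e(2) val[of d] by auto
qed

end

section \<open>Polynomials with the given passport\<close>

text \<open>All roots of 1 - G have order 4, so it is a fourth power of some h. The derivative of h
  has degree 2 r - 2, which is exhausted by its zeros of order r - 1 at the two hubs.\<close>

lemma quartic_of_hub_passport:
  assumes G: "shabat G 0 1" and pass: "passport (shabat_tree G 0 1) = hub_passport r" and r: "r \<ge> 2"
  obtains h \<alpha> \<beta> \<kappa> where "quartic h \<alpha> \<beta> \<kappa> r" "G = 1 - h ^ 4"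
proof -
  interpret hub_map "shabat_tree G 0 1" r
    by unfold_locales (use shabat_tree_map[OF G] shabat_tree_acyclic[OF G] pass r in auto)
  obtain \<alpha> \<beta> where ab: "hubs = {\<alpha>, \<beta>}" "\<alpha> \<noteq> \<beta>" using card_hubs by (auto simp: card_2_iff)
  have hub: "poly G v = 0 \<and> order v G = r" if "v \<in> {\<alpha>, \<beta>}" for v
    using that unfolding ab(1)[symmetric] hubs_def
    by (auto simp: shabat_tree_simps card_black_star_shabat[OF G])
  have white: "order v (1 - G) = 4" if "poly G v = 1" for v
    using white_degree[of v] that by (simp add: shabat_tree_simps card_white_star_shabat[OF G])
  let ?Q = "1 - G"
  let ?R = "{z. poly ?Q z = 0}"
  have Q0: "?Q \<noteq> 0" using shabat_reflect[OF G] by (auto simp: shabat_def)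
  define p where "p = (\<Prod>z\<in>?R. [:- z, 1:])"
  define c where "c = lead_coeff ?Q"
  have c: "c \<noteq> 0" unfolding c_def using Q0 by (rule leading_coeff_neq_0)
  define \<mu> where "\<mu> = exp (Ln c / 4)"
  define h where "h = smult \<mu> p"
  have "\<mu> ^ 4 = exp (of_nat 4 * (Ln c / 4))"
    unfolding \<mu>_def exp_of_nat_mult ..
  then have \<mu>: "\<mu> ^ 4 = c" using c by simp
  have "?Q = smult c (\<Prod>z\<in>?R. [:- z, 1:] ^ order z ?Q)"
    unfolding c_def by (rule complex_poly_decompose[symmetric])
  also have "(\<Prod>z\<in>?R. [:- z, 1:] ^ order z ?Q) = (\<Prod>z\<in>?R. [:- z, 1:] ^ 4)"
    by (intro prod.cong refl) (use white in simp)
  also have "\<dots> = p ^ 4" by (simp add: p_def prod_power_distrib)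
  finally have Qh: "?Q = h ^ 4" by (simp add: h_def smult_power \<mu>)
  then have Gh: "G = 1 - h ^ 4" by (simp add: algebra_simps)
  have hab: "poly h v ^ 4 = 1" if "v \<in> {\<alpha>, \<beta>}" for v
    using hub[OF that] by (simp add: Gh poly_power)
  have "\<mu> \<noteq> 0" by (simp add: \<mu>_def)
  then have "degree h = card ?R" by (simp add: h_def p_def degree_prod_sum_eq)
  also have "?R = {z. poly G z = 1}" by auto
  also have "card \<dots> = 2 * r - 1" using card_white by (simp add: shabat_tree_simps)
  finally have degh: "degree h = 2 * r - 1" .
  have degh': "degree (pderiv h) = (r - 1) + (r - 1)" using degree_pderiv[of h] degh r by simp
  have h'0: "pderiv h \<noteq> 0" using degh' r by auto
  have G0: "G \<noteq> 0" using G by (auto simp: shabat_def)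
  have pG: "pderiv G = - smult 4 (h ^ 3) * pderiv h"
    by (simp add: Gh pderiv_diff pderiv_power)
  have ord: "order v (pderiv h) = r - 1" if v: "v \<in> {\<alpha>, \<beta>}" for v
  proof -
    have hv: "poly h v \<noteq> 0" using hab[OF v] by auto
    then have "h \<noteq> 0" by auto
    then have "order v (pderiv G) = order v (- smult 4 (h ^ 3)) + order v (pderiv h)"
      unfolding pG using h'0 by (intro order_mult) auto
    moreover have "order v (- smult 4 (h ^ 3)) = 0" using hv by (intro order_0I) (simp add: poly_power)
    moreover have "order v G = Suc (order v (pderiv G))" using order_pderiv[OF G0] hub[OF v] by blast
    ultimately show ?thesis using hub[OF v] by simp
  qed
  obtain q where q: "pderiv h = [:- \<alpha>, 1:] ^ (r - 1) * q"
    using order_1[of \<alpha> "pderiv h"] ord[of \<alpha>] by (auto elim: dvdE)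
  have q0: "q \<noteq> 0" using q h'0 by auto
  have "order \<beta> (pderiv h) = order \<beta> ([:- \<alpha>, 1:] ^ (r - 1)) + order \<beta> q"
    unfolding q by (rule order_mult) (use q0 in simp)
  moreover have "order \<beta> ([:- \<alpha>, 1:] ^ (r - 1)) = 0" using ab(2) by (intro order_0I) (simp add: poly_power)
  ultimately have "order \<beta> q = r - 1" using ord[of \<beta>] by simp
  then obtain q2 where q2: "q = [:- \<beta>, 1:] ^ (r - 1) * q2"
    using order_1[of \<beta> q] by (auto elim: dvdE)
  have q20: "q2 \<noteq> 0" using q2 q0 by auto
  have "degree (pderiv h) = (r - 1) + ((r - 1) + degree q2)"
    using q20 by (simp add: q q2 degree_mult_eq degree_power_eq)
  then have "degree q2 = 0" using degh' by simp
  then obtain \<kappa> where \<kappa>: "q2 = [:\<kappa>:]" by (rule degree_eq_zeroE)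
  have "quartic h \<alpha> \<beta> \<kappa> r"
  proof
    show "pderiv h = smult \<kappa> ([:- \<alpha>, 1:] ^ (r - 1) * [:- \<beta>, 1:] ^ (r - 1))"
      by (simp add: q q2 \<kappa>)
  qed (use r ab hab q20 \<kappa> in auto)
  then show ?thesis using that Gh by blast
qed

section \<open>The normalised primitive and the polynomials built from it\<close>

locale normalized_primitive =
  fixes P :: "complex poly" and K :: complex and r :: nat
  assumes r: "r \<ge> 2" and K: "K \<noteq> 0" and pderiv_P: "pderiv P = smult K ([:- 1, 0, 1:] ^ (r - 1))"
    and P_1: "poly P 1 = 0" and P_minus: "\<And>x. poly P (- x) = - poly P x - 1"
begin

lemma P_m1: "poly P (- 1) = - 1"
  using P_minus[of 1] P_1 by simp

lemma poly_pderiv_P: "poly (pderiv P) x = K * (x ^ 2 - 1) ^ (r - 1)"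
  by (simp add: pderiv_P poly_power power2_eq_square algebra_simps)

text \<open>The inner polynomial takes the value 1 at 1 and \<rho> at -1, so \<rho> is the ratio of
  the hub values.\<close>

definition fam :: "complex \<Rightarrow> complex poly" where
  "fam \<rho> = 1 - (smult (1 - \<rho>) P + 1) ^ 4"

lemma poly_fam: "poly (fam \<rho>) x = 1 - ((1 - \<rho>) * poly P x + 1) ^ 4"
  by (simp add: fam_def poly_power)

text \<open>Move \<open>\<alpha>\<close>, \<open>\<beta>\<close> to \<open>1\<close>, \<open>-1\<close>. Then \<open>h\<close> is an affine function of \<open>P\<close>, determined up to a fourth
  root of unity by the ratio \<open>\<rho>\<close> of its values at \<open>-1\<close> and \<open>1\<close>.\<close>

lemma quartic_equivalent:
  assumes "quartic h \<alpha> \<beta> \<kappa> r"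
  shows "\<exists>\<rho>\<in>{- 1, \<i>, - \<i>}. shabat_equivalent (1 - h ^ 4) 0 1 (fam \<rho>) 0 1"
proof -
  interpret quartic h \<alpha> \<beta> \<kappa> r by fact
  define a b where "a = (\<alpha> - \<beta>) / 2" and "b = (\<alpha> + \<beta>) / 2"
  have a: "a \<noteq> 0" using ab by (simp add: a_def)
  have sub: "b + a = \<alpha>" "b - a = \<beta>" by (simp_all add: a_def b_def field_simps)
  let ?h = "h \<circ>\<^sub>p [:b, a:]"
  \<comment> \<open>The derivative of h (a x + b) is \<kappa> a^(2 r - 1) (x^2 - 1)^(r - 1), one
    factor a coming from the chain rule.\<close>
  define A where "A = \<kappa> * a ^ (2 * r - 1) / K"
  have A: "A \<noteq> 0" using \<kappa> a K by (simp add: A_def)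
  have h': "pderiv ?h = smult A (pderiv P)"
  proof (rule poly_extI)
    fix x
    have "(b + a * x - \<alpha>) * (b + a * x - \<beta>) = a ^ 2 * (x ^ 2 - 1)"
      unfolding sub[symmetric] by (simp add: power2_eq_square algebra_simps)
    then have "((b + a * x - \<alpha>) * (b + a * x - \<beta>)) ^ (r - 1) = a ^ (2 * (r - 1)) * (x ^ 2 - 1) ^ (r - 1)"
      by (simp add: power_mult_distrib power_mult)
    then have "poly (pderiv h) (b + a * x) * a = \<kappa> * (a ^ (2 * (r - 1)) * (x ^ 2 - 1) ^ (r - 1)) * a"
      unfolding poly_pderiv_h by (simp only:)
    also have "\<dots> = \<kappa> * a ^ Suc (2 * (r - 1)) * (x ^ 2 - 1) ^ (r - 1)" by simp
    also have "Suc (2 * (r - 1)) = 2 * r - 1" using r by simp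
    finally show "poly (pderiv ?h) x = poly (smult A (pderiv P)) x"
      using K by (simp add: pderiv_pcompose pderiv_pCons poly_pcompose poly_pderiv_P A_def mult_ac)
  qed
  have hP: "?h = smult A P + [:poly h \<alpha>:]"
  proof (rule poly_eq_by_pderiv[where x = 1])
    show "pderiv ?h = pderiv (smult A P + [:poly h \<alpha>:])"
      unfolding h' by (simp add: pderiv_add pderiv_smult pderiv_pCons)
    show "poly ?h 1 = poly (smult A P + [:poly h \<alpha>:]) 1" using sub by (simp add: poly_pcompose P_1)
  qed
  define B where "B = poly h \<alpha>"
  have "poly ?h (- 1) = poly (smult A P + [:poly h \<alpha>:]) (- 1)" unfolding hP ..
  then have hb: "poly h \<beta> = B - A" using sub by (simp add: poly_pcompose P_m1 B_def)
  have B: "B ^ 4 = 1" "(B - A) ^ 4 = 1" "B \<noteq> 0"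
    using h_ab h_nonzero unfolding hb by (simp_all add: B_def)
  define \<rho> where "\<rho> = (B - A) / B"
  have "\<rho> ^ 4 = 1" using B by (simp add: \<rho>_def power_divide)
  moreover have "\<rho> ^ 4 - 1 = (\<rho> - 1) * (\<rho> + 1) * (\<rho> - \<i>) * (\<rho> + \<i>)"
    by (simp add: eval_nat_numeral algebra_simps)
  ultimately have "\<rho> \<in> {1, - 1, \<i>, - \<i>}" by (auto simp: eq_neg_iff_add_eq_0)
  moreover have "\<rho> \<noteq> 1" using A B by (simp add: \<rho>_def field_simps)
  ultimately have \<rho>: "\<rho> \<in> {- 1, \<i>, - \<i>}" by simp
  have "(1 - h ^ 4) \<circ>\<^sub>p [:b, a:] = fam \<rho>"
  proof (rule poly_extI)
    fix x
    have "poly ?h x = A * poly P x + B" unfolding hP by (simp add: B_def)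
    also have "\<dots> = B * ((1 - \<rho>) * poly P x + 1)" using B by (simp add: \<rho>_def field_simps)
    finally have "poly h (b + a * x) = B * ((1 - \<rho>) * poly P x + 1)" by (simp add: poly_pcompose algebra_simps)
    then have "poly h (b + a * x) ^ 4 = ((1 - \<rho>) * poly P x + 1) ^ 4"
      using B(1) by (simp add: power_mult_distrib)
    then show "poly ((1 - h ^ 4) \<circ>\<^sub>p [:b, a:]) x = poly (fam \<rho>) x"
      by (simp add: poly_fam poly_pcompose poly_power algebra_simps)
  qed
  then have "shabat_equivalent (1 - h ^ 4) 0 1 (fam \<rho>) 0 1"
    unfolding shabat_equivalent_def using a
    by (intro exI[of _ 1] exI[of _ 0] exI[of _ a] exI[of _ b]) simp
  then show ?thesis using \<rho> by blast
qed

text \<open>This reaches the argument \<i> x that the claim prescribes for the second tree.\<close>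

lemma fam_rotate: "shabat_equivalent (fam \<i>) 0 1 (fam \<i> \<circ>\<^sub>p [:0, \<i>:]) 0 1"
  unfolding shabat_equivalent_def
  by (intro exI[of _ 1] exI[of _ 0] exI[of _ \<i>] exI[of _ 0]) simp

text \<open>Replacing x by -x exchanges the two hubs and so inverts the ratio; by the symmetry of P
  the inner polynomials then differ by a fourth root of unity only.\<close>

lemma fam_conjugate: "shabat_equivalent (fam (- \<i>)) 0 1 (fam \<i>) 0 1"
proof -
  have "fam \<i> = fam (- \<i>) \<circ>\<^sub>p [:0, - 1:]"
  proof (rule poly_extI)
    fix x
    have "(1 + \<i>) * (- poly P x - 1) + 1 = - \<i> * ((1 - \<i>) * poly P x + 1)"
      by (simp add: algebra_simps)
    moreover have "(- \<i> * y) ^ 4 = y ^ 4" for y by (simp add: power_mult_distrib)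
    ultimately have "((1 + \<i>) * (- poly P x - 1) + 1) ^ 4 = ((1 - \<i>) * poly P x + 1) ^ 4" by (simp only:)
    then show "poly (fam \<i>) x = poly (fam (- \<i>) \<circ>\<^sub>p [:0, - 1:]) x"
      by (simp add: poly_fam poly_pcompose P_minus)
  qed
  then show ?thesis
    unfolding shabat_equivalent_def
    by (intro exI[of _ 1] exI[of _ 0] exI[of _ "- 1"] exI[of _ 0]) simp
qed

text \<open>The ratios \<i> and - \<i> fall into one class, which leaves two classes for the three
  ratios.\<close>

lemma hub_passport_cases:
  assumes G: "shabat G 0 1" and pass: "passport (shabat_tree G 0 1) = hub_passport r"
  shows "shabat_equivalent (fam (- 1)) 0 1 G 0 1 \<or> shabat_equivalent (fam \<i> \<circ>\<^sub>p [:0, \<i>:]) 0 1 G 0 1"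
proof -
  obtain h \<alpha> \<beta> \<kappa> where h: "quartic h \<alpha> \<beta> \<kappa> r" "G = 1 - h ^ 4"
    using quartic_of_hub_passport[OF G pass r] by blast
  then obtain \<rho> where \<rho>: "\<rho> \<in> {- 1, \<i>, - \<i>}" "shabat_equivalent G 0 1 (fam \<rho>) 0 1"
    using quartic_equivalent by blast
  consider "\<rho> = - 1" | "\<rho> = \<i>" | "\<rho> = - \<i>" using \<rho>(1) by blast
  then consider "shabat_equivalent G 0 1 (fam (- 1)) 0 1" | "shabat_equivalent G 0 1 (fam \<i>) 0 1"
  proof cases
    case 1
    show ?thesis using \<rho>(2) unfolding 1 by (rule that(1))
  next
    case 2
    show ?thesis using \<rho>(2) unfolding 2 by (rule that(2))
  next
    case 3
    then have "shabat_equivalent G 0 1 (fam (- \<i>)) 0 1" using \<rho>(2) by (simp only:)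
    from shabat_equivalent_trans[OF this fam_conjugate] show ?thesis by (rule that(2))
  qed
  then show ?thesis
  proof cases
    case 1
    show ?thesis by (rule disjI1, rule shabat_equivalent_sym[OF 1])
  next
    case 2
    show ?thesis by (rule disjI2, rule shabat_equivalent_sym[OF shabat_equivalent_trans[OF 2 fam_rotate]])
  qed
qed

lemma quartic_fam1: "quartic (smult 2 P + 1) 1 (- 1) (2 * K) r"
proof
  show "pderiv (smult 2 P + 1) = smult (2 * K) ([:- 1, 1:] ^ (r - 1) * [:- (- 1), 1:] ^ (r - 1))"
    by (rule poly_extI)
      (simp add: pderiv_add pderiv_smult poly_pderiv_P poly_power power2_eq_square algebra_simps
        flip: power_mult_distrib)
qed (use r K P_1 P_m1 in simp_all)

text \<open>The argument \<i> x moves the hubs to \<i> and - \<i>, where h has the values \<i> and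
  1.\<close>

lemma quartic_fam2:
  "quartic (smult (1 - \<i>) (P \<circ>\<^sub>p [:0, \<i>:]) + 1) \<i> (- \<i>) ((1 - \<i>) * \<i> * K * (- 1) ^ (r - 1)) r"
proof
  show "pderiv (smult (1 - \<i>) (P \<circ>\<^sub>p [:0, \<i>:]) + 1) =
      smult ((1 - \<i>) * \<i> * K * (- 1) ^ (r - 1)) ([:- \<i>, 1:] ^ (r - 1) * [:- (- \<i>), 1:] ^ (r - 1))"
  proof (rule poly_extI)
    fix x
    have "(\<i> * x) ^ 2 - 1 = - 1 * ((x - \<i>) * (x + \<i>))" by (simp add: power2_eq_square algebra_simps)
    then have *: "((\<i> * x) ^ 2 - 1) ^ (r - 1) = (- 1) ^ (r - 1) * ((x - \<i>) ^ (r - 1) * (x + \<i>) ^ (r - 1))"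
      by (simp only: power_mult_distrib)
    have "poly (pderiv (smult (1 - \<i>) (P \<circ>\<^sub>p [:0, \<i>:]) + 1)) x = (1 - \<i>) * (K * ((\<i> * x) ^ 2 - 1) ^ (r - 1) * \<i>)"
      by (simp add: pderiv_add pderiv_smult pderiv_pcompose pderiv_pCons poly_pcompose poly_pderiv_P mult.commute[of x])
    then show "poly (pderiv (smult (1 - \<i>) (P \<circ>\<^sub>p [:0, \<i>:]) + 1)) x =
      poly (smult ((1 - \<i>) * \<i> * K * (- 1) ^ (r - 1)) ([:- \<i>, 1:] ^ (r - 1) * [:- (- \<i>), 1:] ^ (r - 1))) x"
      unfolding * by (simp add: poly_power add.commute[of x] mult_ac)
  qed
  have "1 - \<i> \<noteq> 0" by (simp add: complex_eq_iff)
  then show "(1 - \<i>) * \<i> * K * (- 1) ^ (r - 1) \<noteq> 0" using K by simp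
  show "\<i> \<noteq> - \<i>" by (simp add: complex_eq_iff)
  show "poly (smult (1 - \<i>) (P \<circ>\<^sub>p [:0, \<i>:]) + 1) \<i> ^ 4 = 1"
    "poly (smult (1 - \<i>) (P \<circ>\<^sub>p [:0, \<i>:]) + 1) (- \<i>) ^ 4 = 1"
    by (simp_all add: poly_pcompose P_m1 P_1)
qed (rule r)

end

text \<open>Scaling the critical values to 0 and 1 preserves the tree up to isomorphism, hence its
  passport. Then \<open>char\<close> leaves F and F', and F' would have a tree isomorphic to that of
  F.\<close>

lemma shabat_polynomial_of_iff:
  assumes F: "shabat F 0 1" and pass: "passport (shabat_tree F 0 1) = \<pi>"
    and char: "\<And>G. \<lbrakk>shabat G 0 1; passport (shabat_tree G 0 1) = \<pi>\<rbrakk> \<Longrightarrow>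
      shabat_equivalent F 0 1 G 0 1 \<or> shabat_equivalent F' 0 1 G 0 1"
    and F': "shabat F' 0 1" and ni: "\<not> isomorphic_maps (shabat_tree F 0 1) (shabat_tree F' 0 1)"
  shows "shabat_polynomial_of (shabat_tree F 0 1) G c1 c2 \<longleftrightarrow> shabat_equivalent F 0 1 G c1 c2"
proof
  assume "shabat_equivalent F 0 1 G c1 c2"
  then show "shabat_polynomial_of (shabat_tree F 0 1) G c1 c2"
    using shabat_equivalent_tree[OF F] by (simp add: shabat_polynomial_of_def)
next
  assume "shabat_polynomial_of (shabat_tree F 0 1) G c1 c2"
  then have G: "shabat G c1 c2" and iso: "isomorphic_maps (shabat_tree G c1 c2) (shabat_tree F 0 1)"
    by (simp_all add: shabat_polynomial_of_def)
  have c: "c1 \<noteq> c2" using G by (simp add: shabat_def)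
  define N where "N = smult (1 / (c2 - c1)) (G \<circ>\<^sub>p [:0, 1:]) + [:- c1 / (c2 - c1):]"
  have polyN: "poly N z = (poly G z - c1) / (c2 - c1)" for z
    by (simp add: N_def diff_divide_distrib)
  have GN: "shabat_equivalent G c1 c2 N 0 1"
    unfolding shabat_equivalent_def N_def
    by (rule exI[of _ "1 / (c2 - c1)"], rule exI[of _ "- c1 / (c2 - c1)"], rule exI[of _ 1], rule exI[of _ 0])
      (use c in \<open>simp add: divide_simps\<close>)
  have "degree N = degree G"
    unfolding N_def using c G by (subst degree_add_eq_left) (simp_all add: shabat_def)
  moreover have "pderiv N = smult (1 / (c2 - c1)) (pderiv G)"
    by (simp add: N_def pderiv_add pderiv_smult pderiv_pCons)
  ultimately have N: "shabat N 0 1"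
    using G c by (auto simp: shabat_def polyN)
  note NG = shabat_equivalent_sym[OF GN]
  have isoN: "isomorphic_maps (shabat_tree N 0 1) (shabat_tree F 0 1)"
    using shabat_equivalent_tree(3)[OF N NG] iso by (rule isomorphic_maps_trans)
  have mapN: "bicolored_map (shabat_tree N 0 1)" and mapF: "bicolored_map (shabat_tree F 0 1)"
    using shabat_tree_map N F by blast+
  have "passport (shabat_tree N 0 1) = \<pi>"
    using isomorphic_passport[OF mapN mapF isoN] pass by simp
  then consider "shabat_equivalent F 0 1 N 0 1" | "shabat_equivalent F' 0 1 N 0 1"
    using char[OF N] by blast
  then show "shabat_equivalent F 0 1 G c1 c2"
  proof cases
    case 1
    then show ?thesis using NG by (rule shabat_equivalent_trans)
  next
    case 2
    have "isomorphic_maps (shabat_tree F 0 1) (shabat_tree F' 0 1)"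
      using isomorphic_maps_sym[OF mapN mapF isoN] shabat_equivalent_tree(2)[OF F' 2]
      by (rule isomorphic_maps_trans)
    then show ?thesis using ni by blast
  qed
qed

theorem lemma7p1:
  fixes r s p n :: nat
    and C K :: complex
    and P Q1 Q2 F1 F2 :: "complex poly"
    and \<pi> :: "nat multiset \<times> nat multiset \<times> nat"
  assumes "r \<ge> 2" and "s > 0" and "p > 0" and "n > 0"
    and "n = 4 * p" and "n = 2 * r + s" and "p + s + 2 = n + 1"
    and "C = - 1 / 2"
    and "K = (- 1) ^ (r + 1) * of_nat (double_fact (2 * r - 1)) /
             (2 * of_nat (double_fact (2 * (r - 1))))"
    and "P = smult K (\<Sum>k = 0..r - 1.
               monom ((- 1) ^ k * of_nat ((r - 1) choose k) / of_nat (2 * r - 2 * k - 1))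
                     (2 * r - 2 * k - 1)) + [:C:]"
    and "Q1 = - ([:1, 2:] ^ 4) + 1"
    and "Q2 = smult 4 ([:0, 1:] * [:- 1, 1:] * [:- \<i>, 1:] * [:- 1 - \<i>, 1:])"
    and "F1 = Q1 \<circ>\<^sub>p P"
    and "F2 = Q2 \<circ>\<^sub>p (- (P \<circ>\<^sub>p [:0, \<i>:]))"
    and "\<pi> = (replicate_mset 2 r + replicate_mset s 1, replicate_mset p 4, n)"
  shows "\<exists>(T1 :: (complex, complex set) bicolored_map) (T2 :: (complex, complex set) bicolored_map).
           bicolored_plane_tree T1 \<and> passport T1 = \<pi> \<and>
           bicolored_plane_tree T2 \<and> passport T2 = \<pi> \<and>
           \<not> isomorphic_maps T1 T2 \<and>
           (\<forall>T :: ('v, 'e) bicolored_map. bicolored_plane_tree T \<and> passport T = \<pi> \<longrightarrow>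
              isomorphic_maps T T1 \<or> isomorphic_maps T T2) \<and>
           shabat_polynomial_of T1 F1 0 1 \<and>
           shabat_polynomial_of T2 F2 0 1 \<and>
           (\<forall>F c1 c2. shabat_polynomial_of T1 F c1 c2 \<longleftrightarrow> shabat_equivalent F1 0 1 F c1 c2) \<and>
           (\<forall>F c1 c2. shabat_polynomial_of T2 F c1 c2 \<longleftrightarrow> shabat_equivalent F2 0 1 F c1 c2)"
proof -
  have p: "p = 2 * r - 1" and n: "n = 8 * r - 4" and s: "s = 6 * r - 4"
    using assms(1,5,6,7) by linarith+
  have \<pi>: "\<pi> = hub_passport r" unfolding assms(15) hub_passport_def p n s ..
  have K0: "K \<noteq> 0"
    unfolding assms(9) using double_fact_nonzero by simp
  have P: "P = smult K (odd_primitive (r - 1)) + [:C:]"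
  proof -
    have "(\<Sum>k = 0..r - 1. monom ((- 1) ^ k * of_nat ((r - 1) choose k) / of_nat (2 * r - 2 * k - 1)) (2 * r - 2 * k - 1)) =
        odd_primitive (r - 1)"
      unfolding odd_primitive_def
    proof (intro sum.cong refl)
      fix k assume "k \<in> {0..r - 1}"
      then have "2 * r - 2 * k - 1 = 2 * (r - 1) + 1 - 2 * k" using assms(1) by auto
      then show "monom ((- 1) ^ k * of_nat ((r - 1) choose k) / of_nat (2 * r - 2 * k - 1)) (2 * r - 2 * k - 1) =
        (monom ((- 1) ^ k * of_nat ((r - 1) choose k) / of_nat (2 * (r - 1) + 1 - 2 * k)) (2 * (r - 1) + 1 - 2 * k) :: complex poly)"
        by (simp only:)
    qed
    then show ?thesis unfolding assms(10) by (simp only:)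
  qed
  have KW: "K * poly (odd_primitive (r - 1)) 1 = 1 / 2"
  proof -
    have "2 * (r - 1) + 1 = 2 * r - 1" using assms(1) by simp
    moreover have "(- 1 :: complex) ^ (r + 1) * (- 1) ^ (r - 1) = 1"
      using assms(1) by (simp flip: power_add)
    moreover have "(of_nat (double_fact (2 * r - 1)) :: complex) \<noteq> 0" "(of_nat (double_fact (2 * (r - 1))) :: complex) \<noteq> 0"
      using double_fact_nonzero by simp_all
    ultimately show ?thesis unfolding assms(9) odd_primitive_1 by (simp add: divide_simps mult_ac)
  qed
  interpret normalized_primitive P K r
  proof
    show "pderiv P = smult K ([:- 1, 0, 1:] ^ (r - 1))"
      by (simp add: P pderiv_add pderiv_smult pderiv_odd_primitive pderiv_pCons)
    show "poly P 1 = 0" using KW by (simp add: P assms(8))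
    show "poly P (- x) = - poly P x - 1" for x by (simp add: P assms(8) odd_primitive_minus)
  qed (use assms(1) K0 in auto)
  have F1: "F1 = fam (- 1)"
    by (rule poly_extI) (simp add: assms(11,13) poly_fam poly_pcompose poly_power algebra_simps)
  have F2: "F2 = fam \<i> \<circ>\<^sub>p [:0, \<i>:]"
  proof (rule poly_extI)
    fix x
    \<comment> \<open>For h = (1 - \<i>) q + 1 the values 1, \<i>, - \<i>, - 1 are taken at - q = 0,
      1, \<i>, 1 + \<i>, the roots of \<open>Q2\<close>; the factor 4 is - (1 - \<i>)^4.\<close>
    have "4 * (- q * (- q - 1) * (- q - \<i>) * (- q - 1 - \<i>)) = 1 - ((1 - \<i>) * q + 1) ^ 4" for q
      by (simp add: eval_nat_numeral algebra_simps)
    from this[of "poly P (\<i> * x)"] show "poly F2 x = poly (fam \<i> \<circ>\<^sub>p [:0, \<i>:]) x"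
      by (simp add: assms(12,14) poly_fam poly_pcompose algebra_simps)
  qed
  interpret Q1: quartic "smult 2 P + 1" 1 "- 1" "2 * K" r by (rule quartic_fam1)
  interpret Q2: quartic "smult (1 - \<i>) (P \<circ>\<^sub>p [:0, \<i>:]) + 1" \<i> "- \<i>" "(1 - \<i>) * \<i> * K * (- 1) ^ (r - 1)" r
    by (rule quartic_fam2)
  have Q1F: "Q1.F = F1" unfolding F1 Q1.F_def fam_def by simp
  have Q2F: "Q2.F = F2"
    by (rule poly_extI) (simp add: F2 Q2.F_def fam_def poly_pcompose poly_power)
  let ?T1 = "shabat_tree F1 0 1" and ?T2 = "shabat_tree F2 0 1"
  have sh: "shabat F1 0 1" "shabat F2 0 1" using Q1.shabat Q2.shabat by (simp_all add: Q1F Q2F)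
  have hub: "hub_map ?T1 r" "hub_map ?T2 r" using Q1.hub_map Q2.hub_map by (simp_all add: Q1F Q2F)
  have map: "bicolored_map ?T1" "bicolored_map ?T2" using shabat_tree_map sh by blast+
  have pass: "passport ?T1 = \<pi>" "passport ?T2 = \<pi>"
    using hub_map.pass[OF hub(1)] hub_map.pass[OF hub(2)] by (simp_all add: \<pi>)
  \<comment> \<open>The hub values are 1 and -1 for the first tree, and \<i> and 1 for the second.
    So d = 2 is the only type among 1, 2, 3 for the first and is impossible for the second.\<close>
  have val1: "- 1 = \<i> ^ d" if "hub_type ?T1 r d" for d
    using Q1.hub_type_value[of d] that by (auto simp: Q1F P_1 P_m1 minus_equation_iff[of 1])
  have val2: "\<i> ^ d * \<i> = 1 \<or> \<i> ^ d = \<i>" if "hub_type ?T2 r d" for d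
    using Q2.hub_type_value[of d] that by (auto simp: Q2F P_1 P_m1 poly_pcompose)
  have i3: "\<i> ^ 3 = - \<i>" by (simp add: eval_nat_numeral)
  have type1: "hub_type ?T1 r 2"
    using hub_map.hub_type_exists[OF hub(1)] val1[of 1] val1[of 3] by (auto simp: complex_eq_iff i3)
  have not2: "\<not> hub_type ?T2 r 2" using val2[of 2] by (auto simp: complex_eq_iff)
  have type2: "hub_type ?T2 r 1 \<or> hub_type ?T2 r 3"
    using hub_map.hub_type_exists[OF hub(2)] not2 by auto
  have ni: "\<not> isomorphic_maps ?T1 ?T2"
    using isomorphic_hub_type[OF map _ type1] not2 by blast
  have ni': "\<not> isomorphic_maps ?T2 ?T1"
    using isomorphic_maps_sym[OF map(2,1)] ni by blast
  have unique: "isomorphic_maps T ?T1 \<or> isomorphic_maps T ?T2"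
    if T: "bicolored_plane_tree T" "passport T = \<pi>" for T :: "('v, 'e) bicolored_map"
  proof -
    have "hub_map T r"
      by unfold_locales (use T \<pi> assms(1) in \<open>auto simp: bicolored_plane_tree_def\<close>)
    then show ?thesis using hub_map_two_types hub type1 type2 by blast
  qed
  have char: "shabat_equivalent F1 0 1 G 0 1 \<or> shabat_equivalent F2 0 1 G 0 1"
    if "shabat G 0 1" "passport (shabat_tree G 0 1) = \<pi>" for G
    using hub_passport_cases[OF that(1)] that(2) unfolding \<pi> F1 F2 by blast
  have char': "shabat_equivalent F2 0 1 G 0 1 \<or> shabat_equivalent F1 0 1 G 0 1"
    if "shabat G 0 1" "passport (shabat_tree G 0 1) = \<pi>" for G
    using char[OF that] by blast
  show ?thesis
  proof (intro exI conjI allI impI)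
    show "bicolored_plane_tree ?T1" "bicolored_plane_tree ?T2"
      using hub_map.plane_tree hub by blast+
    show "isomorphic_maps T ?T1 \<or> isomorphic_maps T ?T2"
      if "bicolored_plane_tree T \<and> passport T = \<pi>" for T :: "('v, 'e) bicolored_map"
      using unique that by blast
    show "shabat_polynomial_of ?T1 F1 0 1" "shabat_polynomial_of ?T2 F2 0 1"
      using sh map isomorphic_maps_refl by (simp_all add: shabat_polynomial_of_def)
    show "shabat_polynomial_of ?T1 F c1 c2 \<longleftrightarrow> shabat_equivalent F1 0 1 F c1 c2" for F c1 c2
      by (rule shabat_polynomial_of_iff[OF sh(1) pass(1) char sh(2) ni])
    show "shabat_polynomial_of ?T2 F c1 c2 \<longleftrightarrow> shabat_equivalent F2 0 1 F c1 c2" for F c1 c2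
      by (rule shabat_polynomial_of_iff[OF sh(2) pass(2) char' sh(1) ni'])
  qed (fact pass ni)+
qed

end
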